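(* Let $(B_t; t\ge 0)$ be standard one-dimensional Brownian motion and for $t\ge 0$ let $\alpha_t:=\sup\{s\in[0,1]: B_{t+s}=\inf_{u\in[0,1]}B_{t+u}\}$. Then $(\alpha_t;t\ge 0)$ is a Markov process with Feller transition semigroup $Q_t(x,\cdot)$, $t>0$, $x\in[0,1]$, where $$Q_t(x,dy)=\frac{1_{\{0<y<1\}}}{\pi\sqrt{y(1-y)}}\,dy\quad\text{for }0\le x\le 1<t,$$ $$Q_t(x,dy)=\sqrt{\frac{1-x}{1-x+t}}\,\delta_{x-t}(dy)+\frac{\sqrt{(y+t-1)^+}}{\pi(y+t-x)\sqrt{1-y}}\,dy\quad\text{for }0<t\le x\le 1,$$ $$Q_t(x,dy)=\frac{\sqrt{(1-x)(t-x)}+\sqrt{y(y+t-1)^+}}{\pi(y+t-x)\sqrt{y(1-y)}}\,dy\quad\text{for }0\le x<t\le 1.$$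
   Context: The process $(\alpha_t;t\ge0)$ is called the argmin process of Brownian motion; it has values in $[0,1]$. Here $z^+=\max(z,0)$, $\delta_a$ is the point mass at $a$, and $Q_t(x,\cdot)$ is a probability measure on $[0,1]$, all densities being with respect to Lebesgue measure on $0<y<1$. A Feller semigroup on $[0,1]$ is a strongly continuous semigroup of positive contractions on $C([0,1])$. *)

theory Defs
  imports "HOL-Probability.Probability"
begin

section \<open>Brownian motion and its argmin process\<close>

text \<open>Time is real-valued; only the values of a process at times \<open>t \<ge> 0\<close> are constrained.
  Every path is continuous, so that pathwise functionals such as the argmin are random variables
  without completing the probability space.\<close>

locale std_brownian_motion = prob_space M for M :: "'w measure" +
  fixes B :: "real \<Rightarrow> 'w \<Rightarrow> real"
  assumes random_variable_B: "\<And>t. 0 \<le> t \<Longrightarrow> random_variable borel (B t)"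
    and start_zero: "AE \<omega> in M. B 0 \<omega> = 0"
    and continuous_paths: "\<And>\<omega>. \<omega> \<in> space M \<Longrightarrow> continuous_on {0..} (\<lambda>t. B t \<omega>)"
    and gaussian_increments: "\<And>s t. 0 \<le> s \<Longrightarrow> s < t \<Longrightarrow>
      distributed M lborel (\<lambda>\<omega>. B t \<omega> - B s \<omega>) (normal_density 0 (sqrt (t - s)))"
    and indep_increments: "\<And>(n :: nat) (\<tau> :: nat \<Rightarrow> real).
      0 \<le> \<tau> 0 \<Longrightarrow> (\<forall>i<n. \<tau> i \<le> \<tau> (Suc i)) \<Longrightarrow>
      indep_vars (\<lambda>_. borel) (\<lambda>i \<omega>. B (\<tau> (Suc i)) \<omega> - B (\<tau> i) \<omega>) {..<n}"

definition argmin_process :: "(real \<Rightarrow> 'w \<Rightarrow> real) \<Rightarrow> real \<Rightarrow> 'w \<Rightarrow> real" where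
  "argmin_process B t \<omega> = Sup {s \<in> {0..1}. B (t + s) \<omega> = (INF u\<in>{0..1}. B (t + u) \<omega>)}"

section \<open>Markov processes\<close>

definition natural_filtration ::
    "'w measure \<Rightarrow> 's measure \<Rightarrow> (real \<Rightarrow> 'w \<Rightarrow> 's) \<Rightarrow> real \<Rightarrow> 'w measure" where
  "natural_filtration M S X s =
     sigma (space M) (\<Union>u\<in>{0..s}. {X u -` A \<inter> space M | A. A \<in> sets S})"

text \<open>\<open>X\<close> is an \<open>S\<close>-valued process, Markov with respect to its own filtration, whose conditional
  law at time \<open>s + t\<close> given the past up to time \<open>s\<close> is \<open>Q t (X s)\<close>.\<close>

definition markov_process ::
    "'w measure \<Rightarrow> 's measure \<Rightarrow> (real \<Rightarrow> 'w \<Rightarrow> 's) \<Rightarrow> (real \<Rightarrow> 's \<Rightarrow> 's measure) \<Rightarrow> bool" where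
  "markov_process M S X Q \<longleftrightarrow>
     (\<forall>t\<ge>0. X t \<in> M \<rightarrow>\<^sub>M S) \<and>
     (\<forall>s\<ge>0. \<forall>t>0. \<forall>A\<in>sets S.
        AE \<omega> in M. real_cond_exp M (natural_filtration M S X s)
            (indicat_real (X (s + t) -` A \<inter> space M)) \<omega> = measure (Q t (X s \<omega>)) A)"

section \<open>Feller semigroups on the unit interval\<close>

text \<open>An element of \<open>C([0,1])\<close> is represented by any function \<open>real \<Rightarrow> real\<close> that is continuous on
  \<open>{0..1}\<close>; values outside \<open>{0..1}\<close> carry no information, which is why \<open>cong\<close> is required of an
  operator on \<open>C([0,1])\<close>.\<close>

locale feller_semigroup_01 =
  fixes T :: "real \<Rightarrow> (real \<Rightarrow> real) \<Rightarrow> real \<Rightarrow> real"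
  assumes continuous: "\<And>t f. 0 \<le> t \<Longrightarrow> continuous_on {0..1} f \<Longrightarrow> continuous_on {0..1} (T t f)"
    and cong: "\<And>t f g x. 0 \<le> t \<Longrightarrow> continuous_on {0..1} f \<Longrightarrow> continuous_on {0..1} g \<Longrightarrow>
      (\<forall>y\<in>{0..1}. f y = g y) \<Longrightarrow> x \<in> {0..1} \<Longrightarrow> T t f x = T t g x"
    and linear: "\<And>t f g a b x. 0 \<le> t \<Longrightarrow> continuous_on {0..1} f \<Longrightarrow> continuous_on {0..1} g \<Longrightarrow>
      x \<in> {0..1} \<Longrightarrow> T t (\<lambda>y. a * f y + b * g y) x = a * T t f x + b * T t g x"
    and positive: "\<And>t f x. 0 \<le> t \<Longrightarrow> continuous_on {0..1} f \<Longrightarrow> (\<forall>y\<in>{0..1}. 0 \<le> f y) \<Longrightarrow>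
      x \<in> {0..1} \<Longrightarrow> 0 \<le> T t f x"
    and contraction: "\<And>t f. 0 \<le> t \<Longrightarrow> continuous_on {0..1} f \<Longrightarrow>
      (SUP x\<in>{0..1}. \<bar>T t f x\<bar>) \<le> (SUP x\<in>{0..1}. \<bar>f x\<bar>)"
    and identity: "\<And>f x. continuous_on {0..1} f \<Longrightarrow> x \<in> {0..1} \<Longrightarrow> T 0 f x = f x"
    and semigroup: "\<And>s t f x. 0 \<le> s \<Longrightarrow> 0 \<le> t \<Longrightarrow> continuous_on {0..1} f \<Longrightarrow> x \<in> {0..1} \<Longrightarrow>
      T (s + t) f x = T s (T t f) x"
    and strongly_continuous: "\<And>f. continuous_on {0..1} f \<Longrightarrow>
      ((\<lambda>t. SUP x\<in>{0..1}. \<bar>T t f x - f x\<bar>) \<longlongrightarrow> 0) (at_right 0)"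

abbreviation borel_01 :: "real measure" where
  "borel_01 \<equiv> restrict_space borel {0..1}"

definition feller_transition_semigroup_01 :: "(real \<Rightarrow> real \<Rightarrow> real measure) \<Rightarrow> bool" where
  "feller_transition_semigroup_01 Q \<longleftrightarrow>
     (\<forall>t\<ge>0. Q t \<in> borel_01 \<rightarrow>\<^sub>M prob_algebra borel_01) \<and>
     (\<forall>x\<in>{0..1}. Q 0 x = return borel_01 x) \<and>
     (\<forall>s\<ge>0. \<forall>t\<ge>0. \<forall>x\<in>{0..1}. Q (s + t) x = Q s x \<bind> Q t) \<and>
     feller_semigroup_01 (\<lambda>t f x. \<integral>y. f y \<partial>Q t x)"

section \<open>The transition kernels of the argmin process\<close>

definition sum_measure :: "'a measure \<Rightarrow> 'a measure \<Rightarrow> 'a measure" where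
  "sum_measure M N = measure_of (space M) (sets M) (\<lambda>A. emeasure M A + emeasure N A)"

lemma space_sum_measure [simp]: "space (sum_measure M N) = space M"
  by (simp add: sum_measure_def)

lemma sets_sum_measure [simp]: "sets (sum_measure M N) = sets M"
  by (simp add: sum_measure_def)

lemma emeasure_sum_measure:
  assumes N: "sets N = sets M" and A: "A \<in> sets M"
  shows "emeasure (sum_measure M N) A = emeasure M A + emeasure N A"
  unfolding sum_measure_def
proof (rule emeasure_measure_of_sigma[OF _ _ _ A])
  show "sigma_algebra (space M) (sets M)" ..
  show "positive (sets M) (\<lambda>A. emeasure M A + emeasure N A)"
    by (simp add: positive_def)
  show "countably_additive (sets M) (\<lambda>A. emeasure M A + emeasure N A)"
  proof (rule countably_additiveI)
    fix F :: "nat \<Rightarrow> 'a set"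
    assume F: "range F \<subseteq> sets M" "disjoint_family F" "(\<Union>i. F i) \<in> sets M"
    then show "(\<Sum>i. emeasure M (F i) + emeasure N (F i)) =
        emeasure M (\<Union>i. F i) + emeasure N (\<Union>i. F i)"
      using N by (simp add: suminf_add[symmetric] suminf_emeasure)
  qed
qed

text \<open>The measure on \<open>[0,1]\<close> with density \<open>f\<close> with respect to Lebesgue measure on \<open>0 < y < 1\<close>.\<close>

definition density_01 :: "(real \<Rightarrow> real) \<Rightarrow> real measure" where
  "density_01 f = density (restrict_space lborel {0..1}) (\<lambda>y. ennreal (indicator {0<..<1} y * f y))"

text \<open>The positive part \<open>max (y + t - 1) 0\<close> cannot be dropped, because \<^const>\<open>sqrt\<close> is negative on
  negative reals. At time \<open>0\<close> the kernel is the identity.\<close>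

definition argmin_kernel :: "real \<Rightarrow> real \<Rightarrow> real measure" where
  "argmin_kernel t x =
    (if t \<le> 0 then return borel_01 x
     else if 1 < t then
       density_01 (\<lambda>y. 1 / (pi * sqrt (y * (1 - y))))
     else if t \<le> x then
       sum_measure
         (scale_measure (ennreal (sqrt ((1 - x) / (1 - x + t)))) (return borel_01 (x - t)))
         (density_01 (\<lambda>y. sqrt (max (y + t - 1) 0) / (pi * (y + t - x) * sqrt (1 - y))))
     else
       density_01 (\<lambda>y. (sqrt ((1 - x) * (t - x)) + sqrt (y * max (y + t - 1) 0))
                        / (pi * (y + t - x) * sqrt (y * (1 - y)))))"

end

theory Submission
  imports Defs
begin

text \<open>
  Discretise Brownian motion on a grid of mesh \<open>1/n\<close>. For a random walk with symmetric continuous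
  increments the index of the minimum over a sliding window of \<open>n + 1\<close> points is a Markov chain: given
  that the minimum of the window is at \<open>c\<close>, the past of the chain is a function of the walk before \<open>c\<close>,
  while the walk after \<open>c\<close> is only conditioned to stay above its starting point until the end of the
  window. By the Sparre Andersen theorem and renewal at the successive minima its \<open>k\<close>-step transition
  probabilities are explicit rational expressions in \<open>u m = (2m choose m) / 4^m\<close>. Since
  \<open>u m ~ 1 / sqrt (pi m)\<close>, Scheffe's lemma turns them into the kernel \<open>Q\<close> in the limit, and the discrete
  argmins converge almost surely because the minimum of a Brownian path over an interval is attained
  only once. The semigroup property needs no integration of kernels: it follows from the Markov
  property of the process, the Feller property, and the full support of the arcsine law.
\<close>

section \<open>The probabilities of staying positive\<close>

text \<open>In continuous time one would have to condition on the null event that the path stays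
  above its value at the minimum. On the grid this event has the positive probability
  \<open>persist (N - j)\<close>, and plain independence suffices. The formula for the transition
  probabilities is restricted to lags up to the window length, where the old and the new window
  together leave no index uncovered. Lags \<open>t > 1\<close> are reached through the time at
  distance 1 before the target, from which the kernel forgets its start. The limiting densities have
  integrable singularities; Scheffe's lemma replaces a majorant by convergence of total masses. On
  the grid these are one because the numbers are conditional probabilities, and in the limit because
  of an explicit arctangent integral. The limit of the transition probabilities is taken only at
  starting points other than 0, 1 and \<open>t\<close>, which the argmin process almost surely
  avoids. So the process sees the kernel only almost everywhere, and an identity for every starting
  point has to come from continuity.\<close>

text \<open>\<open>persist n\<close> is \<open>(2n choose n) / 4^n\<close>, the probability that a symmetric continuous random walk
  stays positive for \<open>n\<close> steps.\<close>

primrec persist :: "nat \<Rightarrow> real" where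
  "persist 0 = 1"
| "persist (Suc n) = persist n * (2 * real n + 1) / (2 * real n + 2)"

lemma persist_pos: "0 < persist n"
  by (induction n) auto

lemma persist_nonneg [simp]: "0 \<le> persist n"
  using persist_pos[of n] by simp

lemma persist_neq_0 [simp]: "persist n \<noteq> 0"
  using persist_pos[of n] by simp

lemma gbinomial_Suc_right:
  fixes a :: "'a :: field_char_0"
  shows "(a gchoose Suc n) = (a gchoose n) * (a - of_nat n) / (of_nat n + 1)"
  by (simp add: gbinomial_prod_rev divide_simps add.commute)

text \<open>The generating function of the sequence is \<open>(1 - z) powr (- 1 / 2)\<close>; in
  this form convolutions fall under Vandermonde's identity.\<close>

lemma persist_gbinomial: "persist n = (- 1) ^ n * ((- (1 / 2)) gchoose n)"
proof (induction n)
  case (Suc n)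
  have "(2 * real n + 1) / (2 * real n + 2) = - ((- (1 / 2) - real n) / (real n + 1))"
    by (simp add: divide_simps)
  then show ?case by (simp add: Suc gbinomial_Suc_right times_divide_eq_right[symmetric] del: times_divide_eq_right)
qed simp

text \<open>The square of the generating function is \<open>1 / (1 - z)\<close>, all of whose
  coefficients are 1. Formally this is Vandermonde's identity with upper arguments adding up to
  \<open>- 1\<close>.\<close>

lemma persist_convolution: "(\<Sum>m\<le>n. persist m * persist (n - m)) = 1"
proof -
  have g1: "(- 1 :: real) gchoose n = (- 1) ^ n"
  proof (induction n)
    case (Suc n)
    have "(- 1 - real n) / (real n + 1) = - 1" by (simp add: divide_simps)
    then show ?case by (simp add: gbinomial_Suc_right Suc times_divide_eq_right[symmetric] del: times_divide_eq_right)
  qed simp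
  have "(\<Sum>m\<le>n. persist m * persist (n - m))
      = (\<Sum>m\<le>n. (- 1) ^ n * (((- (1 / 2)) gchoose m) * ((- (1 / 2)) gchoose (n - m))))"
  proof (intro sum.cong refl)
    fix m assume "m \<in> {..n}"
    then have "(- 1 :: real) ^ n = (- 1) ^ m * (- 1) ^ (n - m)"
      by (simp flip: power_add)
    then show "persist m * persist (n - m)
        = (- 1) ^ n * (((- (1 / 2)) gchoose m) * ((- (1 / 2)) gchoose (n - m)))"
      by (simp add: persist_gbinomial)
  qed
  also have "\<dots> = (- 1) ^ n * ((- (1 / 2) + - (1 / 2)) gchoose n)"
    using gbinomial_Vandermonde[of "- (1 / 2) :: real" "- (1 / 2)" n]
    by (simp add: sum_distrib_left[symmetric] atLeast0AtMost)
  also have "\<dots> = 1"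
    using g1 by (simp flip: power_mult_distrib)
  finally show ?thesis .
qed

text \<open>The terms \<open>m = 0\<close> and \<open>m = n\<close> contribute
  \<open>2 * a n\<close>, so the identity determines \<open>a n\<close> from the earlier values.
  This turns a decomposition of the probability space into the Sparre Andersen formula, without
  computing any probability directly.\<close>

lemma persist_unique:
  fixes a :: "nat \<Rightarrow> real"
  assumes "a 0 = 1" and conv: "\<And>n. (\<Sum>m\<le>n. a m * a (n - m)) = 1"
  shows "a n = persist n"
proof (induction n rule: less_induct)
  case (less n)
  show ?case
  proof (cases n)
    case (Suc k)
    have split: "(\<Sum>m\<le>n. b m * b (n - m)) = 2 * b n + (\<Sum>m=1..k. b m * b (n - m))"
      if "b 0 = (1::real)" for b
    proof -
      have "{..n} = insert 0 (insert n {1..k})" using Suc by auto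
      then show ?thesis using Suc that by simp
    qed
    have "(\<Sum>m=1..k. a m * a (n - m)) = (\<Sum>m=1..k. persist m * persist (n - m))"
      using less Suc by (intro sum.cong) auto
    then show ?thesis
      using split[of a] split[of persist] conv[of n] persist_convolution[of n] assms(1) by simp
  qed (simp add: assms)
qed

text \<open>A finite form of Wallis' product, from which the asymptotics of \<open>persist\<close>
  are read off.\<close>

lemma persist_square: "(persist n)\<^sup>2 * (2 * real n + 1) * (\<Prod>k=1..n. (4 * real k ^ 2) / (4 * real k ^ 2 - 1)) = 1"
proof (induction n)
  case (Suc n)
  have "4 * (real (Suc n))\<^sup>2 - 1 = (2 * real n + 1) * (2 * real n + 3)"
    by (simp add: power2_eq_square algebra_simps)
  moreover have "4 * (real (Suc n))\<^sup>2 = (2 * real n + 2)\<^sup>2"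
    by (simp add: power2_eq_square algebra_simps)
  ultimately have "(persist (Suc n))\<^sup>2 * (2 * real (Suc n) + 1) *
      (\<Prod>k=1..Suc n. (4 * real k ^ 2) / (4 * real k ^ 2 - 1))
     = (persist n)\<^sup>2 * ((2 * real n + 1)\<^sup>2 / (2 * real n + 2)\<^sup>2) * (2 * real n + 3) *
       ((\<Prod>k=1..n. (4 * real k ^ 2) / (4 * real k ^ 2 - 1)) *
       ((2 * real n + 2)\<^sup>2 / ((2 * real n + 1) * (2 * real n + 3))))"
    by (simp add: power_divide power_mult_distrib add.commute)
  also have "\<dots> = (persist n)\<^sup>2 * (\<Prod>k=1..n. (4 * real k ^ 2) / (4 * real k ^ 2 - 1)) *
       (((2 * real n + 1)\<^sup>2 / (2 * real n + 2)\<^sup>2) * (2 * real n + 3) *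
       ((2 * real n + 2)\<^sup>2 / ((2 * real n + 1) * (2 * real n + 3))))"
    by (simp only: mult_ac)
  also have "(((2 * real n + 1)\<^sup>2 / (2 * real n + 2)\<^sup>2) * (2 * real n + 3) *
       ((2 * real n + 2)\<^sup>2 / ((2 * real n + 1) * (2 * real n + 3)))) = 2 * real n + 1"
  proof -
    have "(a\<^sup>2 / b\<^sup>2) * c * (b\<^sup>2 / (a * c)) = a" if "a > 0" "b > 0" "c > 0" for a b c :: real
      using that by (simp add: power2_eq_square)
    from this[of "2 * real n + 1" "2 * real n + 2" "2 * real n + 3"] show ?thesis by linarith
  qed
  finally show ?case using Suc by (simp only: mult_ac)
qed simp

lemma sqrt_persist_tendsto: "(\<lambda>n. sqrt (real n) * persist n) \<longlonglongrightarrow> 1 / sqrt pi"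
proof -
  define W where "W n = (\<Prod>k=1..n. (4 * real k ^ 2) / (4 * real k ^ 2 - 1))" for n
  have Wpos: "W n > 0" for n
    unfolding W_def
  proof (rule prod_pos)
    fix k assume "k \<in> {1..n}"
    then have "1 \<le> (real k)\<^sup>2" by (simp add: one_le_power)
    then show "0 < 4 * (real k)\<^sup>2 / (4 * (real k)\<^sup>2 - 1)" by (intro divide_pos_pos) linarith+
  qed
  have sq: "sqrt (real n) * persist n = sqrt (real n / (2 * real n + 1) / W n)" for n
  proof -
    have "(persist n)\<^sup>2 = 1 / (2 * real n + 1) / W n"
    proof -
      have "x = 1 / b / w" if "x * b * w = 1" "b > 0" "w > 0" for x b w :: real
        using that by (simp add: eq_divide_eq)
      then show ?thesis
        using persist_square[of n] Wpos[of n] unfolding W_def[symmetric] by simp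
    qed
    then have "persist n = sqrt (1 / (2 * real n + 1) / W n)"
      by (metis persist_nonneg real_sqrt_unique)
    then show ?thesis by (simp add: real_sqrt_mult[symmetric])
  qed
  have "(\<lambda>n. real n / (2 * real n + 1)) \<longlonglongrightarrow> 1 / 2"
  proof -
    have "(\<lambda>n. inverse (2 + inverse (real n))) \<longlonglongrightarrow> inverse (2 + 0)"
      by (intro tendsto_inverse tendsto_add tendsto_const lim_inverse_n) simp
    moreover have "\<forall>\<^sub>F n in sequentially. inverse (2 + inverse (real n)) = real n / (2 * real n + 1)"
      using eventually_gt_at_top[of 0] by eventually_elim (simp add: field_simps)
    ultimately show ?thesis by (simp add: tendsto_cong)
  qed
  then have "(\<lambda>n. sqrt (real n / (2 * real n + 1) / W n)) \<longlonglongrightarrow> sqrt (1 / 2 / (pi / 2))"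
    using wallis by (intro tendsto_real_sqrt tendsto_divide[of "\<lambda>n. real n / (2 * real n + 1)" _ _ W]) (auto simp: W_def[abs_def])
  then show ?thesis unfolding sq by (simp add: real_sqrt_divide)
qed

text \<open>The form in which the asymptotics enter the limit theorem: each occurrence of
  \<open>persist\<close> at an index proportional to \<open>n\<close> accounts for one factor
  \<open>1 / sqrt n\<close>.\<close>

lemma persist_scaling:
  assumes lim: "(\<lambda>n. real (m n) / real n) \<longlonglongrightarrow> y" and y: "0 < y"
  shows "(\<lambda>n. sqrt (real n) * persist (m n)) \<longlonglongrightarrow> 1 / sqrt (pi * y)"
proof -
  have ev: "\<forall>\<^sub>F n in sequentially. y / 2 < real (m n) / real n"
    using order_tendstoD(1)[OF lim, of "y / 2"] y by simp
  have "filterlim m sequentially sequentially"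
  proof -
    have "filterlim (\<lambda>n. y / 2 * real n) at_top sequentially"
      using y by (intro filterlim_tendsto_pos_mult_at_top[OF tendsto_const] filterlim_real_sequentially) auto
    moreover have "\<forall>\<^sub>F n in sequentially. y / 2 * real n \<le> real (m n)"
      using ev eventually_gt_at_top[of 0] by eventually_elim (simp add: field_simps)
    ultimately have "filterlim (\<lambda>n. real (m n)) at_top sequentially"
      by (rule filterlim_at_top_mono)
    then show ?thesis by (simp add: filterlim_sequentially_iff_filterlim_real)
  qed
  then have 1: "(\<lambda>n. sqrt (real (m n)) * persist (m n)) \<longlonglongrightarrow> 1 / sqrt pi"
    using sqrt_persist_tendsto by (rule filterlim_compose[rotated])
  have "(\<lambda>n. sqrt (real (m n)) * persist (m n) / sqrt (real (m n) / real n)) \<longlonglongrightarrow> 1 / sqrt pi / sqrt y"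
    using y by (intro tendsto_divide 1 tendsto_real_sqrt lim) auto
  moreover have "\<forall>\<^sub>F n in sequentially. sqrt (real (m n)) * persist (m n) / sqrt (real (m n) / real n)
       = sqrt (real n) * persist (m n)"
    using ev eventually_gt_at_top[of 0]
  proof eventually_elim
    case (elim n)
    then have "m n > 0" using y by (cases "m n") auto
    then show ?case using elim by (simp add: real_sqrt_divide)
  qed
  ultimately show ?thesis by (simp add: tendsto_cong real_sqrt_mult)
qed

lemma persist_tendsto_0: "persist \<longlonglongrightarrow> 0"
proof -
  have "(\<lambda>n. sqrt (real n) * persist n * inverse (sqrt (real n))) \<longlonglongrightarrow> 1 / sqrt pi * 0"
    by (intro tendsto_mult sqrt_persist_tendsto)
      (rule tendsto_inverse_0_at_top, intro filterlim_compose[OF sqrt_at_top filterlim_real_sequentially])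
  moreover have "\<forall>\<^sub>F n in sequentially. sqrt (real n) * persist n * inverse (sqrt (real n)) = persist n"
    using eventually_gt_at_top[of 0] by eventually_elim simp
  ultimately show ?thesis by (simp add: tendsto_cong)
qed

section \<open>The argmin chain of a symmetric random walk\<close>

text \<open>The inductive step shared by \<open>prob_below_both\<close> and
  \<open>prob_below_tail\<close>. By the recursion of \<open>persist\<close>, all terms are
  multiples of \<open>persist L * persist r\<close>, which leaves an identity between rational
  functions of \<open>L\<close> and \<open>r\<close>.\<close>

lemma persist_ladder_identity:
  assumes "0 < i" and i: "i = Suc (r + L)"
  shows "persist L * persist (Suc r) * real (Suc r) / real i
       = persist (Suc L) * persist r * real r / real i + (persist L - persist (Suc L)) * persist r"
proof -
  have eq: "a / (L + r + 1) * (2 * r + 1) / 2 = a * (2 * L + 1) / (2 * L + 2) * r / (L + r + 1) + a * (1 - (2 * L + 1) / (2 * L + 2))"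
    if "L \<ge> 0" "r \<ge> 0" for a L r :: real
    using that by (simp add: divide_simps) (simp add: algebra_simps)
  have "persist L * persist (Suc r) * real (Suc r) / real i
     = persist L * persist r / (real L + real r + 1) * (2 * real r + 1) / 2"
    unfolding i by (simp add: divide_simps) (simp add: algebra_simps)
  also have "\<dots> = persist L * persist r * (2 * real L + 1) / (2 * real L + 2) * real r / (real L + real r + 1)
      + persist L * persist r * (1 - (2 * real L + 1) / (2 * real L + 2))"
    by (rule eq) auto
  also have "\<dots> = persist (Suc L) * persist r * real r / real i + (persist L - persist (Suc L)) * persist r"
    unfolding i by (simp add: algebra_simps)
  finally show ?thesis .
qed

text \<open>Taking the last minimiser parallels the \<open>Sup\<close> in
  \<open>argmin_process\<close>. It also gives paths with ties a definite value, so that the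
  truncation property below holds for every path.\<close>

definition last_argmin :: "(nat \<Rightarrow> real) \<Rightarrow> nat \<Rightarrow> nat" where
  "last_argmin f N = Max {j. j \<le> N \<and> (\<forall>i\<le>N. f j \<le> f i)}"

lemma last_argmin_eq_iff:
  "last_argmin f N = j \<longleftrightarrow> j \<le> N \<and> (\<forall>i<j. f j \<le> f i) \<and> (\<forall>i\<in>{j<..N}. f j < f i)"
proof -
  let ?S = "{j. j \<le> N \<and> (\<forall>i\<le>N. f j \<le> f i)}"
  have fin: "finite ?S" by simp
  obtain i0 where "i0 \<in> {..N}" "\<forall>i\<in>{..N}. f i0 \<le> f i"
    using ex_min_if_finite[of "f ` {..N}"] by (auto simp: not_less)
  then have ne: "?S \<noteq> {}" by auto
  have "last_argmin f N = j \<longleftrightarrow> j \<in> ?S \<and> (\<forall>i\<in>?S. i \<le> j)"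
    unfolding last_argmin_def using Max_eq_iff[OF fin ne, of j] by auto
  also have "\<dots> \<longleftrightarrow> j \<le> N \<and> (\<forall>i<j. f j \<le> f i) \<and> (\<forall>i\<in>{j<..N}. f j < f i)"
  proof safe
    fix i assume *: "j \<le> N" "\<forall>i\<le>N. f j \<le> f i" "\<forall>i\<in>?S. i \<le> j" "i \<in> {j<..N}"
    show "f j < f i"
    proof (rule ccontr)
      assume "\<not> f j < f i"
      then have "i \<in> ?S" using * by (auto intro: order_trans)
      then show False using * by auto
    qed
  next
    fix i assume *: "j \<le> N" "\<forall>i<j. f j \<le> f i" "\<forall>i\<in>{j<..N}. f j < f i" "i \<le> N"
    then show "f j \<le> f i" by (cases i j rule: linorder_cases) (auto simp: less_imp_le)
  next
    fix i assume *: "j \<le> N" "\<forall>i\<in>{j<..N}. f j < f i" "i \<le> N" "\<forall>k\<le>N. f i \<le> f k"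
    then show "i \<le> j" by (meson greaterThanAtMost_iff not_le)
  qed auto
  finally show ?thesis .
qed

lemma last_argmin_le: "last_argmin f N \<le> N"
  using last_argmin_eq_iff[of f N "last_argmin f N"] by simp

lemma last_argmin_min: "i \<le> N \<Longrightarrow> f (last_argmin f N) \<le> f i"
  using last_argmin_eq_iff[of f N "last_argmin f N"]
  by (cases i "last_argmin f N" rule: linorder_cases) (auto simp: less_imp_le)

text \<open>Hence, once the argmin of a window is known to be \<open>c\<close>, the argmins of all earlier windows are
  functions of the values up to \<open>c\<close>.\<close>

lemma last_argmin_truncate:
  assumes j: "last_argmin (\<lambda>i. f (\<sigma> + i)) N = j" and "\<sigma>' \<le> \<sigma>"
  shows "last_argmin (\<lambda>i. f (\<sigma>' + i)) N = last_argmin (\<lambda>i. f (\<sigma>' + i)) (min N (\<sigma> + j - \<sigma>'))"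
proof -
  define n where "n = min N (\<sigma> + j - \<sigma>')"
  define m where "m = last_argmin (\<lambda>i. f (\<sigma>' + i)) n"
  have J: "j \<le> N" "\<forall>i\<in>{j<..N}. f (\<sigma> + j) < f (\<sigma> + i)"
    using j by (auto simp: last_argmin_eq_iff)
  have m: "m \<le> n" "\<forall>i<m. f (\<sigma>' + m) \<le> f (\<sigma>' + i)" "\<forall>i\<in>{m<..n}. f (\<sigma>' + m) < f (\<sigma>' + i)"
    using last_argmin_eq_iff[of "\<lambda>i. f (\<sigma>' + i)" n m] by (auto simp: m_def)
  \<comment> \<open>Such an index lies to the right of the later argmin \<open>\<sigma> + j\<close>
    and still inside the later window. So its value strictly exceeds that at
    \<open>\<sigma> + j\<close>, which is at least the minimum over the truncated window.\<close>
  have "f (\<sigma>' + m) < f (\<sigma>' + i)" if i: "i \<in> {n<..N}" for i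
  proof -
    have n: "n = \<sigma> + j - \<sigma>'" using i by (auto simp: n_def min_def split: if_splits)
    have "f (\<sigma>' + m) \<le> f (\<sigma>' + n)"
      unfolding m_def by (rule last_argmin_min[of n n "\<lambda>i. f (\<sigma>' + i)"]) simp
    also have "\<sigma>' + n = \<sigma> + j" using n assms(2) by simp
    also have "f (\<sigma> + j) < f (\<sigma> + (\<sigma>' + i - \<sigma>))"
      using J(2) i n assms(2) by (intro bspec[OF J(2)]) auto
    also have "\<sigma> + (\<sigma>' + i - \<sigma>) = \<sigma>' + i" using i n assms(2) by auto
    finally show ?thesis .
  qed
  then have "last_argmin (\<lambda>i. f (\<sigma>' + i)) N = m"
    using m unfolding last_argmin_eq_iff
    by (metis greaterThanAtMost_iff min.cobounded1 n_def not_le_imp_less order_trans)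
  then show ?thesis by (simp add: m_def n_def)
qed

lemma last_argmin_distinct_iff:
  assumes "inj_on f {..N}"
  shows "last_argmin f N = j \<longleftrightarrow> j \<le> N \<and> (\<forall>i\<in>{..N} - {j}. f j < f i)"
proof -
  have "(\<forall>i<j. f j \<le> f i) \<longleftrightarrow> (\<forall>i<j. f j < f i)" if "j \<le> N"
    using that assms by (fastforce simp: inj_on_def order_less_le)
  moreover have "(\<forall>i\<in>{..N} - {j}. f j < f i) \<longleftrightarrow> (\<forall>i<j. f j < f i) \<and> (\<forall>i\<in>{j<..N}. f j < f i)" if "j \<le> N"
    using that by (auto; metis greaterThanAtMost_iff linorder_neqE_nat)
  ultimately show ?thesis
    unfolding last_argmin_eq_iff by blast
qed

text \<open>The part of the transition that acquires a density in the limit, kept apart from the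
  atom. The first summand belongs to an old argmin that has left the window, the second to a new
  overall minimum; \<open>persist (N - m)\<close> is the cost of staying above the new argmin until
  the window ends. Dividing by \<open>persist (N - j)\<close> conditions on the walk staying above
  the old argmin up to the end of the old window; in the second summand this factor has
  cancelled.\<close>

definition refresh_transition :: "nat \<Rightarrow> nat \<Rightarrow> nat \<Rightarrow> nat \<Rightarrow> real" where
  "refresh_transition N k j m =
     (if j < k then persist m * persist (k - j) * real (k - j) / (real (m + k - j) * persist (N - j)) * persist (N - m) else 0)
   + (if N < m + k then persist (m + k - N) * real (m + k - N) / real (m + k - j) * persist (N - m) else 0)"

lemma refresh_transition_nonneg: "0 \<le> refresh_transition N k j m"
  unfolding refresh_transition_def by (intro add_nonneg_nonneg) auto

text \<open>The \<open>k\<close>-step transition probabilities, for \<open>k \<le> N\<close>, of the index at which a random walk attains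
  its minimum over a sliding window of \<open>N + 1\<close> points.\<close>

definition argmin_transition :: "nat \<Rightarrow> nat \<Rightarrow> nat \<Rightarrow> nat \<Rightarrow> real" where
  "argmin_transition N k j m = refresh_transition N k j m
     + (if k \<le> j \<and> m = j - k then persist (N - j + k) / persist (N - j) else 0)"

lemma argmin_transition_nonneg: "0 \<le> argmin_transition N k j m"
  unfolding argmin_transition_def by (intro add_nonneg_nonneg refresh_transition_nonneg) auto

text \<open>Used to shift the sequence of steps and to read it backwards.\<close>

lemma (in prob_space) indep_vars_reindex:
  assumes "inj_on f I" and X: "indep_vars (\<lambda>_. N) X (f ` I)"
  shows "indep_vars (\<lambda>_. N) (\<lambda>i. X (f i)) I"
  unfolding indep_vars_def2 indep_sets_def
proof (intro conjI ballI allI impI)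
  let ?F = "\<lambda>i. {X i -` A \<inter> space M | A. A \<in> sets N}"
  show "random_variable N (X (f i))" if "i \<in> I" for i
    using X that by (auto simp: indep_vars_def)
  show "?F (f i) \<subseteq> events" if "i \<in> I" for i
    using X that by (auto simp: indep_vars_def)
  fix J A assume J: "J \<subseteq> I" "J \<noteq> {}" "finite J" and A: "A \<in> Pi J (\<lambda>i. ?F (f i))"
  have inj: "inj_on f J" using assms(1) J(1) by (rule inj_on_subset)
  define A' where "A' = A \<circ> the_inv_into J f"
  have A': "A' (f j) = A j" if "j \<in> J" for j
    using that inj by (simp add: A'_def the_inv_into_f_f)
  have "indep_sets ?F (f ` I)" using X by (simp add: indep_vars_def2)
  then have "prob (\<Inter>k\<in>f ` J. A' k) = (\<Prod>k\<in>f ` J. prob (A' k))"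
    using J A by (intro indep_setsD) (auto simp: A' Pi_iff)
  then show "prob (\<Inter>j\<in>J. A j) = (\<Prod>j\<in>J. prob (A j))"
    using A' by (simp add: prod.reindex[OF inj])
qed

text \<open>Continuity of the step law is asked for only through \<open>no_ties\<close>, which makes
  the partial sums almost surely distinct. For Brownian increments this is immediate, since the sum
  over a block is again a Gaussian increment.\<close>

locale symmetric_walk = prob_space M for M :: "'w measure" +
  fixes X :: "nat \<Rightarrow> 'w \<Rightarrow> real" and \<nu> :: "real measure"
  assumes indep: "indep_vars (\<lambda>_. borel) X UNIV"
    and distr_X: "\<And>i. distr M borel (X i) = \<nu>"
    and distr_uminus: "distr \<nu> borel uminus = \<nu>"
    and no_ties: "\<And>a b. a < b \<Longrightarrow> AE \<omega> in M. (\<Sum>l=a..<b. X l \<omega>) \<noteq> 0"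
begin

definition S :: "nat \<Rightarrow> 'w \<Rightarrow> real" where
  "S n \<omega> = (\<Sum>l<n. X l \<omega>)"

lemma S_diff: "a \<le> b \<Longrightarrow> S b \<omega> - S a \<omega> = (\<Sum>l=a..<b. X l \<omega>)"
  unfolding S_def by (simp add: lessThan_atLeast0 sum_diff_nat_ivl)

lemma AE_inj_S: "AE \<omega> in M. inj (\<lambda>n. S n \<omega>)"
proof -
  have "AE \<omega> in M. a < b \<longrightarrow> S a \<omega> \<noteq> S b \<omega>" for a b
  proof (cases "a < b")
    case True
    from no_ties[OF True] show ?thesis
      by eventually_elim (metis True S_diff diff_self less_imp_le)
  qed simp
  then have "AE \<omega> in M. \<forall>a b. a < b \<longrightarrow> S a \<omega> \<noteq> S b \<omega>"
    by (simp add: AE_all_countable)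
  then show ?thesis
    by eventually_elim (metis injI linorder_neqE_nat)
qed

text \<open>With the information organised by index sets of steps, every independence claim about
  the walk reduces to the disjointness of two sets of naturals.\<close>

definition steps :: "nat set \<Rightarrow> 'w measure" where
  "steps J = sigma (space M) (\<Union>i\<in>J. {X i -` A \<inter> space M | A. A \<in> sets borel})"

lemma space_steps [simp]: "space (steps J) = space M"
  by (simp add: steps_def space_measure_of_conv)

lemma random_variable_X [measurable]: "X i \<in> borel_measurable M"
  using indep by (auto simp: indep_vars_def)

lemma sets_steps: "sets (steps J) = sigma_sets (space M) (\<Union>i\<in>J. {X i -` A \<inter> space M | A. A \<in> sets borel})"
  unfolding steps_def by (rule sets_measure_of) auto

lemma sets_steps_subset: "sets (steps J) \<subseteq> sets M"
  unfolding sets_steps by (rule sets.sigma_sets_subset) auto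

lemma subalgebra_steps: "subalgebra M (steps J)"
  by (simp add: subalgebra_def sets_steps_subset)

lemma measurable_steps_imp: "f \<in> steps J \<rightarrow>\<^sub>M N \<Longrightarrow> f \<in> M \<rightarrow>\<^sub>M N"
  by (rule measurable_from_subalg[OF subalgebra_steps])

lemma X_steps: "i \<in> J \<Longrightarrow> X i \<in> borel_measurable (steps J)"
  by (rule measurableI) (auto simp: sets_steps)

lemma S_diff_steps:
  assumes "{min a b..<max a b} \<subseteq> J"
  shows "(\<lambda>\<omega>. S b \<omega> - S a \<omega>) \<in> borel_measurable (steps J)"
proof -
  have *: "(\<lambda>\<omega>. S b \<omega> - S a \<omega>) \<in> borel_measurable (steps J)" if "a \<le> b" "{a..<b} \<subseteq> J" for a b
    using that by (auto simp: S_diff intro!: borel_measurable_sum X_steps)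
  show ?thesis
  proof (cases "a \<le> b")
    case False
    then have "(\<lambda>\<omega>. - (S a \<omega> - S b \<omega>)) \<in> borel_measurable (steps J)"
      using assms by (intro borel_measurable_uminus *) auto
    then show ?thesis by simp
  qed (use assms * in auto)
qed

lemma S_less_steps:
  assumes "{min a b..<max a b} \<subseteq> J"
  shows "Measurable.pred (steps J) (\<lambda>\<omega>. S a \<omega> < S b \<omega>)"
proof -
  note S_diff_steps[OF assms, measurable]
  have "Measurable.pred (steps J) (\<lambda>\<omega>. 0 < S b \<omega> - S a \<omega>)" by measurable
  then show ?thesis by simp
qed

lemma S_le_steps:
  assumes "{min a b..<max a b} \<subseteq> J"
  shows "Measurable.pred (steps J) (\<lambda>\<omega>. S a \<omega> \<le> S b \<omega>)"
proof -
  note S_diff_steps[OF assms, measurable]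
  have "Measurable.pred (steps J) (\<lambda>\<omega>. 0 \<le> S b \<omega> - S a \<omega>)" by measurable
  then show ?thesis by simp
qed

text \<open>The argmin depends only on differences of \<open>S\<close> within the window, so the
  level \<open>S a\<close> at which the window is entered drops out, and the steps inside the window
  suffice.\<close>

lemma last_argmin_steps:
  assumes "{a..<a + n} \<subseteq> J"
  shows "Measurable.pred (steps J) (\<lambda>\<omega>. last_argmin (\<lambda>i. S (a + i) \<omega>) n = j)"
proof (cases "j \<le> n")
  case True
  have "Measurable.pred (steps J) (\<lambda>\<omega>. (\<forall>i\<in>{..<j}. S (a + j) \<omega> \<le> S (a + i) \<omega>) \<and> (\<forall>i\<in>{j<..n}. S (a + j) \<omega> < S (a + i) \<omega>))"
    using True assms
    by (intro pred_intros_logic pred_intros_finite S_less_steps S_le_steps) (auto simp: subset_iff)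
  moreover have "last_argmin (\<lambda>i. S (a + i) \<omega>) n = j \<longleftrightarrow>
     (\<forall>i\<in>{..<j}. S (a + j) \<omega> \<le> S (a + i) \<omega>) \<and> (\<forall>i\<in>{j<..n}. S (a + j) \<omega> < S (a + i) \<omega>)" for \<omega>
    unfolding last_argmin_eq_iff using True by auto
  ultimately show ?thesis by simp
qed (simp add: last_argmin_eq_iff)

lemma last_argmin_fun_steps:
  fixes f :: "nat \<Rightarrow> real"
  assumes "{a..<a + n} \<subseteq> J"
  shows "(\<lambda>\<omega>. f (last_argmin (\<lambda>i. S (a + i) \<omega>) n)) \<in> borel_measurable (steps J)"
proof -
  have "(\<lambda>\<omega>. last_argmin (\<lambda>i. S (a + i) \<omega>) n) \<in> steps J \<rightarrow>\<^sub>M count_space UNIV"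
    unfolding measurable_count_space_eq2_countable
    using last_argmin_steps[OF assms] by (auto simp: pred_def vimage_def Int_def conj_commute)
  then show ?thesis by (rule measurable_compose) simp
qed

lemma indep_var_steps:
  fixes f g :: "'w \<Rightarrow> real"
  assumes f: "f \<in> borel_measurable (steps J)" and g: "g \<in> borel_measurable (steps K)" and "J \<inter> K = {}"
  shows "indep_var borel f borel g"
proof -
  let ?E = "\<lambda>i. {X i -` A \<inter> space M | A. A \<in> sets borel}"
  have "indep_sets ?E UNIV" using indep by (simp add: indep_vars_def2)
  then have "indep_sets (\<lambda>b. sigma_sets (space M) (\<Union>i\<in>case_bool J K b. ?E i)) UNIV"
  proof (intro indep_sets_collect_sigma)
    show "indep_sets ?E (\<Union>b\<in>UNIV. case_bool J K b)"
      if "indep_sets ?E UNIV" using that by (rule indep_sets_mono_index[rotated]) auto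
    show "Int_stable (?E i)" for i
    proof (rule Int_stableI, clarsimp)
      fix A B :: "real set" assume "A \<in> sets borel" "B \<in> sets borel"
      then show "\<exists>C. X i -` A \<inter> space M \<inter> (X i -` B \<inter> space M) = X i -` C \<inter> space M \<and> C \<in> sets borel"
        by (intro exI[of _ "A \<inter> B"]) auto
    qed
    show "disjoint_family (case_bool J K)"
      using \<open>J \<inter> K = {}\<close> by (auto simp: disjoint_family_on_def split: bool.splits)
  qed
  then have "indep_set (sets (steps J)) (sets (steps K))"
    unfolding indep_set_def sets_steps
    by (rule indep_sets_mono_sets) (auto split: bool.splits)
  moreover have "sigma_sets (space M) {h -` A \<inter> space M | A. A \<in> sets borel} \<subseteq> sets (steps I)"
    if "h \<in> borel_measurable (steps I)" for h :: "'w \<Rightarrow> real" and I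
  proof -
    have "{h -` A \<inter> space M | A. A \<in> sets borel} \<subseteq> sets (steps I)"
      using measurable_sets[OF that] by auto
    from sets.sigma_sets_subset[OF this] show ?thesis by simp
  qed
  ultimately have "indep_set (sigma_sets (space M) {f -` A \<inter> space M | A. A \<in> sets borel})
      (sigma_sets (space M) {g -` A \<inter> space M | A. A \<in> sets borel})"
    unfolding indep_set_def using f g
    by (elim indep_sets_mono_sets) (auto split: bool.splits)
  then show ?thesis
    unfolding indep_var_eq using f g by (auto intro: measurable_steps_imp)
qed

lemma expectation_steps_mult:
  fixes f g :: "'w \<Rightarrow> real"
  assumes "f \<in> borel_measurable (steps J)" "g \<in> borel_measurable (steps K)" "J \<inter> K = {}"
    and "\<And>\<omega>. \<omega> \<in> space M \<Longrightarrow> \<bar>f \<omega>\<bar> \<le> C" "\<And>\<omega>. \<omega> \<in> space M \<Longrightarrow> \<bar>g \<omega>\<bar> \<le> D"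
  shows "expectation (\<lambda>\<omega>. f \<omega> * g \<omega>) = expectation f * expectation g"
proof (rule indep_var_lebesgue_integral)
  show "indep_var borel f borel g" by (rule indep_var_steps) (use assms in auto)
  show "integrable M f"
    using assms by (auto intro!: integrable_const_bound[where B=C] intro: measurable_steps_imp)
  show "integrable M g"
    using assms by (auto intro!: integrable_const_bound[where B=D] intro: measurable_steps_imp)
qed

lemma prob_steps_conj:
  assumes P: "Measurable.pred (steps J) P" and Q: "Measurable.pred (steps K) Q" and "J \<inter> K = {}"
  shows "\<P>(\<omega> in M. P \<omega> \<and> Q \<omega>) = \<P>(\<omega> in M. P \<omega>) * \<P>(\<omega> in M. Q \<omega>)"
proof -
  have ind: "\<P>(\<omega> in M. R \<omega>) = expectation (\<lambda>\<omega>. of_bool (R \<omega>))" for R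
  proof -
    have "expectation (\<lambda>\<omega>. of_bool (R \<omega>)) = expectation (indicat_real {\<omega> \<in> space M. R \<omega>})"
      by (intro Bochner_Integration.integral_cong) (auto simp: indicator_def)
    moreover have "{\<omega> \<in> space M. R \<omega>} \<inter> space M = {\<omega> \<in> space M. R \<omega>}" by auto
    ultimately show ?thesis by simp
  qed
  have "expectation (\<lambda>\<omega>. of_bool (P \<omega>) * of_bool (Q \<omega>) :: real) = expectation (\<lambda>\<omega>. of_bool (P \<omega>)) * expectation (\<lambda>\<omega>. of_bool (Q \<omega>))"
    using P Q by (intro expectation_steps_mult[where J=J and K=K and C=1 and D=1] \<open>J \<inter> K = {}\<close>) (auto simp: of_bool_def)
  then show ?thesis unfolding ind by (simp add: of_bool_conj)
qed

section \<open>The probability of staying above the starting value\<close>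

definition below :: "'w \<Rightarrow> nat \<Rightarrow> nat set \<Rightarrow> bool" where
  "below \<omega> c I \<longleftrightarrow> (\<forall>q\<in>I. S c \<omega> < S q \<omega>)"

lemma below_steps:
  assumes "finite I" "\<And>q. q \<in> I \<Longrightarrow> {min c q..<max c q} \<subseteq> J"
  shows "Measurable.pred (steps J) (\<lambda>\<omega>. below \<omega> c I)"
  unfolding below_def using assms by (intro pred_intros_finite S_less_steps) auto

lemma below_measurable [measurable]: "finite I \<Longrightarrow> Measurable.pred M (\<lambda>\<omega>. below \<omega> c I)"
  using below_steps[of I c UNIV] by (intro measurable_steps_imp[of _ UNIV]) auto

text \<open>The probability depends on \<open>Y\<close> only through the product of the step laws,
  so any rearrangement or reflection of the steps that preserves their joint law yields the same
  value.\<close>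

lemma prob_positive_eq_PiM:
  fixes Y :: "nat \<Rightarrow> 'w \<Rightarrow> real"
  assumes Y: "indep_vars (\<lambda>_. borel) Y {..<n}" "\<And>l. l < n \<Longrightarrow> distr M borel (Y l) = \<nu>" and "0 < n"
  shows "\<P>(\<omega> in M. \<forall>i\<in>{1..n}. 0 < (\<Sum>l<i. Y l \<omega>))
       = measure (\<Pi>\<^sub>M l\<in>{..<n}. \<nu>) {x \<in> space (\<Pi>\<^sub>M l\<in>{..<n}. borel). \<forall>i\<in>{1..n}. 0 < (\<Sum>l<i. x l)}"
proof -
  let ?P = "\<Pi>\<^sub>M l\<in>{..<n}. (borel :: real measure)"
  let ?E = "{x \<in> space ?P. \<forall>i\<in>{1..n}. 0 < (\<Sum>l<i. x l)}"
  have [measurable]: "l < n \<Longrightarrow> Y l \<in> borel_measurable M" for l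
    using Y(1) by (auto simp: indep_vars_def)
  have "distr M ?P (\<lambda>\<omega>. \<lambda>l\<in>{..<n}. Y l \<omega>) = (\<Pi>\<^sub>M l\<in>{..<n}. distr M borel (Y l))"
    using Y(1) \<open>0 < n\<close> by (subst indep_vars_iff_distr_eq_PiM'[symmetric]) auto
  also have "\<dots> = (\<Pi>\<^sub>M l\<in>{..<n}. \<nu>)"
    by (intro PiM_cong) (auto simp: Y(2))
  finally have distr: "distr M ?P (\<lambda>\<omega>. \<lambda>l\<in>{..<n}. Y l \<omega>) = (\<Pi>\<^sub>M l\<in>{..<n}. \<nu>)" .
  have "?E \<in> sets ?P"
  proof -
    have "(\<lambda>x. \<Sum>l<i. x l) \<in> borel_measurable ?P" if "i \<in> {1..n}" for i
      using that by (intro borel_measurable_sum measurable_component_singleton) auto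
    then have "Measurable.pred ?P (\<lambda>x. \<forall>i\<in>{1..n}. 0 < (\<Sum>l<i. x l))"
      by (intro pred_intros_finite) auto
    then show ?thesis by (simp add: pred_def)
  qed
  moreover have "(\<lambda>\<omega>. \<lambda>l\<in>{..<n}. Y l \<omega>) \<in> M \<rightarrow>\<^sub>M ?P"
    by (intro measurable_restrict) auto
  ultimately have "measure (\<Pi>\<^sub>M l\<in>{..<n}. \<nu>) ?E = prob ((\<lambda>\<omega>. \<lambda>l\<in>{..<n}. Y l \<omega>) -` ?E \<inter> space M)"
    unfolding distr[symmetric] by (simp add: measure_distr)
  also have "(\<lambda>\<omega>. \<lambda>l\<in>{..<n}. Y l \<omega>) -` ?E \<inter> space M = {\<omega> \<in> space M. \<forall>i\<in>{1..n}. 0 < (\<Sum>l<i. Y l \<omega>)}"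
  proof -
    have "(\<Sum>l<i. (\<lambda>l\<in>{..<n}. Y l \<omega>) l) = (\<Sum>l<i. Y l \<omega>)" if "i \<in> {1..n}" for i \<omega>
      using that by (intro sum.cong) auto
    then show ?thesis by (auto simp: space_PiM)
  qed
  finally show ?thesis by simp
qed

text \<open>The first identity shifts the steps. For the second, the steps before
  \<open>c + n\<close> are read backwards with opposite sign; symmetry of \<open>\<nu>\<close> keeps
  their law, and the partial sums become \<open>S (c + n - i) - S (c + n)\<close>.\<close>

lemma prob_below_shift:
  "\<P>(\<omega> in M. below \<omega> c {c<..c + n}) = \<P>(\<omega> in M. below \<omega> 0 {0<..n})"
  "\<P>(\<omega> in M. below \<omega> (c + n) {c..<c + n}) = \<P>(\<omega> in M. below \<omega> 0 {0<..n})"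
proof -
  have image_ball: "(\<forall>q\<in>h ` A. P q) \<longleftrightarrow> (\<forall>i\<in>A. P (h i))" for h :: "nat \<Rightarrow> nat" and A P
    by blast
  have fwd: "\<P>(\<omega> in M. below \<omega> c {c<..c + n}) = measure (\<Pi>\<^sub>M l\<in>{..<n}. \<nu>)
      {x \<in> space (\<Pi>\<^sub>M l\<in>{..<n}. borel). \<forall>i\<in>{1..n}. 0 < (\<Sum>l<i. x l)}" if "0 < n" for c
  proof -
    have "indep_vars (\<lambda>_. borel) (\<lambda>l. X (c + l)) {..<n}"
      by (rule indep_vars_reindex[OF _ indep_vars_subset[OF indep]]) (auto simp: inj_on_def)
    from prob_positive_eq_PiM[OF this distr_X that]
    have "\<P>(\<omega> in M. \<forall>i\<in>{1..n}. 0 < (\<Sum>l<i. X (c + l) \<omega>)) = measure (\<Pi>\<^sub>M l\<in>{..<n}. \<nu>)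
      {x \<in> space (\<Pi>\<^sub>M l\<in>{..<n}. borel). \<forall>i\<in>{1..n}. 0 < (\<Sum>l<i. x l)}" .
    moreover have "(\<forall>i\<in>{1..n}. 0 < (\<Sum>l<i. X (c + l) \<omega>)) \<longleftrightarrow> below \<omega> c {c<..c + n}" for \<omega>
    proof -
      have "(\<Sum>l<i. X (c + l) \<omega>) = S (c + i) \<omega> - S c \<omega>" for i
        by (subst S_diff) (auto intro!: sum.reindex_bij_witness[of _ "\<lambda>l. l - c" "\<lambda>l. c + l"])
      moreover have "{c<..c + n} = (\<lambda>i. c + i) ` {1..n}"
      proof safe
        fix q assume "q \<in> {c<..c + n}"
        then show "q \<in> (\<lambda>i. c + i) ` {1..n}" by (intro image_eqI[of _ _ "q - c"]) auto
      qed auto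
      ultimately show ?thesis by (simp only: below_def image_ball diff_gt_0_iff_gt)
    qed
    ultimately show ?thesis by simp
  qed
  have bwd: "\<P>(\<omega> in M. below \<omega> (c + n) {c..<c + n}) = measure (\<Pi>\<^sub>M l\<in>{..<n}. \<nu>)
      {x \<in> space (\<Pi>\<^sub>M l\<in>{..<n}. borel). \<forall>i\<in>{1..n}. 0 < (\<Sum>l<i. x l)}" if "0 < n"
  proof -
    have "indep_vars (\<lambda>_. borel) (\<lambda>l. X (c + n - Suc l)) {..<n}"
      by (rule indep_vars_reindex[OF _ indep_vars_subset[OF indep]]) (auto simp: inj_on_def)
    then have "indep_vars (\<lambda>_. borel) (\<lambda>l \<omega>. - X (c + n - Suc l) \<omega>) {..<n}"
      by (rule indep_vars_compose2) simp
    moreover have "distr M borel (\<lambda>\<omega>. - X l \<omega>) = \<nu>" for l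
      using distr_distr[of uminus borel borel "X l" M] distr_uminus distr_X[of l] by (simp add: comp_def)
    ultimately have "\<P>(\<omega> in M. \<forall>i\<in>{1..n}. 0 < (\<Sum>l<i. - X (c + n - Suc l) \<omega>)) = measure (\<Pi>\<^sub>M l\<in>{..<n}. \<nu>)
      {x \<in> space (\<Pi>\<^sub>M l\<in>{..<n}. borel). \<forall>i\<in>{1..n}. 0 < (\<Sum>l<i. x l)}"
      using that by (intro prob_positive_eq_PiM)
    moreover have "(\<forall>i\<in>{1..n}. 0 < (\<Sum>l<i. - X (c + n - Suc l) \<omega>)) \<longleftrightarrow> below \<omega> (c + n) {c..<c + n}" for \<omega>
    proof -
      have "(\<Sum>l<i. - X (c + n - Suc l) \<omega>) = S (c + n - i) \<omega> - S (c + n) \<omega>" if "i \<in> {1..n}" for i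
      proof -
        have "S (c + n) \<omega> - S (c + n - i) \<omega> = (\<Sum>l=c + n - i..<c + n. X l \<omega>)" by (rule S_diff) simp
        also have "\<dots> = (\<Sum>l<i. X (c + n - Suc l) \<omega>)"
          by (rule sum.reindex_bij_witness[of _ "\<lambda>l. c + n - Suc l" "\<lambda>l. c + n - Suc l"]) (use that in auto)
        finally show ?thesis by (simp add: sum_negf)
      qed
      moreover have "{c..<c + n} = (\<lambda>i. c + n - i) ` {1..n}"
      proof safe
        fix q assume "q \<in> {c..<c + n}"
        then show "q \<in> (\<lambda>i. c + n - i) ` {1..n}" by (intro image_eqI[of _ _ "c + n - q"]) auto
      qed auto
      ultimately show ?thesis by (simp only: below_def image_ball diff_gt_0_iff_gt cong: ball_cong)
    qed
    ultimately show ?thesis by simp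
  qed
  show "\<P>(\<omega> in M. below \<omega> c {c<..c + n}) = \<P>(\<omega> in M. below \<omega> 0 {0<..n})"
    using fwd[of c] fwd[of 0] by (cases "n = 0") (auto simp: below_def)
  show "\<P>(\<omega> in M. below \<omega> (c + n) {c..<c + n}) = \<P>(\<omega> in M. below \<omega> 0 {0<..n})"
    using bwd fwd[of 0] by (cases "n = 0") (auto simp: below_def)
qed

text \<open>The Sparre Andersen theorem. Almost surely exactly one index \<open>m \<le> n\<close> is
  the strict minimum of the walk up to \<open>n\<close>. The steps before and after \<open>m\<close>
  are independent, so this index occurs with probability \<open>a m * a (n - m)\<close>. Summing
  over \<open>m\<close> gives the convolution identity that characterises
  \<open>persist\<close>.\<close>

lemma prob_below:
  shows prob_below_right: "\<P>(\<omega> in M. below \<omega> c {c<..c + n}) = persist n"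
    and prob_below_left: "\<P>(\<omega> in M. below \<omega> (c + n) {c..<c + n}) = persist n"
proof -
  define a where "a n = \<P>(\<omega> in M. below \<omega> 0 {0<..n})" for n
  have "(\<Sum>m\<le>n. a m * a (n - m)) = 1" for n
  proof -
    let ?E = "\<lambda>m. {\<omega> \<in> space M. below \<omega> m {0..<m} \<and> below \<omega> m {m<..n}}"
    have "prob (?E m) = a m * a (n - m)" if "m \<le> n" for m
    proof -
      have "prob (?E m) = \<P>(\<omega> in M. below \<omega> m {0..<m}) * \<P>(\<omega> in M. below \<omega> m {m<..n})"
        by (rule prob_steps_conj[where J="{..<m}" and K="{m..}"]; (rule below_steps)?) auto
      then show ?thesis
        using prob_below_shift(2)[of 0 m] prob_below_shift(1)[of m "n - m"] that by (simp add: a_def)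
    qed
    then have "(\<Sum>m\<le>n. a m * a (n - m)) = (\<Sum>m\<le>n. prob (?E m))" by simp
    also have "\<dots> = prob (\<Union>m\<in>{..n}. ?E m)"
    proof (rule finite_measure_finite_Union[symmetric])
      show "?E ` {..n} \<subseteq> events" by (intro image_subsetI) measurable
      show "disjoint_family_on ?E {..n}"
        unfolding disjoint_family_on_def
      proof safe
        fix x i j \<omega> assume "i \<le> n" "j \<le> n" "i \<noteq> j"
          "below \<omega> i {0..<i}" "below \<omega> i {i<..n}" "below \<omega> j {0..<j}" "below \<omega> j {j<..n}"
        then have "S i \<omega> < S j \<omega>" "S j \<omega> < S i \<omega>"
          by (cases i j rule: linorder_cases; simp add: below_def)+
        then show "\<omega> \<in> {}" by simp
      qed
    qed simp
    also have "\<dots> = 1"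
    proof -
      have "AE \<omega> in M. \<omega> \<in> (\<Union>m\<in>{..n}. ?E m)"
        using AE_inj_S AE_space
      proof eventually_elim
        case (elim \<omega>)
        have inj: "inj_on (\<lambda>i. S i \<omega>) {..n}" using elim(1) by (rule inj_on_subset) simp
        let ?m = "last_argmin (\<lambda>i. S i \<omega>) n"
        have "?m \<le> n" "\<forall>i\<in>{..n} - {?m}. S ?m \<omega> < S i \<omega>"
          using last_argmin_distinct_iff[OF inj, of ?m] by auto
        then have "\<omega> \<in> ?E ?m" using elim(2) by (auto simp: below_def)
        then show ?case using \<open>?m \<le> n\<close> by blast
      qed
      then show ?thesis by (subst prob_eq_1) auto
    qed
    finally show ?thesis .
  qed
  moreover have "a 0 = 1" by (simp add: a_def below_def prob_space)
  ultimately have "a n = persist n" for n by (intro persist_unique)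
  then show "\<P>(\<omega> in M. below \<omega> c {c<..c + n}) = persist n"
    "\<P>(\<omega> in M. below \<omega> (c + n) {c..<c + n}) = persist n"
    by (simp_all add: prob_below_shift a_def)
qed

section \<open>Joint laws of two successive minima\<close>

lemma prob_split:
  assumes "AE \<omega> in M. P \<omega> \<longleftrightarrow> Q \<omega> \<or> R \<omega>" "\<And>\<omega>. \<not> (Q \<omega> \<and> R \<omega>)"
    and [measurable]: "Measurable.pred M P" "Measurable.pred M Q" "Measurable.pred M R"
  shows "\<P>(\<omega> in M. P \<omega>) = \<P>(\<omega> in M. Q \<omega>) + \<P>(\<omega> in M. R \<omega>)"
proof -
  have "\<P>(\<omega> in M. P \<omega>) = \<P>(\<omega> in M. Q \<omega> \<or> R \<omega>)"
    using assms(1) by (rule prob_eq_AE) auto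
  also have "{\<omega> \<in> space M. Q \<omega> \<or> R \<omega>} = {\<omega> \<in> space M. Q \<omega>} \<union> {\<omega> \<in> space M. R \<omega>}"
    by auto
  also have "prob \<dots> = \<P>(\<omega> in M. Q \<omega>) + \<P>(\<omega> in M. R \<omega>)"
    using assms(2) by (intro finite_measure_Union) auto
  finally show ?thesis .
qed

lemma S_less_measurable [measurable]: "Measurable.pred M (\<lambda>\<omega>. S a \<omega> < S b \<omega>)"
  using S_less_steps[of a b UNIV] by (intro measurable_steps_imp[of _ UNIV]) auto

text \<open>Induction on \<open>L\<close>, with \<open>f = c + L + 1\<close>. What is lost from one
  stage to the next is the event that \<open>f\<close> is the first index after \<open>c\<close>
  below \<open>S c\<close>. On it, lying below everything from \<open>c\<close> on is the same for
  \<open>e\<close> as lying below everything from \<open>f\<close> on, so the event factors at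
  \<open>f\<close>.\<close>

lemma prob_below_both:
  assumes "c + L < e"
  shows "\<P>(\<omega> in M. below \<omega> c {c<..c + L} \<and> below \<omega> e {c..<e})
       = persist L * persist (e - c - L) * real (e - c - L) / real (e - c)"
  using assms
proof (induction L)
  case 0
  then show ?case using prob_below_left[of c "e - c"] by (simp add: below_def)
next
  case (Suc L)
  define f where "f = Suc (c + L)"
  have f: "c < f" "f \<le> e" "{c<..f} = insert f {c<..c + L}" using Suc.prems by (auto simp: f_def)
  let ?E = "\<lambda>f \<omega>. below \<omega> c {c<..f} \<and> below \<omega> e {c..<e}"
  let ?D1 = "\<lambda>\<omega>. below \<omega> c {c<..c + L} \<and> S f \<omega> < S c \<omega>"
  have "\<P>(\<omega> in M. below \<omega> c {c<..c + L}) = \<P>(\<omega> in M. below \<omega> c {c<..f}) + \<P>(\<omega> in M. ?D1 \<omega>)"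
  proof (rule prob_split)
    show "AE \<omega> in M. below \<omega> c {c<..c + L} \<longleftrightarrow> below \<omega> c {c<..f} \<or> ?D1 \<omega>"
      using AE_inj_S
    proof eventually_elim
      case (elim \<omega>)
      then have "S c \<omega> \<noteq> S f \<omega>" using f(1) by (auto dest: injD)
      then show ?case unfolding f(3) below_def by auto
    qed
  qed (auto simp: below_def f(3))
  then have D1: "\<P>(\<omega> in M. ?D1 \<omega>) = persist L - persist (Suc L)"
    using prob_below_right[of c L] prob_below_right[of c "Suc L"] by (simp add: f_def)
  have "\<P>(\<omega> in M. ?E (c + L) \<omega>) = \<P>(\<omega> in M. ?E f \<omega>) + \<P>(\<omega> in M. ?D1 \<omega> \<and> below \<omega> e {f..<e})"
  proof (rule prob_split)
    show "AE \<omega> in M. ?E (c + L) \<omega> \<longleftrightarrow> ?E f \<omega> \<or> (?D1 \<omega> \<and> below \<omega> e {f..<e})"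
      using AE_inj_S
    proof eventually_elim
      case (elim \<omega>)
      then have ne: "S c \<omega> \<noteq> S f \<omega>" using f(1) by (auto dest: injD)
      have "below \<omega> e {c..<e}" if D1: "?D1 \<omega>" and e: "below \<omega> e {f..<e}"
        unfolding below_def
      proof
        fix q assume q: "q \<in> {c..<e}"
        show "S e \<omega> < S q \<omega>"
        proof (cases "f \<le> q")
          case True
          then show ?thesis using e q by (simp add: below_def)
        next
          case False
          have "S e \<omega> \<le> S f \<omega>" using e f(2) by (cases "f = e") (auto simp: below_def less_imp_le)
          also have "\<dots> < S c \<omega>" using D1 by simp
          also have "\<dots> \<le> S q \<omega>"
            using D1 q False by (cases "q = c") (auto simp: below_def f_def less_imp_le)
          finally show ?thesis .
        qed
      qed
      moreover have "below \<omega> e {c..<e} \<Longrightarrow> below \<omega> e {f..<e}"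
        using f(1) by (auto simp: below_def)
      moreover have "below \<omega> c {c<..f} \<longleftrightarrow> below \<omega> c {c<..c + L} \<and> S c \<omega> < S f \<omega>"
        unfolding f(3) below_def by auto
      ultimately show ?case using ne by auto
    qed
  qed (auto simp: below_def f(3))
  moreover have "\<P>(\<omega> in M. ?D1 \<omega> \<and> below \<omega> e {f..<e}) = \<P>(\<omega> in M. ?D1 \<omega>) * \<P>(\<omega> in M. below \<omega> e {f..<e})"
    using f by (intro prob_steps_conj[where J="{..<f}" and K="{f..}"] pred_intros_logic below_steps S_less_steps) (auto simp: f_def)
  moreover have "\<P>(\<omega> in M. below \<omega> e {f..<e}) = persist (e - f)"
    using prob_below_left[of f "e - f"] f(2) by simp
  moreover have "\<P>(\<omega> in M. ?E (c + L) \<omega>) = persist L * persist (e - c - L) * real (e - c - L) / real (e - c)"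
    using Suc.IH Suc.prems by simp
  ultimately have 1: "\<P>(\<omega> in M. ?E f \<omega>) = persist L * persist (e - c - L) * real (e - c - L) / real (e - c)
      - (persist L - persist (Suc L)) * persist (e - f)"
    using D1 by simp
  have "persist L * persist (Suc (e - f)) * real (Suc (e - f)) / real (e - c)
       = persist (Suc L) * persist (e - f) * real (e - f) / real (e - c) + (persist L - persist (Suc L)) * persist (e - f)"
    using Suc.prems by (intro persist_ladder_identity) (auto simp: f_def)
  moreover have "Suc (e - f) = e - c - L" using Suc.prems by (auto simp: f_def)
  ultimately have "\<P>(\<omega> in M. ?E f \<omega>) = persist (Suc L) * persist (e - f) * real (e - f) / real (e - c)"
    using 1 by (simp only:)
  moreover have "e - f = e - c - Suc L" "f = c + Suc L" using Suc.prems by (auto simp: f_def)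
  ultimately show ?case by (simp only:)
qed

text \<open>Induction on \<open>d\<close>, starting from the contradictory event at
  \<open>d = c\<close>, which matches the factor \<open>d - c\<close>. What is gained when
  \<open>d\<close> becomes \<open>Suc d\<close> is the event that \<open>d\<close> is the last index
  before \<open>e\<close> below \<open>S e\<close>. Then \<open>S c \<le> S d < S e\<close> puts
  everything after \<open>d\<close> above \<open>S c\<close> automatically, and the event factors at
  \<open>d\<close>.\<close>

lemma prob_below_tail:
  assumes "c \<le> d" "d \<le> e" "c < e"
  shows "\<P>(\<omega> in M. below \<omega> c {c<..e} \<and> below \<omega> e {d..<e})
       = persist (e - d) * persist (d - c) * real (d - c) / real (e - c)"
  using assms(1,2)
proof (induction d rule: dec_induct)
  case base
  have "\<not> (below \<omega> c {c<..e} \<and> below \<omega> e {c..<e})" for \<omega>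
  proof safe
    assume "below \<omega> c {c<..e}" "below \<omega> e {c..<e}"
    then have "S c \<omega> < S e \<omega>" "S e \<omega> < S c \<omega>" using \<open>c < e\<close> by (simp_all add: below_def)
    then show False by simp
  qed
  then show ?case by (simp only: simp_thms) simp
next
  case (step d)
  let ?W = "\<lambda>d \<omega>. below \<omega> c {c<..e} \<and> below \<omega> e {d..<e}"
  let ?D = "\<lambda>\<omega>. S d \<omega> < S e \<omega> \<and> below \<omega> e {Suc d..<e}"
  have de: "d < e" "{d..<e} = insert d {Suc d..<e}" using step by auto
  have "\<P>(\<omega> in M. below \<omega> e {Suc d..<e}) = \<P>(\<omega> in M. below \<omega> e {d..<e}) + \<P>(\<omega> in M. ?D \<omega>)"
  proof (rule prob_split)
    show "AE \<omega> in M. below \<omega> e {Suc d..<e} \<longleftrightarrow> below \<omega> e {d..<e} \<or> ?D \<omega>"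
      using AE_inj_S
    proof eventually_elim
      case (elim \<omega>)
      then have "S d \<omega> \<noteq> S e \<omega>" using de(1) by (auto dest: injD)
      then show ?case unfolding de(2) below_def by auto
    qed
  qed (auto simp: below_def de(2))
  then have D: "\<P>(\<omega> in M. ?D \<omega>) = persist (e - Suc d) - persist (e - d)"
    using prob_below_left[of d "e - d"] prob_below_left[of "Suc d" "e - Suc d"] de(1) by simp
  have "\<P>(\<omega> in M. ?W (Suc d) \<omega>) = \<P>(\<omega> in M. ?W d \<omega>) + \<P>(\<omega> in M. below \<omega> c {c<..d} \<and> ?D \<omega>)"
  proof (rule prob_split)
    show "AE \<omega> in M. ?W (Suc d) \<omega> \<longleftrightarrow> ?W d \<omega> \<or> (below \<omega> c {c<..d} \<and> ?D \<omega>)"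
      using AE_inj_S
    proof eventually_elim
      case (elim \<omega>)
      then have ne: "S d \<omega> \<noteq> S e \<omega>" using de(1) by (auto dest: injD)
      have "below \<omega> c {c<..e}" if c: "below \<omega> c {c<..d}" and D: "?D \<omega>"
        unfolding below_def
      proof
        fix q assume q: "q \<in> {c<..e}"
        show "S c \<omega> < S q \<omega>"
        proof (cases "q \<le> d")
          case True
          then show ?thesis using c q by (simp add: below_def)
        next
          case False
          have "S c \<omega> \<le> S d \<omega>" using c step.hyps by (cases "c = d") (auto simp: below_def less_imp_le)
          also have "\<dots> < S e \<omega>" using D by simp
          also have "\<dots> \<le> S q \<omega>"
            using D q False by (cases "q = e") (auto simp: below_def less_imp_le)
          finally show ?thesis .
        qed
      qed
      moreover have "below \<omega> c {c<..e} \<Longrightarrow> below \<omega> c {c<..d}"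
        using de(1) by (auto simp: below_def)
      moreover have "below \<omega> e {d..<e} \<longleftrightarrow> below \<omega> e {Suc d..<e} \<and> S e \<omega> < S d \<omega>"
        unfolding de(2) below_def by auto
      ultimately show ?case using ne by auto
    qed
  qed (auto simp: below_def de(1) intro!: bexI[of _ d])
  moreover have "\<P>(\<omega> in M. below \<omega> c {c<..d} \<and> ?D \<omega>) = \<P>(\<omega> in M. below \<omega> c {c<..d}) * \<P>(\<omega> in M. ?D \<omega>)"
    using de step.hyps by (intro prob_steps_conj[where J="{..<d}" and K="{d..}"] pred_intros_logic below_steps S_less_steps) auto
  moreover have "\<P>(\<omega> in M. below \<omega> c {c<..d}) = persist (d - c)"
    using prob_below_right[of c "d - c"] step.hyps by simp
  ultimately have "\<P>(\<omega> in M. ?W (Suc d) \<omega>) = persist (e - d) * persist (d - c) * real (d - c) / real (e - c)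
      + persist (d - c) * (persist (e - Suc d) - persist (e - d))"
    using D step by simp
  moreover have "persist (e - Suc d) * persist (Suc (d - c)) * real (Suc (d - c)) / real (e - c)
       = persist (Suc (e - Suc d)) * persist (d - c) * real (d - c) / real (e - c)
         + (persist (e - Suc d) - persist (Suc (e - Suc d))) * persist (d - c)"
    using step by (intro persist_ladder_identity) auto
  moreover have "Suc (e - Suc d) = e - d" "Suc (d - c) = Suc d - c" using step by auto
  ultimately show ?case by (simp add: mult.commute)
qed

section \<open>The sliding window chain and its Markov property\<close>

definition window_argmin :: "nat \<Rightarrow> nat \<Rightarrow> 'w \<Rightarrow> nat" where
  "window_argmin N a \<omega> = last_argmin (\<lambda>i. S (a + i) \<omega>) N"

lemma window_argmin_le: "window_argmin N a \<omega> \<le> N"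
  unfolding window_argmin_def by (rule last_argmin_le)

lemma window_argmin_eq_iff:
  assumes "inj (\<lambda>n. S n \<omega>)" and "j \<le> N"
  shows "window_argmin N a \<omega> = j \<longleftrightarrow> below \<omega> (a + j) ({a..a + N} - {a + j})"
proof -
  have "inj_on (\<lambda>i. S (a + i) \<omega>) {..N}"
    by (auto simp: inj_on_def dest!: injD[OF assms(1)])
  from last_argmin_distinct_iff[OF this] have "window_argmin N a \<omega> = j \<longleftrightarrow> (\<forall>i\<in>{..N} - {j}. S (a + j) \<omega> < S (a + i) \<omega>)"
    using assms(2) by (simp add: window_argmin_def)
  also have "\<dots> \<longleftrightarrow> below \<omega> (a + j) ({a..a + N} - {a + j})"
    unfolding below_def
  proof (intro iffI ballI)
    fix q assume "\<forall>i\<in>{..N} - {j}. S (a + j) \<omega> < S (a + i) \<omega>" "q \<in> {a..a + N} - {a + j}"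
    then show "S (a + j) \<omega> < S q \<omega>"
      by (elim ballE[of _ _ "q - a"]) auto
  qed auto
  finally show ?thesis .
qed

text \<open>The three ways in which the minimum of the window \<open>{b..b + N}\<close> can follow the minimum at \<open>c\<close> of
  the earlier window \<open>{a..a + N}\<close>: a new overall minimum, \<open>c\<close> has left the window and its successor
  is higher, or the argmin does not move.\<close>

definition new_minimum :: "'w \<Rightarrow> nat \<Rightarrow> nat \<Rightarrow> nat \<Rightarrow> nat \<Rightarrow> nat \<Rightarrow> bool" where
  "new_minimum \<omega> N a b c e \<longleftrightarrow> a + N < e \<and> (below \<omega> c {c<..a + N} \<and> below \<omega> e {c..<e}) \<and> below \<omega> e {e<..b + N}"

definition higher_minimum :: "'w \<Rightarrow> nat \<Rightarrow> nat \<Rightarrow> nat \<Rightarrow> nat \<Rightarrow> bool" where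
  "higher_minimum \<omega> N b c e \<longleftrightarrow> c < b \<and> (below \<omega> c {c<..e} \<and> below \<omega> e {b..<e}) \<and> below \<omega> e {e<..b + N}"

definition same_minimum :: "'w \<Rightarrow> nat \<Rightarrow> nat \<Rightarrow> nat \<Rightarrow> nat \<Rightarrow> bool" where
  "same_minimum \<omega> N b c e \<longleftrightarrow> b \<le> c \<and> e = c \<and> below \<omega> c {c<..b + N}"

text \<open>The gain is a separation at \<open>c\<close>: the first conjunct concerns the walk
  before \<open>c\<close>, the three alternatives only the walk from \<open>c\<close> on. The
  hypothesis \<open>b \<le> a + N\<close> makes the two windows cover all of
  \<open>{a..b + N}\<close>, so that every index is compared with \<open>c\<close> or with
  \<open>e\<close>, and the order of \<open>S c\<close> and \<open>S e\<close> settles the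
  rest.\<close>

lemma window_argmin_pair_iff:
  assumes inj: "inj (\<lambda>n. S n \<omega>)" and "j \<le> N" "m \<le> N" "a \<le> b" "b \<le> a + N"
    and c: "c = a + j" and e: "e = b + m"
  shows "window_argmin N a \<omega> = j \<and> window_argmin N b \<omega> = m \<longleftrightarrow>
     below \<omega> c {a..<c} \<and> (new_minimum \<omega> N a b c e \<or> higher_minimum \<omega> N b c e \<or> same_minimum \<omega> N b c e)"
    (is "?L \<longleftrightarrow> ?R")
proof -
  define x where "x q = S q \<omega>" for q
  have W: "?L \<longleftrightarrow> (\<forall>q\<in>{a..a + N} - {c}. x c < x q) \<and> (\<forall>q\<in>{b..b + N} - {e}. x e < x q)"
    using assms by (simp add: window_argmin_eq_iff below_def x_def)
  have ce: "a \<le> c" "c \<le> a + N" "b \<le> e" "e \<le> b + N" using assms by auto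
  show ?thesis
  proof
    assume ?L
    then have c1: "\<And>q. a \<le> q \<Longrightarrow> q \<le> a + N \<Longrightarrow> q \<noteq> c \<Longrightarrow> x c < x q"
      and e1: "\<And>q. b \<le> q \<Longrightarrow> q \<le> b + N \<Longrightarrow> q \<noteq> e \<Longrightarrow> x e < x q"
      unfolding W by auto
    have pre: "below \<omega> c {a..<c}" and right: "below \<omega> c {c<..a + N}" and post: "below \<omega> e {e<..b + N}"
      using c1 e1 ce by (auto simp: below_def x_def)
    have new: "new_minimum \<omega> N a b c e" if "e \<noteq> c" "x e < x c"
    proof -
      have "a + N < e"
      proof (rule ccontr)
        assume "\<not> a + N < e"
        then have "x c < x e" using c1[of e] ce \<open>a \<le> b\<close> that by auto
        then show False using that by simp
      qed
      moreover have "below \<omega> e {c..<e}"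
        unfolding below_def x_def[symmetric]
      proof
        fix q assume q: "q \<in> {c..<e}"
        show "x e < x q"
        proof (cases "b \<le> q")
          case True
          then show ?thesis using e1[of q] q ce by auto
        next
          case False
          then have "q = c \<or> x c < x q" using c1[of q] q ce \<open>b \<le> a + N\<close> by auto
          then show ?thesis using that by auto
        qed
      qed
      ultimately show ?thesis using right post by (auto simp: new_minimum_def)
    qed
    \<comment> \<open>Ties between \<open>c\<close> and \<open>e\<close> are excluded by
      \<open>inj\<close>. If \<open>c\<close> is still in the later window without being its argmin,
      then \<open>S e < S c\<close>, and the case is one of a new minimum.\<close>
    consider "e = c" | "e \<noteq> c" "b \<le> c" | "e \<noteq> c" "c < b" "x e < x c" | "e \<noteq> c" "c < b" "x c < x e"
      using inj by (metis linorder_neqE not_le injD x_def)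
    then have "new_minimum \<omega> N a b c e \<or> higher_minimum \<omega> N b c e \<or> same_minimum \<omega> N b c e"
    proof cases
      case 1
      then show ?thesis using ce post by (auto simp: same_minimum_def)
    next
      case 2
      then show ?thesis using e1[of c] ce \<open>a \<le> b\<close> new by auto
    next
      case 3
      then show ?thesis using new by auto
    next
      case 4
      have "below \<omega> c {c<..e}"
        unfolding below_def x_def[symmetric]
      proof
        fix q assume q: "q \<in> {c<..e}"
        show "x c < x q"
        proof (cases "q \<le> a + N")
          case True
          then show ?thesis using c1[of q] q ce by auto
        next
          case False
          then have "q = e \<or> x e < x q" using e1[of q] q ce \<open>b \<le> a + N\<close> by auto
          then show ?thesis using 4 by auto
        qed
      qed
      moreover have "below \<omega> e {b..<e}" using e1 ce by (auto simp: below_def x_def)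
      ultimately show ?thesis using 4 post by (auto simp: higher_minimum_def)
    qed
    then show ?R using pre by simp
  next
    assume R: ?R
    then have pre: "\<And>q. a \<le> q \<Longrightarrow> q < c \<Longrightarrow> x c < x q" by (auto simp: below_def x_def)
    from R consider "new_minimum \<omega> N a b c e" | "higher_minimum \<omega> N b c e" | "same_minimum \<omega> N b c e" by auto
    then show ?L
    proof cases
      case 1
      then have *: "a + N < e" "\<And>q. c < q \<Longrightarrow> q \<le> a + N \<Longrightarrow> x c < x q" "\<And>q. c \<le> q \<Longrightarrow> q < e \<Longrightarrow> x e < x q"
        "\<And>q. e < q \<Longrightarrow> q \<le> b + N \<Longrightarrow> x e < x q"
        by (auto simp: new_minimum_def below_def x_def)
      have "x e < x c" using * ce by auto
      show ?thesis
        unfolding W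
      proof (intro conjI ballI)
        fix q assume "q \<in> {a..a + N} - {c}"
        then show "x c < x q" using pre[of q] *(2)[of q] by (cases "q < c") auto
      next
        fix q assume q: "q \<in> {b..b + N} - {e}"
        consider "q < c" | "c \<le> q" "q < e" | "e < q" using q by force
        then show "x e < x q"
        proof cases
          case 1
          then have "x c < x q" using q \<open>a \<le> b\<close> by (intro pre) auto
          then show ?thesis using \<open>x e < x c\<close> by simp
        qed (use * q in auto)
      qed
    next
      case 2
      then have *: "c < b" "\<And>q. c < q \<Longrightarrow> q \<le> e \<Longrightarrow> x c < x q" "\<And>q. b \<le> q \<Longrightarrow> q < e \<Longrightarrow> x e < x q"
        "\<And>q. e < q \<Longrightarrow> q \<le> b + N \<Longrightarrow> x e < x q"
        by (auto simp: higher_minimum_def below_def x_def)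
      have "x c < x e" using * ce by auto
      show ?thesis
        unfolding W
      proof (intro conjI ballI)
        fix q assume q: "q \<in> {a..a + N} - {c}"
        consider "q < c" | "c < q" "q \<le> e" | "e < q" using q by force
        then show "x c < x q"
        proof cases
          case 3
          then have "x e < x q" using q \<open>a \<le> b\<close> by (intro *) auto
          then show ?thesis using \<open>x c < x e\<close> by simp
        qed (use * pre q in auto)
      next
        fix q assume q: "q \<in> {b..b + N} - {e}"
        then show "x e < x q" using *(3)[of q] *(4)[of q] by (cases "q < e") auto
      qed
    next
      case 3
      then have *: "b \<le> c" "e = c" "\<And>q. c < q \<Longrightarrow> q \<le> b + N \<Longrightarrow> x c < x q"
        by (auto simp: same_minimum_def below_def x_def)
      have "x c < x q" if "a \<le> q" "q \<le> b + N" "q \<noteq> c" for q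
        using that pre[of q] *(3)[of q] by (cases "q < c") auto
      then show ?thesis unfolding W using *(2) \<open>a \<le> b\<close> by auto
    qed
  qed
qed

text \<open>The alternatives are disjoint. The first two split at \<open>e\<close> into a joint law
  of two minima and an independent factor \<open>persist (N - m)\<close> for the rest of the window.
  The common factor \<open>persist (N - j)\<close> is pulled out so that it can later be read as the
  condition on the old window after \<open>c\<close>.\<close>

lemma prob_next_minimum:
  assumes "j \<le> N" "m \<le> N" "k \<le> N"
    and b: "b = a + k" and c: "c = a + j" and e: "e = b + m"
  shows "\<P>(\<omega> in M. new_minimum \<omega> N a b c e \<or> higher_minimum \<omega> N b c e \<or> same_minimum \<omega> N b c e)
       = persist (N - j) * argmin_transition N k j m" (is "\<P>(\<omega> in M. ?G1 \<omega> \<or> ?G2 \<omega> \<or> ?G3 \<omega>) = _")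
proof -
  have [measurable]: "Measurable.pred M ?G1" "Measurable.pred M ?G2" "Measurable.pred M ?G3"
    unfolding new_minimum_def higher_minimum_def same_minimum_def by auto
  have excl: "\<not> (?G1 \<omega> \<and> ?G2 \<omega>)" "\<not> (?G1 \<omega> \<and> ?G3 \<omega>)" "\<not> (?G2 \<omega> \<and> ?G3 \<omega>)" for \<omega>
  proof -
    have "S e \<omega> < S c \<omega>" if "?G1 \<omega>"
      using that assms by (auto simp: new_minimum_def below_def)
    moreover have "S c \<omega> < S e \<omega>" if "?G2 \<omega>"
      using that assms by (auto simp: higher_minimum_def below_def)
    ultimately show "\<not> (?G1 \<omega> \<and> ?G2 \<omega>)" by force
    show "\<not> (?G1 \<omega> \<and> ?G3 \<omega>)" "\<not> (?G2 \<omega> \<and> ?G3 \<omega>)"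
      using assms by (auto simp: new_minimum_def higher_minimum_def same_minimum_def)
  qed
  have ce: "e + (N - m) = b + N" using assms by auto
  have tail: "\<P>(\<omega> in M. below \<omega> e {e<..b + N}) = persist (N - m)"
    using prob_below_right[of e "N - m"] ce by simp
  have "\<P>(\<omega> in M. ?G1 \<omega> \<or> ?G2 \<omega> \<or> ?G3 \<omega>) = \<P>(\<omega> in M. ?G1 \<omega>) + \<P>(\<omega> in M. ?G2 \<omega> \<or> ?G3 \<omega>)"
    by (rule prob_split) (use excl in auto)
  also have "\<P>(\<omega> in M. ?G2 \<omega> \<or> ?G3 \<omega>) = \<P>(\<omega> in M. ?G2 \<omega>) + \<P>(\<omega> in M. ?G3 \<omega>)"
    by (rule prob_split) (use excl in auto)
  also have "\<P>(\<omega> in M. ?G1 \<omega>) = (if N < m + k then persist (N - j) * (persist (m + k - N) * real (m + k - N) / real (m + k - j)) * persist (N - m) else 0)"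
  proof (cases "N < m + k")
    case True
    then have lt: "a + N < e" "c + (N - j) = a + N" using assms by auto
    have "\<P>(\<omega> in M. ?G1 \<omega>) = \<P>(\<omega> in M. (below \<omega> c {c<..a + N} \<and> below \<omega> e {c..<e}) \<and> below \<omega> e {e<..b + N})"
      using lt by (simp add: new_minimum_def)
    also have "\<dots> = \<P>(\<omega> in M. below \<omega> c {c<..a + N} \<and> below \<omega> e {c..<e}) * \<P>(\<omega> in M. below \<omega> e {e<..b + N})"
      using lt by (intro prob_steps_conj[where J="{..<e}" and K="{e..}"] pred_intros_logic below_steps) auto
    also have "\<P>(\<omega> in M. below \<omega> c {c<..a + N} \<and> below \<omega> e {c..<e})
        = persist (N - j) * persist (e - c - (N - j)) * real (e - c - (N - j)) / real (e - c)"
      using prob_below_both[of c "N - j" e] lt by simp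
    also have "e - c = m + k - j" using assms by auto
    also have "m + k - j - (N - j) = m + k - N" using assms by auto
    finally show ?thesis using True tail by simp
  next
    case False
    then show ?thesis using assms by (simp add: new_minimum_def)
  qed
  also have "\<P>(\<omega> in M. ?G2 \<omega>) = (if j < k then persist m * persist (k - j) * real (k - j) / real (m + k - j) * persist (N - m) else 0)"
  proof (cases "j < k")
    case True
    then have lt: "c < b" "c < e" "b \<le> e" using assms by auto
    have "\<P>(\<omega> in M. ?G2 \<omega>) = \<P>(\<omega> in M. (below \<omega> c {c<..e} \<and> below \<omega> e {b..<e}) \<and> below \<omega> e {e<..b + N})"
      using lt by (simp add: higher_minimum_def)
    also have "\<dots> = \<P>(\<omega> in M. below \<omega> c {c<..e} \<and> below \<omega> e {b..<e}) * \<P>(\<omega> in M. below \<omega> e {e<..b + N})"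
      using lt by (intro prob_steps_conj[where J="{..<e}" and K="{e..}"] pred_intros_logic below_steps) auto
    also have "\<P>(\<omega> in M. below \<omega> c {c<..e} \<and> below \<omega> e {b..<e})
        = persist (e - b) * persist (b - c) * real (b - c) / real (e - c)"
      using prob_below_tail[of c b e] lt by simp
    also have "e - c = m + k - j" using assms by auto
    also have "e - b = m" using assms by auto
    also have "b - c = k - j" using assms by auto
    finally show ?thesis using True tail by simp
  next
    case False
    then show ?thesis using assms by (simp add: higher_minimum_def)
  qed
  also have "\<P>(\<omega> in M. ?G3 \<omega>) = (if k \<le> j \<and> m = j - k then persist (N - j + k) else 0)"
  proof (cases "k \<le> j \<and> m = j - k")
    case True
    then have "b \<le> c" "e = c" "c + (N - j + k) = b + N" using assms by auto
    then show ?thesis using True prob_below_right[of c "N - j + k"] by (simp add: same_minimum_def)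
  next
    case False
    then have "\<not> (b \<le> c \<and> e = c)" using assms by auto
    then have "\<not> ?G3 \<omega>" for \<omega> by (auto simp: same_minimum_def)
    then show ?thesis using False by simp
  qed
  also have "(if N < m + k then persist (N - j) * (persist (m + k - N) * real (m + k - N) / real (m + k - j)) * persist (N - m) else 0)
     = persist (N - j) * (if N < m + k then persist (m + k - N) * real (m + k - N) / real (m + k - j) * persist (N - m) else 0)"
    by simp
  also have "(if j < k then persist m * persist (k - j) * real (k - j) / real (m + k - j) * persist (N - m) else 0)
     = persist (N - j) * (if j < k then persist m * persist (k - j) * real (k - j) / (real (m + k - j) * persist (N - j)) * persist (N - m) else 0)"
  proof -
    have "p * (x * d / (r * p) * q) = x * d / r * q" if "p \<noteq> 0" for p x d r q :: real
      using that by simp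
    then show ?thesis by (simp only: if_distrib[of "(*) _"] mult_zero_right persist_neq_0 not_False_eq_True)
  qed
  also have "(if k \<le> j \<and> m = j - k then persist (N - j + k) else 0)
     = persist (N - j) * (if k \<le> j \<and> m = j - k then persist (N - j + k) / persist (N - j) else 0)"
    by simp
  finally show ?thesis
    unfolding argmin_transition_def refresh_transition_def by (simp only: distrib_left add.assoc add.commute add.left_commute)
qed

text \<open>The Markov property of the discrete chain, in the product form that survives a limit.
  Once the argmin of the window at \<open>a\<close> is fixed as \<open>j\<close>, all earlier
  argmins are functions of the steps before \<open>a + j\<close>, while the next argmin is governed
  by the steps from \<open>a + j\<close> on.\<close>

theorem expectation_window_argmin:
  fixes f :: "'i \<Rightarrow> nat \<Rightarrow> real" and g :: "nat \<Rightarrow> real" and \<kappa> :: "'i \<Rightarrow> nat"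
  assumes U: "finite U" "\<And>u. u \<in> U \<Longrightarrow> \<kappa> u \<le> a" and "k \<le> N"
    and f: "\<And>u i. u \<in> U \<Longrightarrow> i \<le> N \<Longrightarrow> \<bar>f u i\<bar> \<le> 1"
  shows "expectation (\<lambda>\<omega>. (\<Prod>u\<in>U. f u (window_argmin N (\<kappa> u) \<omega>)) * g (window_argmin N (a + k) \<omega>))
       = expectation (\<lambda>\<omega>. (\<Prod>u\<in>U. f u (window_argmin N (\<kappa> u) \<omega>)) *
           (\<Sum>m\<le>N. argmin_transition N k (window_argmin N a \<omega>) m * g m))"
proof -
  define \<Phi> where "\<Phi> \<omega> = (\<Prod>u\<in>U. f u (window_argmin N (\<kappa> u) \<omega>))" for \<omega>
  define \<Phi>' where "\<Phi>' j \<omega> = (\<Prod>u\<in>U. f u (last_argmin (\<lambda>i. S (\<kappa> u + i) \<omega>) (min N (a + j - \<kappa> u))))" for j \<omega>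
  have meas [measurable]: "Measurable.pred M (\<lambda>\<omega>. window_argmin N b \<omega> = j)" for b j
    unfolding window_argmin_def by (rule measurable_steps_imp[OF last_argmin_steps[OF subset_UNIV]])
  have [measurable]: "(\<lambda>\<omega>. h (window_argmin N b \<omega>)) \<in> borel_measurable M" for b and h :: "nat \<Rightarrow> real"
    unfolding window_argmin_def by (rule measurable_steps_imp[OF last_argmin_fun_steps[OF subset_UNIV]])
  have \<Phi>_meas [measurable]: "\<Phi> \<in> borel_measurable M"
    unfolding \<Phi>_def by measurable
  have bound: "\<bar>\<Prod>u\<in>U. f u (i u)\<bar> \<le> 1" if "\<And>u. i u \<le> N" for i
    unfolding abs_prod using f that by (intro prod_le_1) auto
  have \<Phi>_bound: "\<bar>\<Phi> \<omega>\<bar> \<le> 1" for \<omega>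
    unfolding \<Phi>_def by (rule bound) (rule window_argmin_le)
  have \<Phi>'_bound: "\<bar>\<Phi>' j \<omega>\<bar> \<le> 1" for j \<omega>
    unfolding \<Phi>'_def by (rule bound) (rule order_trans[OF last_argmin_le min.cobounded1])
  have \<Phi>'_steps: "\<Phi>' j \<in> borel_measurable (steps {..<a + j})" for j
    unfolding \<Phi>'_def using U(2) by (intro borel_measurable_prod last_argmin_fun_steps) (auto simp: min_def)
  have \<Phi>_eq: "\<Phi> \<omega> = \<Phi>' j \<omega>" if "window_argmin N a \<omega> = j" for j \<omega>
    unfolding \<Phi>_def \<Phi>'_def
    using last_argmin_truncate[OF that[unfolded window_argmin_def] U(2)]
    by (intro prod.cong refl) (simp add: window_argmin_def)
  \<comment> \<open>Both expectations are expressed by \<open>\<Phi>' j\<close> and the event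
    \<open>?pre\<close>, which involve only steps before \<open>c\<close>. What differs is the
    independent factor coming from the walk after \<open>c\<close>.\<close>
  have key: "expectation (\<lambda>\<omega>. \<Phi> \<omega> * of_bool (window_argmin N a \<omega> = j \<and> window_argmin N (a + k) \<omega> = m))
      = argmin_transition N k j m * expectation (\<lambda>\<omega>. \<Phi> \<omega> * of_bool (window_argmin N a \<omega> = j))"
    if "j \<le> N" "m \<le> N" for j m
  proof -
    define c where "c = a + j"
    define e where "e = a + k + m"
    let ?pre = "\<lambda>\<omega>. below \<omega> c {a..<c}"
    let ?post = "\<lambda>\<omega>. new_minimum \<omega> N a (a + k) c e \<or> higher_minimum \<omega> N (a + k) c e \<or> same_minimum \<omega> N (a + k) c e"
    have pre: "(\<lambda>\<omega>. \<Phi>' j \<omega> * of_bool (?pre \<omega>)) \<in> borel_measurable (steps {..<c})"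
    proof -
      have [measurable]: "Measurable.pred (steps {..<c}) ?pre" by (rule below_steps) auto
      have [measurable]: "\<Phi>' j \<in> borel_measurable (steps {..<c})" using \<Phi>'_steps[of j] by (simp add: c_def)
      show ?thesis unfolding of_bool_def by measurable
    qed
    have indep: "expectation (\<lambda>\<omega>. (\<Phi>' j \<omega> * of_bool (?pre \<omega>)) * of_bool (Q \<omega>))
        = expectation (\<lambda>\<omega>. \<Phi>' j \<omega> * of_bool (?pre \<omega>)) * \<P>(\<omega> in M. Q \<omega>)"
      if Q: "Measurable.pred (steps {c..}) Q" for Q
    proof -
      have "expectation (\<lambda>\<omega>. (\<Phi>' j \<omega> * of_bool (?pre \<omega>)) * of_bool (Q \<omega>))
         = expectation (\<lambda>\<omega>. \<Phi>' j \<omega> * of_bool (?pre \<omega>)) * expectation (\<lambda>\<omega>. of_bool (Q \<omega>))"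
        using Q \<Phi>'_bound[of j] by (intro expectation_steps_mult[OF pre, of _ "{c..}" 1 1]) (auto simp: of_bool_def)
      also have "expectation (\<lambda>\<omega>. of_bool (Q \<omega>)) = expectation (indicat_real {\<omega> \<in> space M. Q \<omega>})"
        by (intro Bochner_Integration.integral_cong) (auto simp: indicator_def)
      also have "\<dots> = \<P>(\<omega> in M. Q \<omega>)"
        using measurable_steps_imp[OF Q] by (simp add: pred_def)
      finally show ?thesis .
    qed
    \<comment> \<open>In each alternative the guard forces \<open>c \<le> e\<close>, so no step
      before \<open>c\<close> enters; when the guard fails, the alternative is constantly
      false.\<close>
    have post: "Measurable.pred (steps {c..}) ?post"
    proof -
      have below: "Measurable.pred (steps {c..}) (\<lambda>\<omega>. below \<omega> x I)" if "c \<le> x" "I \<subseteq> {c..}" "finite I" for x I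
        using that by (intro below_steps) (auto simp: subset_iff)
      have 1: "Measurable.pred (steps {c..}) (\<lambda>\<omega>. new_minimum \<omega> N a (a + k) c e)"
      proof (cases "a + N < e")
        case True
        then have "c \<le> e" using that by (simp add: c_def)
        then show ?thesis using True unfolding new_minimum_def
          by (simp only: simp_thms) (intro pred_intros_logic below; force)
      qed (simp add: new_minimum_def)
      have 2: "Measurable.pred (steps {c..}) (\<lambda>\<omega>. higher_minimum \<omega> N (a + k) c e)"
      proof (cases "c < a + k")
        case True
        then have "c \<le> e" by (simp add: e_def)
        then show ?thesis using True unfolding higher_minimum_def
          by (simp only: simp_thms) (intro pred_intros_logic below; force)
      qed (simp add: higher_minimum_def)
      have 3: "Measurable.pred (steps {c..}) (\<lambda>\<omega>. same_minimum \<omega> N (a + k) c e)"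
      proof (cases "a + k \<le> c \<and> e = c")
        case True
        then show ?thesis unfolding same_minimum_def
          by (simp only: simp_thms) (intro pred_intros_logic below; force)
      next
        case False
        then have "(\<lambda>\<omega>. same_minimum \<omega> N (a + k) c e) = (\<lambda>\<omega>. False)"
          by (auto simp: same_minimum_def fun_eq_iff)
        then show ?thesis by simp
      qed
      note [measurable] = 1 2 3
      show ?thesis by measurable
    qed
    have "expectation (\<lambda>\<omega>. \<Phi> \<omega> * of_bool (window_argmin N a \<omega> = j \<and> window_argmin N (a + k) \<omega> = m))
       = expectation (\<lambda>\<omega>. (\<Phi>' j \<omega> * of_bool (?pre \<omega>)) * of_bool (?post \<omega>))"
    proof (rule integral_cong_AE)
      show "AE \<omega> in M. \<Phi> \<omega> * of_bool (window_argmin N a \<omega> = j \<and> window_argmin N (a + k) \<omega> = m)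
          = (\<Phi>' j \<omega> * of_bool (?pre \<omega>)) * of_bool (?post \<omega>)"
        using AE_inj_S
      proof eventually_elim
        case (elim \<omega>)
        then have "window_argmin N a \<omega> = j \<and> window_argmin N (a + k) \<omega> = m \<longleftrightarrow> ?pre \<omega> \<and> ?post \<omega>"
          using that \<open>k \<le> N\<close> by (intro window_argmin_pair_iff) (auto simp: c_def e_def)
        then show ?case using \<Phi>_eq[of \<omega> j] by (auto simp: of_bool_def)
      qed
      show "(\<lambda>\<omega>. \<Phi>' j \<omega> * of_bool (?pre \<omega>) * of_bool (?post \<omega>)) \<in> borel_measurable M"
        using measurable_steps_imp[OF pre] measurable_steps_imp[OF post] by (auto simp: of_bool_def)
    qed (auto simp: of_bool_def)
    also have "\<dots> = expectation (\<lambda>\<omega>. \<Phi>' j \<omega> * of_bool (?pre \<omega>)) * (persist (N - j) * argmin_transition N k j m)"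
      using indep[OF post] prob_next_minimum[OF that \<open>k \<le> N\<close> refl c_def e_def] by simp
    also have "expectation (\<lambda>\<omega>. \<Phi>' j \<omega> * of_bool (?pre \<omega>)) * (persist (N - j) * argmin_transition N k j m)
      = argmin_transition N k j m * (expectation (\<lambda>\<omega>. \<Phi>' j \<omega> * of_bool (?pre \<omega>)) * persist (N - j))"
      by simp
    \<comment> \<open>The factor \<open>persist (N - j)\<close> is turned back into the event that
      the walk stays above \<open>c\<close> to the end of the old window. Together with
      \<open>?pre\<close> this is the event that the old argmin is \<open>j\<close>.\<close>
    also have "expectation (\<lambda>\<omega>. \<Phi>' j \<omega> * of_bool (?pre \<omega>)) * persist (N - j)
       = expectation (\<lambda>\<omega>. (\<Phi>' j \<omega> * of_bool (?pre \<omega>)) * of_bool (below \<omega> c {c<..c + (N - j)}))"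
      by (subst indep, rule below_steps) (auto simp: prob_below_right)
    also have "\<dots> = expectation (\<lambda>\<omega>. \<Phi> \<omega> * of_bool (window_argmin N a \<omega> = j))"
    proof (rule integral_cong_AE)
      show "AE \<omega> in M. (\<Phi>' j \<omega> * of_bool (?pre \<omega>)) * of_bool (below \<omega> c {c<..c + (N - j)})
          = \<Phi> \<omega> * of_bool (window_argmin N a \<omega> = j)"
        using AE_inj_S
      proof eventually_elim
        case (elim \<omega>)
        have "{a..a + N} - {c} = {a..<c} \<union> {c<..c + (N - j)}" using that by (auto simp: c_def)
        then have "window_argmin N a \<omega> = j \<longleftrightarrow> ?pre \<omega> \<and> below \<omega> c {c<..c + (N - j)}"
          unfolding window_argmin_eq_iff[OF elim that(1)] c_def[symmetric] below_def by auto
        then show ?case using \<Phi>_eq[of \<omega> j] by (auto simp: of_bool_def)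
      qed
      show "(\<lambda>\<omega>. \<Phi>' j \<omega> * of_bool (?pre \<omega>) * of_bool (below \<omega> c {c<..c + (N - j)})) \<in> borel_measurable M"
        using measurable_steps_imp[OF pre] by (auto simp: of_bool_def)
    qed (auto simp: of_bool_def)
    finally show ?thesis .
  qed
  have int1: "integrable M (\<lambda>\<omega>. \<Phi> \<omega> * of_bool (P \<omega>))" if [measurable]: "Measurable.pred M P" for P
    using \<Phi>_bound by (intro integrable_const_bound[where B=1]) (auto simp: of_bool_def)
  have "expectation (\<lambda>\<omega>. \<Phi> \<omega> * g (window_argmin N (a + k) \<omega>))
     = expectation (\<lambda>\<omega>. \<Sum>j\<le>N. \<Sum>m\<le>N. g m * (\<Phi> \<omega> * of_bool (window_argmin N a \<omega> = j \<and> window_argmin N (a + k) \<omega> = m)))"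
  proof (intro Bochner_Integration.integral_cong refl)
    fix \<omega>
    have "(\<Sum>j\<le>N. \<Sum>m\<le>N. g m * (\<Phi> \<omega> * of_bool (window_argmin N a \<omega> = j \<and> window_argmin N (a + k) \<omega> = m)))
      = (\<Sum>j\<le>N. \<Sum>m\<le>N. if m = window_argmin N (a + k) \<omega> then (if j = window_argmin N a \<omega> then g m * \<Phi> \<omega> else 0) else 0)"
      by (intro sum.cong refl) auto
    also have "\<dots> = \<Phi> \<omega> * g (window_argmin N (a + k) \<omega>)"
      by (simp add: window_argmin_le)
    finally show "\<Phi> \<omega> * g (window_argmin N (a + k) \<omega>) = (\<Sum>j\<le>N. \<Sum>m\<le>N. g m * (\<Phi> \<omega> * of_bool (window_argmin N a \<omega> = j \<and> window_argmin N (a + k) \<omega> = m)))"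
      by simp
  qed
  also have "\<dots> = (\<Sum>j\<le>N. \<Sum>m\<le>N. g m * (argmin_transition N k j m * expectation (\<lambda>\<omega>. \<Phi> \<omega> * of_bool (window_argmin N a \<omega> = j))))"
    by (simp add: int1 key Bochner_Integration.integral_sum Bochner_Integration.integrable_sum)
  also have "\<dots> = (\<Sum>j\<le>N. (\<Sum>m\<le>N. argmin_transition N k j m * g m) * expectation (\<lambda>\<omega>. \<Phi> \<omega> * of_bool (window_argmin N a \<omega> = j)))"
    by (simp add: sum_distrib_right mult_ac)
  also have "\<dots> = (\<Sum>j\<le>N. expectation (\<lambda>\<omega>. (\<Sum>m\<le>N. argmin_transition N k j m * g m) * (\<Phi> \<omega> * of_bool (window_argmin N a \<omega> = j))))"
    by simp
  also have "\<dots> = expectation (\<lambda>\<omega>. \<Sum>j\<le>N. (\<Sum>m\<le>N. argmin_transition N k j m * g m) * (\<Phi> \<omega> * of_bool (window_argmin N a \<omega> = j)))"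
    by (rule Bochner_Integration.integral_sum[symmetric]) (intro integrable_mult_right int1, measurable)
  also have "\<dots> = expectation (\<lambda>\<omega>. \<Phi> \<omega> * (\<Sum>m\<le>N. argmin_transition N k (window_argmin N a \<omega>) m * g m))"
  proof (intro Bochner_Integration.integral_cong refl)
    fix \<omega>
    have "(\<Sum>j\<le>N. (\<Sum>m\<le>N. argmin_transition N k j m * g m) * (\<Phi> \<omega> * of_bool (window_argmin N a \<omega> = j)))
      = (\<Sum>j\<le>N. if j = window_argmin N a \<omega> then \<Phi> \<omega> * (\<Sum>m\<le>N. argmin_transition N k j m * g m) else 0)"
      by (intro sum.cong refl) (auto simp: of_bool_def)
    also have "\<dots> = \<Phi> \<omega> * (\<Sum>m\<le>N. argmin_transition N k (window_argmin N a \<omega>) m * g m)"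
      by (simp add: window_argmin_le)
    finally show "(\<Sum>j\<le>N. (\<Sum>m\<le>N. argmin_transition N k j m * g m) * (\<Phi> \<omega> * of_bool (window_argmin N a \<omega> = j)))
      = \<Phi> \<omega> * (\<Sum>m\<le>N. argmin_transition N k (window_argmin N a \<omega>) m * g m)" .
  qed
  finally show ?thesis unfolding \<Phi>_def .
qed

text \<open>The purely numerical identity is read off from the Markov property with \<open>g\<close>
  constantly 1, tested on the event that the first argmin is \<open>j\<close>. That event has the
  nonzero probability \<open>persist j * persist (N - j)\<close>, which can be cancelled.\<close>

lemma sum_argmin_transition:
  assumes "j \<le> N" "k \<le> N"
  shows "(\<Sum>m\<le>N. argmin_transition N k j m) = 1"
proof -
  have [measurable]: "Measurable.pred M (\<lambda>\<omega>. window_argmin N b \<omega> = j)" for b j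
    unfolding window_argmin_def by (rule measurable_steps_imp[OF last_argmin_steps[OF subset_UNIV]])
  have "\<P>(\<omega> in M. window_argmin N 0 \<omega> = j) = \<P>(\<omega> in M. below \<omega> j {0..<j} \<and> below \<omega> j {j<..N})"
  proof (rule prob_eq_AE)
    show "AE \<omega> in M. window_argmin N 0 \<omega> = j \<longleftrightarrow> below \<omega> j {0..<j} \<and> below \<omega> j {j<..N}"
      using AE_inj_S
    proof eventually_elim
      case (elim \<omega>)
      have "{0..0 + N} - {0 + j} = {0..<j} \<union> {j<..N}" using assms(1) by auto
      then show ?case unfolding window_argmin_eq_iff[OF elim assms(1)] below_def by auto
    qed
  qed auto
  also have "\<dots> = \<P>(\<omega> in M. below \<omega> j {0..<j}) * \<P>(\<omega> in M. below \<omega> j {j<..N})"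
    by (rule prob_steps_conj[where J="{..<j}" and K="{j..}"]; (rule below_steps)?) auto
  also have "\<dots> = persist j * persist (N - j)"
    using prob_below_left[of 0 j] prob_below_right[of j "N - j"] assms(1) by simp
  finally have pos: "\<P>(\<omega> in M. window_argmin N 0 \<omega> = j) = persist j * persist (N - j)" .
  have ind: "expectation (\<lambda>\<omega>. of_bool (window_argmin N 0 \<omega> = j)) = \<P>(\<omega> in M. window_argmin N 0 \<omega> = j)"
  proof -
    have "expectation (\<lambda>\<omega>. of_bool (window_argmin N 0 \<omega> = j)) = expectation (indicat_real {\<omega> \<in> space M. window_argmin N 0 \<omega> = j})"
      by (intro Bochner_Integration.integral_cong) (auto simp: indicator_def)
    also have "\<dots> = \<P>(\<omega> in M. window_argmin N 0 \<omega> = j)" by simp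
    finally show ?thesis .
  qed
  have "expectation (\<lambda>\<omega>. of_bool (window_argmin N 0 \<omega> = j))
     = expectation (\<lambda>\<omega>. of_bool (window_argmin N 0 \<omega> = j) * (\<Sum>m\<le>N. argmin_transition N k (window_argmin N 0 \<omega>) m))"
    using expectation_window_argmin[of "{()}" "\<lambda>_. 0" 0 k N "\<lambda>_ i. of_bool (i = j)" "\<lambda>_. 1"] \<open>k \<le> N\<close> by simp
  also have "\<dots> = expectation (\<lambda>\<omega>. of_bool (window_argmin N 0 \<omega> = j) * (\<Sum>m\<le>N. argmin_transition N k j m))"
    by (intro Bochner_Integration.integral_cong) auto
  also have "\<dots> = expectation (\<lambda>\<omega>. of_bool (window_argmin N 0 \<omega> = j)) * (\<Sum>m\<le>N. argmin_transition N k j m)"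
    by simp
  finally show ?thesis
    unfolding ind pos by simp
qed

end

section \<open>The kernel and its Feller property\<close>

lemma nn_integral_sum_measure:
  assumes N: "sets N = sets M" and f: "f \<in> borel_measurable M"
  shows "(\<integral>\<^sup>+x. f x \<partial>sum_measure M N) = (\<integral>\<^sup>+x. f x \<partial>M) + (\<integral>\<^sup>+x. f x \<partial>N)"
  using f
proof (induction rule: borel_measurable_induct)
  case (cong f g)
  then show ?case
    by (simp cong: nn_integral_cong_simp add: sets_eq_imp_space_eq[OF N])
next
  case (set A)
  then show ?case by (simp add: N emeasure_sum_measure)
next
  case (mult u c)
  have [measurable]: "u \<in> borel_measurable N" "u \<in> borel_measurable (sum_measure M N)"
    using mult by (simp_all cong: measurable_cong_sets add: N)
  show ?case using mult by (simp add: nn_integral_cmult distrib_left)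
next
  case (add u v)
  have [measurable]: "u \<in> borel_measurable N" "u \<in> borel_measurable (sum_measure M N)"
     "v \<in> borel_measurable N" "v \<in> borel_measurable (sum_measure M N)"
    using add by (simp_all cong: measurable_cong_sets add: N)
  show ?case using add by (simp add: nn_integral_add ac_simps)
next
  case (seq U)
  have [measurable]: "U i \<in> borel_measurable N" "U i \<in> borel_measurable (sum_measure M N)" for i
    using seq by (simp_all cong: measurable_cong_sets add: N)
  have "(\<integral>\<^sup>+x. (SUP i. U i) x \<partial>L) = (SUP i. \<integral>\<^sup>+x. U i x \<partial>L)" if "\<And>i. U i \<in> borel_measurable L" for L
    using that seq(3) by (simp add: nn_integral_monotone_convergence_SUP image_comp)
  moreover have "(SUP i. (\<integral>\<^sup>+x. U i x \<partial>M) + (\<integral>\<^sup>+x. U i x \<partial>N)) = (SUP i. \<integral>\<^sup>+x. U i x \<partial>M) + (SUP i. \<integral>\<^sup>+x. U i x \<partial>N)"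
    using seq(3) by (intro ennreal_SUP_add) (auto simp: incseq_def le_fun_def intro!: nn_integral_mono)
  ultimately show ?case using seq by simp
qed

lemma integral_sum_measure:
  fixes f :: "'a \<Rightarrow> real"
  assumes N: "sets N = sets M" and M: "integrable M f" and "integrable N f"
  shows "(\<integral>x. f x \<partial>sum_measure M N) = (\<integral>x. f x \<partial>M) + (\<integral>x. f x \<partial>N)"
proof -
  have [measurable]: "f \<in> borel_measurable M" using M by simp
  have [measurable]: "f \<in> borel_measurable (sum_measure M N)" by (simp cong: measurable_cong_sets add: N)
  note nn = nn_integral_sum_measure[OF N]
  have "integrable (sum_measure M N) f"
    using assms by (auto simp: integrable_iff_bounded nn)
  then show ?thesis
    using assms by (simp add: real_lebesgue_integral_def nn enn2real_plus real_integrable_def less_top[symmetric])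
qed

lemma integral_scale_measure:
  fixes f :: "'a \<Rightarrow> real"
  assumes f: "integrable M f" and "0 \<le> c"
  shows "integrable (scale_measure (ennreal c) M) f"
    and "(\<integral>x. f x \<partial>scale_measure (ennreal c) M) = c * (\<integral>x. f x \<partial>M)"
proof -
  have [measurable]: "f \<in> borel_measurable M" using f by simp
  have [measurable]: "f \<in> borel_measurable (scale_measure (ennreal c) M)" by (simp cong: measurable_cong_sets)
  show *: "integrable (scale_measure (ennreal c) M) f"
    using assms by (auto simp: integrable_iff_bounded nn_integral_scale_measure ennreal_mult_less_top)
  show "(\<integral>x. f x \<partial>scale_measure (ennreal c) M) = c * (\<integral>x. f x \<partial>M)"
    using assms * by (simp add: real_lebesgue_integral_def nn_integral_scale_measure enn2real_mult right_diff_distrib)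
qed

section \<open>Parametrisation of the kernel by a uniform angle\<close>

definition theta :: "real measure" where
  "theta = density lborel (\<lambda>\<theta>. ennreal (indicator {0..pi / 2} \<theta> * (2 / pi)))"

lemma space_theta [simp]: "space theta = UNIV"
  and sets_theta [simp, measurable_cong]: "sets theta = sets borel"
  by (simp_all add: theta_def)

lemma nn_integral_theta:
  assumes [measurable]: "f \<in> borel_measurable borel"
  shows "(\<integral>\<^sup>+\<theta>. f \<theta> \<partial>theta) = (\<integral>\<^sup>+\<theta>. ennreal (indicator {0..pi / 2} \<theta> * (2 / pi)) * f \<theta> \<partial>lborel)"
  unfolding theta_def by (subst nn_integral_density) auto

lemma integral_theta:
  fixes f :: "real \<Rightarrow> real"
  assumes [measurable]: "f \<in> borel_measurable borel"
  shows "(\<integral>\<theta>. f \<theta> \<partial>theta) = 2 / pi * (\<integral>\<theta>. f \<theta> * indicator {0..pi / 2} \<theta> \<partial>lborel)"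
proof -
  have "(\<integral>\<theta>. f \<theta> \<partial>theta) = (\<integral>\<theta>. 2 / pi * (f \<theta> * indicator {0..pi / 2} \<theta>) \<partial>lborel)"
    unfolding theta_def by (subst integral_density) (auto simp: mult_ac)
  also have "\<dots> = 2 / pi * (\<integral>\<theta>. f \<theta> * indicator {0..pi / 2} \<theta> \<partial>lborel)"
    by (rule integral_mult_right_zero)
  finally show ?thesis .
qed

lemma prob_space_theta: "prob_space theta"
proof
  have "emeasure theta (space theta) = (\<integral>\<^sup>+\<theta>. ennreal (2 / pi) * indicator {0..pi / 2} \<theta> \<partial>lborel)"
    by (simp add: theta_def emeasure_density) (intro nn_integral_cong, simp split: split_indicator)
  also have "\<dots> = ennreal (2 / pi) * ennreal (pi / 2)" by (simp add: nn_integral_cmult)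
  also have "\<dots> = 1" by (simp flip: ennreal_mult)
  finally show "emeasure theta (space theta) = 1" .
qed

lemma AE_theta: "AE \<theta> in theta. \<theta> \<in> {0<..<pi / 2}"
proof -
  have "AE \<theta> in lborel. \<theta> \<noteq> 0 \<and> \<theta> \<noteq> pi / 2"
    using AE_lborel_singleton[of 0] AE_lborel_singleton[of "pi / 2"] by eventually_elim simp
  then have "AE \<theta> in lborel. 0 < ennreal (indicator {0..pi / 2} \<theta> * (2 / pi)) \<longrightarrow> \<theta> \<in> {0<..<pi / 2}"
    by eventually_elim (auto split: split_indicator)
  then show ?thesis
    unfolding theta_def by (subst AE_density) simp_all
qed

lemma sin_cos_theta:
  assumes "\<theta> \<in> {0<..<pi / 2}"
  shows "0 < sin \<theta>" "0 < cos \<theta>"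
  using assms by (auto intro: sin_gt_zero cos_gt_zero)

text \<open>With \<open>\<theta>\<close> uniform on \<open>[0, pi/2]\<close>, the substitutions \<open>y = jump (t - x) \<theta>\<close> and \<open>y = 1 - t (cos \<theta>)\<^sup>2\<close> remove the
  singularities of the two summands of the transition density. For \<open>x \<ge> t\<close> the former becomes
  constant, which yields the atom at \<open>x - t\<close>.\<close>

definition jump :: "real \<Rightarrow> real \<Rightarrow> real" where
  "jump a \<theta> = (if a \<le> 0 then - a else a * (sin \<theta>)\<^sup>2 / (a + (cos \<theta>)\<^sup>2))"

text \<open>The density with respect to \<open>theta\<close> of the second summand of the kernel
  after \<open>y = 1 - t * (cos \<theta>)^2\<close>, for which \<open>y + t - 1\<close> becomes
  \<open>t * (sin \<theta>)^2\<close>. It lies between 0 and 1.\<close>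

definition refresh_weight :: "real \<Rightarrow> real \<Rightarrow> real \<Rightarrow> real" where
  "refresh_weight t x \<theta> = t * (sin \<theta>)\<^sup>2 / (t * (sin \<theta>)\<^sup>2 + 1 - x)"

text \<open>The mass of the \<open>jump\<close> part, whether that part is an atom or a density. It
  is also the limit of \<open>persist (N - j + k) / persist (N - j)\<close>: the chance that a path
  which has stayed above its minimum for time \<open>1 - x\<close> does so for a further time
  \<open>t\<close>.\<close>

definition survival :: "real \<Rightarrow> real \<Rightarrow> real" where
  "survival t x = sqrt ((1 - x) / (1 - x + t))"

lemma refresh_weight_measurable [measurable]: "refresh_weight t x \<in> borel_measurable borel"
  unfolding refresh_weight_def[abs_def] by measurable

lemma jump_measurable [measurable]: "jump a \<in> borel_measurable borel"
  unfolding jump_def[abs_def] by measurable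

lemma refresh_weight_bounds:
  assumes "0 \<le> t" "x \<le> 1"
  shows "0 \<le> refresh_weight t x \<theta>" "refresh_weight t x \<theta> \<le> 1"
proof -
  have *: "0 \<le> p / (p + 1 - x) \<and> p / (p + 1 - x) \<le> 1" if "0 \<le> p" for p :: real
    using that assms by (cases "p + 1 - x = 0") (auto simp: divide_le_eq_1 intro!: divide_nonneg_nonneg)
  show "0 \<le> refresh_weight t x \<theta>" "refresh_weight t x \<theta> \<le> 1"
    using *[of "t * (sin \<theta>)\<^sup>2"] assms unfolding refresh_weight_def by simp_all
qed

lemma jump_01:
  assumes "-1 \<le> a" shows "jump a \<theta> \<in> {0..1}"
proof (cases "a \<le> 0")
  case False
  have "a * (sin \<theta>)\<^sup>2 \<le> a * 1" using False by (intro mult_left_mono) (auto simp: abs_square_le_1)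
  then have "a * (sin \<theta>)\<^sup>2 \<le> a + (cos \<theta>)\<^sup>2" by (simp add: add_increasing2)
  moreover have "0 < a + (cos \<theta>)\<^sup>2" using False by (simp add: add_pos_nonneg)
  ultimately show ?thesis using False by (auto simp: jump_def divide_le_eq_1 intro!: divide_nonneg_nonneg)
qed (use assms in \<open>auto simp: jump_def\<close>)

lemma sets_borel_01D: "A \<in> sets borel_01 \<Longrightarrow> A \<in> sets borel \<and> A \<subseteq> {0..1}"
  by (auto simp: sets_restrict_space)

lemma sets_density_01 [simp, measurable_cong]: "sets (density_01 q) = sets borel_01"
  by (simp add: density_01_def sets_restrict_space)

lemma emeasure_density_01:
  assumes [measurable]: "q \<in> borel_measurable borel" and A: "A \<in> sets borel_01"
  shows "emeasure (density_01 q) A = (\<integral>\<^sup>+y. ennreal (indicator ({0<..<1} \<inter> A) y * q y) \<partial>lborel)"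
proof -
  have A': "A \<in> sets (restrict_space lborel {0..1})" using A by (simp add: sets_restrict_space)
  have m: "(\<lambda>y. ennreal (indicator {0<..<1} y * q y)) \<in> borel_measurable (restrict_space lborel {0..1})"
    by (intro measurable_restrict_space1) measurable
  have [measurable]: "A \<in> sets borel" using A sets_borel_01D by blast
  have "emeasure (density_01 q) A = (\<integral>\<^sup>+y. ennreal (indicator {0<..<1} y * q y) * indicator A y \<partial>restrict_space lborel {0..1})"
    unfolding density_01_def using A' m by (rule emeasure_density[rotated])
  also have "\<dots> = (\<integral>\<^sup>+y. ennreal (indicator {0<..<1} y * q y) * indicator A y * indicator {0..1} y \<partial>lborel)"
    by (rule nn_integral_restrict_space) simp
  also have "\<dots> = (\<integral>\<^sup>+y. ennreal (indicator ({0<..<1} \<inter> A) y * q y) \<partial>lborel)"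
    using A sets_borel_01D by (intro nn_integral_cong) (auto split: split_indicator)
  finally show ?thesis .
qed

text \<open>A change of variables with the Jacobian absorbed. The hypothesis on \<open>w\<close>
  says that \<open>q\<close> composed with \<open>g\<close>, times \<open>g'\<close>, is a harmless
  weight. It is required only on the open interval, since \<open>q\<close> may blow up at the images
  of the endpoints, which form a null set of angles.\<close>

lemma emeasure_density_01_substitution:
  fixes g g' q w :: "real \<Rightarrow> real"
  assumes [measurable]: "q \<in> borel_measurable borel" "w \<in> borel_measurable borel" "g \<in> borel_measurable borel"
    and A: "A \<in> sets borel_01"
    and deriv: "\<And>\<theta>. \<theta> \<in> {0..pi / 2} \<Longrightarrow> (g has_real_derivative g' \<theta>) (at \<theta>)"
    and g': "continuous_on {0..pi / 2} g'" "\<And>\<theta>. \<theta> \<in> {0..pi / 2} \<Longrightarrow> 0 \<le> g' \<theta>"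
    and g: "\<And>\<theta>. \<theta> \<in> {0<..<pi / 2} \<Longrightarrow> g \<theta> \<in> {0<..<1}"
    and w: "\<And>\<theta>. \<theta> \<in> {0<..<pi / 2} \<Longrightarrow> q (g \<theta>) * g' \<theta> = 2 / pi * w \<theta>" "\<And>\<theta>. 0 \<le> w \<theta>"
    and q: "\<And>y. y \<in> {0<..<1} \<Longrightarrow> y \<notin> {g 0..g (pi / 2)} \<Longrightarrow> q y = 0"
  shows "emeasure (density_01 q) A = (\<integral>\<^sup>+\<theta>. ennreal (w \<theta>) * indicator A (g \<theta>) \<partial>theta)"
proof -
  have [measurable]: "A \<in> sets borel" using A sets_borel_01D by blast
  let ?f = "\<lambda>y. indicator ({0<..<1} \<inter> A) y * q y"
  have "emeasure (density_01 q) A = (\<integral>\<^sup>+y. ennreal (?f y) \<partial>lborel)"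
    using A by (intro emeasure_density_01) auto
  also have "\<dots> = (\<integral>\<^sup>+y. ennreal (?f y * indicator {g 0..g (pi / 2)} y) \<partial>lborel)"
    using q by (intro nn_integral_cong) (auto split: split_indicator)
  also have "\<dots> = (\<integral>\<^sup>+\<theta>. ennreal (?f (g \<theta>) * g' \<theta> * indicator {0..pi / 2} \<theta>) \<partial>lborel)"
    by (rule nn_integral_substitution[OF _ deriv g']) (auto simp: set_borel_measurable_def)
  also have "\<dots> = (\<integral>\<^sup>+\<theta>. ennreal (indicator {0..pi / 2} \<theta> * (2 / pi)) * (ennreal (w \<theta>) * indicator A (g \<theta>)) \<partial>lborel)"
  proof (rule nn_integral_cong_AE)
    have "AE \<theta> in lborel. \<theta> \<noteq> 0 \<and> \<theta> \<noteq> pi / 2"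
      using AE_lborel_singleton[of 0] AE_lborel_singleton[of "pi / 2"] by eventually_elim simp
    then show "AE \<theta> in lborel. ennreal (?f (g \<theta>) * g' \<theta> * indicator {0..pi / 2} \<theta>)
       = ennreal (indicator {0..pi / 2} \<theta> * (2 / pi)) * (ennreal (w \<theta>) * indicator A (g \<theta>))"
    proof eventually_elim
      case (elim \<theta>)
      show ?case
      proof (cases "\<theta> \<in> {0..pi / 2}")
        case True
        then have \<theta>: "\<theta> \<in> {0<..<pi / 2}" using elim by auto
        then show ?thesis
          using g[OF \<theta>] w(1)[OF \<theta>] w(2)[of \<theta>] by (simp split: split_indicator flip: ennreal_mult)
      qed simp
    qed
  qed
  also have "\<dots> = (\<integral>\<^sup>+\<theta>. ennreal (w \<theta>) * indicator A (g \<theta>) \<partial>theta)"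
    by (rule nn_integral_theta[symmetric]) measurable
  finally show ?thesis .
qed

lemma emeasure_refresh:
  assumes t: "0 < t" "t \<le> 1" and x: "x \<in> {0..1}" and A: "A \<in> sets borel_01"
  shows "emeasure (density_01 (\<lambda>y. sqrt (max (y + t - 1) 0) / (pi * (y + t - x) * sqrt (1 - y)))) A
       = (\<integral>\<^sup>+\<theta>. ennreal (refresh_weight t x \<theta>) * indicator A (1 - t * (cos \<theta>)\<^sup>2) \<partial>theta)"
proof (rule emeasure_density_01_substitution[where g' = "\<lambda>\<theta>. 2 * t * sin \<theta> * cos \<theta>"])
  show "((\<lambda>\<theta>. 1 - t * (cos \<theta>)\<^sup>2) has_real_derivative 2 * t * sin \<theta> * cos \<theta>) (at \<theta>)" for \<theta>
    by (auto intro!: derivative_eq_intros)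
  show "0 \<le> 2 * t * sin \<theta> * cos \<theta>" if "\<theta> \<in> {0..pi / 2}" for \<theta>
    using that t by (auto intro!: mult_nonneg_nonneg sin_ge_zero cos_ge_zero)
  fix \<theta> :: real assume \<theta>: "\<theta> \<in> {0<..<pi / 2}"
  note sc = sin_cos_theta[OF \<theta>]
  have "(cos \<theta>)\<^sup>2 < 1" using sc by (simp add: cos_squared_eq)
  then have "t * (cos \<theta>)\<^sup>2 < 1" using t by (metis less_1_mult linorder_not_le mult.right_neutral mult_le_cancel_right2 mult_less_cancel_left_pos order_le_less_trans order_less_le_trans)
  then show "1 - t * (cos \<theta>)\<^sup>2 \<in> {0<..<1}" using sc t by simp
  define D where "D = t * (sin \<theta>)\<^sup>2 + 1 - x"
  have eqs: "1 - t * (cos \<theta>)\<^sup>2 + t - 1 = t * (sin \<theta>)\<^sup>2" "1 - t * (cos \<theta>)\<^sup>2 + t - x = D"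
    "1 - (1 - t * (cos \<theta>)\<^sup>2) = t * (cos \<theta>)\<^sup>2"
    by (simp_all add: D_def cos_squared_eq algebra_simps)
  have sqrts: "sqrt (max (t * (sin \<theta>)\<^sup>2) 0) = sqrt t * sin \<theta>" "sqrt (t * (cos \<theta>)\<^sup>2) = sqrt t * cos \<theta>"
    using sc t by (simp_all add: real_sqrt_mult)
  show "sqrt (max (1 - t * (cos \<theta>)\<^sup>2 + t - 1) 0) / (pi * (1 - t * (cos \<theta>)\<^sup>2 + t - x) * sqrt (1 - (1 - t * (cos \<theta>)\<^sup>2))) *
        (2 * t * sin \<theta> * cos \<theta>) = 2 / pi * refresh_weight t x \<theta>"
    unfolding eqs sqrts refresh_weight_def D_def[symmetric] using sc t by (simp add: power2_eq_square)
next
  show "0 \<le> refresh_weight t x \<theta>" for \<theta> using t x by (intro refresh_weight_bounds) auto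
qed (use A in \<open>auto intro!: continuous_intros\<close>)

text \<open>With \<open>a = t - x\<close> the substitution amounts to
  \<open>y / (1 - y) = a / (a + 1) * (tan \<theta>)^2\<close>. Writing
  \<open>d = a + (cos \<theta>)^2\<close>, both \<open>1 - y\<close> and \<open>y + a\<close> become
  explicit multiples of \<open>1 / d\<close>, and all dependence on the angle cancels, which leaves
  the constant weight \<open>survival t x\<close>.\<close>

lemma emeasure_jump:
  assumes t: "0 < t" "t \<le> 1" and x: "x \<in> {0..1}" "x < t" and A: "A \<in> sets borel_01"
  shows "emeasure (density_01 (\<lambda>y. sqrt ((1 - x) * (t - x)) / (pi * (y + t - x) * sqrt (y * (1 - y))))) A
       = (\<integral>\<^sup>+\<theta>. ennreal (survival t x) * indicator A (jump (t - x) \<theta>) \<partial>theta)"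
proof (rule emeasure_density_01_substitution[where g' = "\<lambda>\<theta>. (t - x) * (t - x + 1) / (t - x + (cos \<theta>)\<^sup>2)\<^sup>2 * (2 * sin \<theta> * cos \<theta>)"])
  define a where "a = t - x"
  have a: "0 < a" "a \<le> 1" using t x by (auto simp: a_def)
  have D: "0 < a + (cos \<theta>)\<^sup>2" for \<theta> using a by (simp add: add_pos_nonneg)
  show "(jump (t - x) has_real_derivative (t - x) * (t - x + 1) / (t - x + (cos \<theta>)\<^sup>2)\<^sup>2 * (2 * sin \<theta> * cos \<theta>)) (at \<theta>)" for \<theta>
  proof -
    have "((\<lambda>\<theta>. a * (sin \<theta>)\<^sup>2 / (a + (cos \<theta>)\<^sup>2)) has_real_derivative a * (a + 1) / (a + (cos \<theta>)\<^sup>2)\<^sup>2 * (2 * sin \<theta> * cos \<theta>)) (at \<theta>)"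
      using D[of \<theta>] by (auto intro!: derivative_eq_intros simp: divide_simps power2_eq_square)
        (simp add: sin_squared_eq[unfolded power2_eq_square] algebra_simps)
    moreover have "jump a = (\<lambda>\<theta>. a * (sin \<theta>)\<^sup>2 / (a + (cos \<theta>)\<^sup>2))" using a by (auto simp: jump_def)
    ultimately show ?thesis by (simp add: a_def)
  qed
  show "continuous_on {0..pi / 2} (\<lambda>\<theta>. (t - x) * (t - x + 1) / (t - x + (cos \<theta>)\<^sup>2)\<^sup>2 * (2 * sin \<theta> * cos \<theta>))"
    unfolding a_def[symmetric] using D by (auto intro!: continuous_intros simp: less_imp_neq[symmetric])
  show "0 \<le> (t - x) * (t - x + 1) / (t - x + (cos \<theta>)\<^sup>2)\<^sup>2 * (2 * sin \<theta> * cos \<theta>)" if "\<theta> \<in> {0..pi / 2}" for \<theta>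
    using that a unfolding a_def[symmetric] by (intro mult_nonneg_nonneg divide_nonneg_nonneg) (auto intro: sin_ge_zero cos_ge_zero)
  fix \<theta> :: real assume \<theta>: "\<theta> \<in> {0<..<pi / 2}"
  note sc = sin_cos_theta[OF \<theta>]
  define d where "d = a + (cos \<theta>)\<^sup>2"
  have d: "0 < d" using D by (simp add: d_def)
  have j: "jump a \<theta> = a * (sin \<theta>)\<^sup>2 / d" using a by (simp add: jump_def d_def)
  have j1: "1 - jump a \<theta> = (a + 1) * (cos \<theta>)\<^sup>2 / d"
    unfolding j using d by (simp add: diff_divide_eq_iff) (simp add: d_def sin_squared_eq algebra_simps)
  have j2: "jump a \<theta> + a = a * (a + 1) / d"
    unfolding j using d by (simp add: divide_add_eq_iff) (simp add: d_def sin_squared_eq algebra_simps)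
  have "0 < jump a \<theta>" unfolding j using a sc d by simp
  moreover have "0 < 1 - jump a \<theta>" unfolding j1 using a sc d by simp
  ultimately show "jump (t - x) \<theta> \<in> {0<..<1}" by (simp add: a_def)
  have "jump a \<theta> * (1 - jump a \<theta>) = a * (a + 1) * (sin \<theta> * cos \<theta> / d)\<^sup>2"
    unfolding j1 unfolding j by (simp add: power2_eq_square)
  then have "sqrt (jump a \<theta> * (1 - jump a \<theta>)) = sqrt (a * (a + 1)) * (sin \<theta> * cos \<theta> / d)"
    using sc d by (simp add: real_sqrt_mult)
  moreover have "sqrt ((1 - x) * a) = survival t x * sqrt (a * (a + 1))"
  proof -
    have "(1 - x) * a = (1 - x) / (a + 1) * (a * (a + 1))" using a by simp
    moreover have "1 - x + t = a + 1" by (simp add: a_def)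
    ultimately show ?thesis by (simp only: survival_def flip: real_sqrt_mult)
  qed
  moreover have "s * p / (pi * (p2 / d) * (p * (sc / d))) * (p2 / d\<^sup>2 * (2 * sc)) = 2 / pi * s" if "p > 0" "p2 > 0" "sc > 0" for s p p2 sc
    using that d by (simp add: power2_eq_square)
  from this[of "sqrt (a * (a + 1))" "a * (a + 1)" "sin \<theta> * cos \<theta>" "survival t x"] a sc
  have "survival t x * sqrt (a * (a + 1)) / (pi * (a * (a + 1) / d) * (sqrt (a * (a + 1)) * (sin \<theta> * cos \<theta> / d))) * (a * (a + 1) / d\<^sup>2 * (2 * (sin \<theta> * cos \<theta>))) = 2 / pi * survival t x"
    by auto
  ultimately have "sqrt ((1 - x) * a) / (pi * (jump a \<theta> + a) * sqrt (jump a \<theta> * (1 - jump a \<theta>))) * (a * (a + 1) / d\<^sup>2 * (2 * sin \<theta> * cos \<theta>)) = 2 / pi * survival t x"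
    unfolding j2 by (simp only: mult.assoc)
  then show "sqrt ((1 - x) * (t - x)) / (pi * (jump (t - x) \<theta> + t - x) * sqrt (jump (t - x) \<theta> * (1 - jump (t - x) \<theta>))) *
     ((t - x) * (t - x + 1) / (t - x + (cos \<theta>)\<^sup>2)\<^sup>2 * (2 * sin \<theta> * cos \<theta>)) = 2 / pi * survival t x"
    by (simp only: d_def a_def add_diff_eq)
next
  show "0 \<le> survival t x" using x t by (simp add: survival_def)
next
  fix y :: real assume "y \<in> {0<..<1}" "y \<notin> {jump (t - x) 0..jump (t - x) (pi / 2)}"
  then show "sqrt ((1 - x) * (t - x)) / (pi * (y + t - x) * sqrt (y * (1 - y))) = 0"
    using x by (auto simp: jump_def)
qed (use A in auto)

lemma density_01_add:
  assumes [measurable]: "p \<in> borel_measurable borel" "q \<in> borel_measurable borel" "r \<in> borel_measurable borel"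
    and eq: "\<And>y. y \<in> {0<..<1} \<Longrightarrow> r y = p y + q y" and nonneg: "\<And>y. y \<in> {0<..<1} \<Longrightarrow> 0 \<le> p y" "\<And>y. y \<in> {0<..<1} \<Longrightarrow> 0 \<le> q y"
  shows "density_01 r = sum_measure (density_01 p) (density_01 q)"
proof (rule measure_eqI)
  fix A assume "A \<in> sets (density_01 r)"
  then have A: "A \<in> sets borel_01" by simp
  have [measurable]: "A \<in> sets borel" using A sets_borel_01D by blast
  have "emeasure (density_01 r) A = (\<integral>\<^sup>+y. ennreal (indicator ({0<..<1} \<inter> A) y * p y) + ennreal (indicator ({0<..<1} \<inter> A) y * q y) \<partial>lborel)"
    unfolding emeasure_density_01[OF assms(3) A]
    using eq nonneg by (intro nn_integral_cong) (auto split: split_indicator simp flip: ennreal_plus)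
  also have "\<dots> = emeasure (density_01 p) A + emeasure (density_01 q) A"
    unfolding emeasure_density_01[OF assms(1) A] emeasure_density_01[OF assms(2) A] by (rule nn_integral_add) auto
  finally show "emeasure (density_01 r) A = emeasure (sum_measure (density_01 p) (density_01 q)) A"
    using A by (simp add: emeasure_sum_measure)
qed simp

lemma jump_borel_01: "-1 \<le> a \<Longrightarrow> jump a \<in> theta \<rightarrow>\<^sub>M borel_01"
  using jump_01[of a] by (intro measurable_restrict_space2) auto

lemma refresh_range: "0 \<le> (t :: real) \<Longrightarrow> t \<le> 1 \<Longrightarrow> 1 - t * (cos \<theta>)\<^sup>2 \<in> {0..1}"
  using mult_mono[of t 1 "(cos \<theta>)\<^sup>2" 1] by (auto simp: abs_square_le_1)

lemma refresh_borel_01: "0 \<le> t \<Longrightarrow> t \<le> 1 \<Longrightarrow> (\<lambda>\<theta>. 1 - t * (cos \<theta>)\<^sup>2) \<in> theta \<rightarrow>\<^sub>M borel_01"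
  using refresh_range[of t] by (intro measurable_restrict_space2) auto

text \<open>At time 1 from 0 the numerator is \<open>1 + y\<close> and cancels, leaving the arcsine
  law. Statements about large times thus reduce to a time at most 1.\<close>

lemma argmin_kernel_after_1: "1 < t \<Longrightarrow> argmin_kernel t x = argmin_kernel 1 0"
proof -
  have "1 / (pi * S) = (sqrt ((1 - 0) * (1 - 0)) + sqrt (y * max (y + 1 - 1) 0)) / (pi * (y + 1 - 0) * S)"
    if "0 < y" for y S :: real
  proof -
    have "pi * (y + 1 - 0) * S = (1 + y) * (pi * S)" by (simp add: algebra_simps)
    moreover have "sqrt ((1 - 0) * (1 - 0)) + sqrt (y * max (y + 1 - 1) 0) = 1 + y" using that by simp
    moreover have "1 / (pi * S) = (1 + y) / ((1 + y) * (pi * S))" using that by simp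
    ultimately show ?thesis by (simp only:)
  qed
  then have "density_01 (\<lambda>y. 1 / (pi * sqrt (y * (1 - y)))) = density_01 (\<lambda>y. (sqrt ((1 - 0) * (1 - 0)) + sqrt (y * max (y + 1 - 1) 0))
                        / (pi * (y + 1 - 0) * sqrt (y * (1 - y))))"
    unfolding density_01_def
    by (intro arg_cong[where f = "density _"] ext) (simp split: split_indicator)
  then show "1 < t \<Longrightarrow> argmin_kernel t x = argmin_kernel 1 0"
    by (simp add: argmin_kernel_def)
qed

lemma survival_bounds: "0 \<le> t \<Longrightarrow> x \<le> 1 \<Longrightarrow> 0 \<le> survival t x \<and> survival t x \<le> 1"
  unfolding survival_def by (auto simp: divide_le_eq_1)

text \<open>One formula for both regimes \<open>t \<le> x\<close> and \<open>x < t\<close>: the atom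
  and the first density are images of the same angle under \<open>jump (t - x)\<close>. All
  integrands become bounded, so continuity in \<open>x\<close> needs only dominated
  convergence.\<close>

lemma argmin_kernel_eq:
  assumes t: "0 < t" "t \<le> 1" and x: "x \<in> {0..1}"
  shows "argmin_kernel t x = sum_measure
    (scale_measure (ennreal (survival t x)) (distr theta borel_01 (jump (t - x))))
    (distr (density theta (\<lambda>\<theta>. ennreal (refresh_weight t x \<theta>))) borel_01 (\<lambda>\<theta>. 1 - t * (cos \<theta>)\<^sup>2))"
proof -
  interpret theta: prob_space theta by (rule prob_space_theta)
  define q2 where "q2 = (\<lambda>y. sqrt (max (y + t - 1) 0) / (pi * (y + t - x) * sqrt (1 - y)))"
  define q1 where "q1 = (\<lambda>y. sqrt ((1 - x) * (t - x)) / (pi * (y + t - x) * sqrt (y * (1 - y))))"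
  have [measurable]: "q1 \<in> borel_measurable borel" "q2 \<in> borel_measurable borel"
    unfolding q1_def q2_def by measurable
  have g: "(\<lambda>\<theta>. 1 - t * (cos \<theta>)\<^sup>2) \<in> theta \<rightarrow>\<^sub>M borel_01" using t by (intro refresh_borel_01) auto
  have j: "jump (t - x) \<in> theta \<rightarrow>\<^sub>M borel_01" using t x by (intro jump_borel_01) auto
  have 2: "density_01 q2 = distr (density theta (\<lambda>\<theta>. ennreal (refresh_weight t x \<theta>))) borel_01 (\<lambda>\<theta>. 1 - t * (cos \<theta>)\<^sup>2)"
  proof (rule measure_eqI)
    fix A assume "A \<in> sets (density_01 q2)"
    then have A: "A \<in> sets borel_01" by simp
    have A': "(\<lambda>\<theta>. 1 - t * (cos \<theta>)\<^sup>2) -` A \<in> sets borel"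
      using measurable_sets[OF g A] by simp
    have "emeasure (distr (density theta (\<lambda>\<theta>. ennreal (refresh_weight t x \<theta>))) borel_01 (\<lambda>\<theta>. 1 - t * (cos \<theta>)\<^sup>2)) A
       = emeasure (density theta (\<lambda>\<theta>. ennreal (refresh_weight t x \<theta>))) ((\<lambda>\<theta>. 1 - t * (cos \<theta>)\<^sup>2) -` A)"
      using A g by (subst emeasure_distr) (auto simp: measurable_cong_sets[OF sets_density refl])
    also have "\<dots> = (\<integral>\<^sup>+\<theta>. ennreal (refresh_weight t x \<theta>) * indicator ((\<lambda>\<theta>. 1 - t * (cos \<theta>)\<^sup>2) -` A) \<theta> \<partial>theta)"
      using A' by (intro emeasure_density) auto
    finally show "emeasure (density_01 q2) A = emeasure (distr (density theta (\<lambda>\<theta>. ennreal (refresh_weight t x \<theta>))) borel_01 (\<lambda>\<theta>. 1 - t * (cos \<theta>)\<^sup>2)) A"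
      unfolding q2_def emeasure_refresh[OF t x A] by (simp add: indicator_vimage[abs_def] comp_def)
  qed simp
  show ?thesis
  proof (cases "t \<le> x")
    case True
    have "distr theta borel_01 (jump (t - x)) = return borel_01 (x - t)"
    proof -
      have "jump (t - x) = (\<lambda>_. x - t)" using True by (auto simp: jump_def)
      then show ?thesis using True t x by (simp add: theta.distr_const space_restrict_space)
    qed
    then show ?thesis
      using t True 2 by (simp add: argmin_kernel_def q2_def survival_def)
  next
    case False
    have 1: "density_01 q1 = scale_measure (ennreal (survival t x)) (distr theta borel_01 (jump (t - x)))"
    proof (rule measure_eqI)
      fix A assume "A \<in> sets (density_01 q1)"
      then have A: "A \<in> sets borel_01" by simp
      have A': "jump (t - x) -` A \<in> sets borel"
        using measurable_sets[OF j A] by simp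
      have "emeasure (density_01 q1) A = (\<integral>\<^sup>+\<theta>. ennreal (survival t x) * indicator (jump (t - x) -` A) \<theta> \<partial>theta)"
        unfolding q1_def using False A t x by (subst emeasure_jump) (auto simp: indicator_vimage[abs_def] comp_def)
      also have "\<dots> = ennreal (survival t x) * emeasure theta (jump (t - x) -` A)"
        using A' by (simp add: nn_integral_cmult_indicator)
      finally show "emeasure (density_01 q1) A = emeasure (scale_measure (ennreal (survival t x)) (distr theta borel_01 (jump (t - x)))) A"
        using A j by (simp add: emeasure_distr)
    qed simp
    have "density_01 (\<lambda>y. (sqrt ((1 - x) * (t - x)) + sqrt (y * max (y + t - 1) 0)) / (pi * (y + t - x) * sqrt (y * (1 - y))))
        = sum_measure (density_01 q1) (density_01 q2)"
    proof (rule density_01_add)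
      fix y :: real assume y: "y \<in> {0<..<1}"
      have "sqrt (y * max (y + t - 1) 0) / (pi * (y + t - x) * sqrt (y * (1 - y))) = q2 y"
        using y by (simp add: q2_def real_sqrt_mult)
      then show "(sqrt ((1 - x) * (t - x)) + sqrt (y * max (y + t - 1) 0)) / (pi * (y + t - x) * sqrt (y * (1 - y))) = q1 y + q2 y"
        by (simp add: q1_def add_divide_distrib)
      show "0 \<le> q1 y" "0 \<le> q2 y" using y False x by (auto simp: q1_def q2_def)
    qed simp_all
    then show ?thesis
      using t False by (simp add: argmin_kernel_def 1 2)
  qed
qed

lemma sets_argmin_kernel [simp, measurable_cong]: "sets (argmin_kernel t x) = sets borel_01"
  by (simp add: argmin_kernel_def)

lemma space_argmin_kernel [simp]: "space (argmin_kernel t x) = {0..1}"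
  using sets_eq_imp_space_eq[OF sets_argmin_kernel[of t x]] by (simp add: space_restrict_space)

lemma integral_argmin_kernel:
  fixes f :: "real \<Rightarrow> real"
  assumes t: "0 < t" "t \<le> 1" and x: "x \<in> {0..1}"
    and f: "f \<in> borel_measurable borel_01" "\<And>y. y \<in> {0..1} \<Longrightarrow> \<bar>f y\<bar> \<le> C"
  shows "(\<integral>y. f y \<partial>argmin_kernel t x) = survival t x * (\<integral>\<theta>. f (jump (t - x) \<theta>) \<partial>theta)
      + (\<integral>\<theta>. refresh_weight t x \<theta> * f (1 - t * (cos \<theta>)\<^sup>2) \<partial>theta)"
proof -
  interpret theta: prob_space theta by (rule prob_space_theta)
  have g: "(\<lambda>\<theta>. 1 - t * (cos \<theta>)\<^sup>2) \<in> theta \<rightarrow>\<^sub>M borel_01" using t by (intro refresh_borel_01) auto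
  have j: "jump (t - x) \<in> theta \<rightarrow>\<^sub>M borel_01" using t x by (intro jump_borel_01) auto
  have g': "(\<lambda>\<theta>. 1 - t * (cos \<theta>)\<^sup>2) \<in> density theta (\<lambda>\<theta>. ennreal (refresh_weight t x \<theta>)) \<rightarrow>\<^sub>M borel_01"
    using g by (simp add: measurable_cong_sets[OF sets_density refl])
  have fj: "(\<lambda>\<theta>. f (jump (t - x) \<theta>)) \<in> borel_measurable theta" by (rule measurable_compose[OF j f(1)])
  have fg: "(\<lambda>\<theta>. f (1 - t * (cos \<theta>)\<^sup>2)) \<in> borel_measurable theta" by (rule measurable_compose[OF g f(1)])
  have w: "0 \<le> refresh_weight t x \<theta>" "refresh_weight t x \<theta> \<le> 1" for \<theta>
    using refresh_weight_bounds[of t x \<theta>] t x by auto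
  have c: "0 \<le> survival t x" using survival_bounds[of t x] t x by auto
  have "integrable theta (\<lambda>\<theta>. f (jump (t - x) \<theta>))"
    using fj f(2) jump_01[of "t - x"] t x by (intro theta.integrable_const_bound[where B = C]) auto
  then have 1: "integrable (distr theta borel_01 (jump (t - x))) f"
    using j f(1) by (simp add: integrable_distr_eq)
  have "integrable theta (\<lambda>\<theta>. refresh_weight t x \<theta> * f (1 - t * (cos \<theta>)\<^sup>2))"
  proof (rule theta.integrable_const_bound[where B = C])
    show "AE \<theta> in theta. norm (refresh_weight t x \<theta> * f (1 - t * (cos \<theta>)\<^sup>2)) \<le> C"
    proof (rule AE_I2)
      fix \<theta>
      have "\<bar>refresh_weight t x \<theta>\<bar> * \<bar>f (1 - t * (cos \<theta>)\<^sup>2)\<bar> \<le> 1 * C"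
        using w[of \<theta>] f(2) refresh_range[of t \<theta>] t by (intro mult_mono) auto
      then show "norm (refresh_weight t x \<theta> * f (1 - t * (cos \<theta>)\<^sup>2)) \<le> C" by (simp add: abs_mult)
    qed
    show "(\<lambda>\<theta>. refresh_weight t x \<theta> * f (1 - t * (cos \<theta>)\<^sup>2)) \<in> borel_measurable theta"
      using fg by simp
  qed
  then have 2: "integrable (distr (density theta (\<lambda>\<theta>. ennreal (refresh_weight t x \<theta>))) borel_01 (\<lambda>\<theta>. 1 - t * (cos \<theta>)\<^sup>2)) f"
    using g' f(1) fg w by (simp add: integrable_distr_eq integrable_density)
  have "(\<integral>y. f y \<partial>argmin_kernel t x) = survival t x * (\<integral>y. f y \<partial>distr theta borel_01 (jump (t - x)))
     + (\<integral>y. f y \<partial>distr (density theta (\<lambda>\<theta>. ennreal (refresh_weight t x \<theta>))) borel_01 (\<lambda>\<theta>. 1 - t * (cos \<theta>)\<^sup>2))"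
    unfolding argmin_kernel_eq[OF t x] using integral_scale_measure[OF 1 c] 2 by (subst integral_sum_measure) auto
  also have "(\<integral>y. f y \<partial>distr theta borel_01 (jump (t - x))) = (\<integral>\<theta>. f (jump (t - x) \<theta>) \<partial>theta)"
    using j f(1) by (rule integral_distr)
  also have "(\<integral>y. f y \<partial>distr (density theta (\<lambda>\<theta>. ennreal (refresh_weight t x \<theta>))) borel_01 (\<lambda>\<theta>. 1 - t * (cos \<theta>)\<^sup>2))
      = (\<integral>\<theta>. refresh_weight t x \<theta> * f (1 - t * (cos \<theta>)\<^sup>2) \<partial>theta)"
    using g' f(1) fg w by (simp add: integral_distr integral_density)
  finally show ?thesis .
qed

text \<open>For \<open>\<theta> < pi/2\<close> this is the derivative of \<open>arctan (r tan \<theta>)\<close>, in a form that is smooth at \<open>pi/2\<close>.\<close>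

lemma has_real_derivative_arctan_tan_sin_cos:
  fixes r :: real
  assumes "0 < r"
  shows "((\<lambda>\<theta>. \<theta> + arctan ((r - 1) * (sin \<theta> * cos \<theta>) / ((cos \<theta>)\<^sup>2 + r * (sin \<theta>)\<^sup>2)))
     has_real_derivative r / ((cos \<theta>)\<^sup>2 + r\<^sup>2 * (sin \<theta>)\<^sup>2)) (at \<theta>)"
proof -
  define s c where "s = sin \<theta>" and "c = cos \<theta>"
  \<comment> \<open>By the subtraction formula, \<open>N / D\<close> is the tangent of
    \<open>arctan (r * tan \<theta>) - \<theta>\<close>.\<close>
  define N D N' D' where "N = (r - 1) * (s * c)" and "D = c\<^sup>2 + r * s\<^sup>2"
    and "N' = (r - 1) * (c\<^sup>2 - s\<^sup>2)" and "D' = 2 * (r - 1) * (s * c)"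
  have sc: "s\<^sup>2 + c\<^sup>2 = 1" by (simp add: s_def c_def)
  have "0 < D"
  proof (cases "s = 0")
    case True
    then show ?thesis using sc by (simp add: D_def)
  qed (use \<open>0 < r\<close> in \<open>simp add: D_def add_nonneg_pos\<close>)
  define E where "E = c\<^sup>2 + r\<^sup>2 * s\<^sup>2"
  have ND: "N\<^sup>2 + D\<^sup>2 = E"
  proof -
    have "N\<^sup>2 + D\<^sup>2 = (s\<^sup>2 + c\<^sup>2) * E"
      by (simp add: N_def D_def E_def power2_eq_square algebra_simps)
    then show ?thesis by (simp add: sc)
  qed
  then have "0 < E" using \<open>0 < D\<close> by (metis add_nonneg_pos zero_le_power2 zero_less_power)
  have num: "N' * D - N * D' = (r - 1) * (c\<^sup>2 - r * s\<^sup>2)"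
  proof -
    have "N' * D - N * D' = (r - 1) * ((s\<^sup>2 + c\<^sup>2) * (c\<^sup>2 - r * s\<^sup>2))"
      by (simp add: N_def D_def N'_def D'_def power2_eq_square algebra_simps)
    then show ?thesis by (simp add: sc)
  qed
  have N: "((\<lambda>\<theta>. (r - 1) * (sin \<theta> * cos \<theta>)) has_real_derivative N') (at \<theta>)"
    by (auto intro!: derivative_eq_intros simp: N'_def s_def c_def power2_eq_square algebra_simps)
  have D: "((\<lambda>\<theta>. (cos \<theta>)\<^sup>2 + r * (sin \<theta>)\<^sup>2) has_real_derivative D') (at \<theta>)"
    by (auto intro!: derivative_eq_intros simp: D'_def s_def c_def algebra_simps)
  have "((\<lambda>\<theta>. (r - 1) * (sin \<theta> * cos \<theta>) / ((cos \<theta>)\<^sup>2 + r * (sin \<theta>)\<^sup>2)) has_real_derivative (N' * D - N * D') / (D * D)) (at \<theta>)"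
    using DERIV_divide[OF N D] \<open>0 < D\<close> by (simp add: N_def D_def s_def c_def)
  then have "((\<lambda>\<theta>. \<theta> + arctan ((r - 1) * (sin \<theta> * cos \<theta>) / ((cos \<theta>)\<^sup>2 + r * (sin \<theta>)\<^sup>2)))
     has_real_derivative 1 + inverse (1 + (N / D)\<^sup>2) * ((N' * D - N * D') / (D * D))) (at \<theta>)"
    by (intro DERIV_add DERIV_ident) (auto intro!: DERIV_chain2[OF DERIV_arctan, THEN DERIV_cong] simp: N_def D_def s_def c_def)
  moreover have "1 + inverse (1 + (N / D)\<^sup>2) * ((N' * D - N * D') / (D * D)) = r / E"
  proof -
    have "1 + (N / D)\<^sup>2 = E / (D * D)" using \<open>0 < D\<close> ND by (simp add: field_simps power2_eq_square)
    then have "inverse (1 + (N / D)\<^sup>2) * ((N' * D - N * D') / (D * D)) = (N' * D - N * D') / E"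
      using \<open>0 < D\<close> by simp
    then have "1 + inverse (1 + (N / D)\<^sup>2) * ((N' * D - N * D') / (D * D)) = (E + (r - 1) * (c\<^sup>2 - r * s\<^sup>2)) / E"
      using \<open>0 < E\<close> num by (simp add: add_divide_distrib)
    also have "E + (r - 1) * (c\<^sup>2 - r * s\<^sup>2) = r * (s\<^sup>2 + c\<^sup>2)"
      by (simp add: E_def power2_eq_square algebra_simps)
    finally show ?thesis by (simp add: sc)
  qed
  ultimately show ?thesis by (simp add: E_def s_def c_def)
qed

lemma integral_refresh_weight:
  assumes t: "0 < t" and x: "x \<le> 1"
  shows "(\<integral>\<theta>. refresh_weight t x \<theta> \<partial>theta) = 1 - survival t x"
proof (cases "x = 1")
  case True
  interpret theta: prob_space theta by (rule prob_space_theta)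
  have "(\<integral>\<theta>. refresh_weight t x \<theta> \<partial>theta) = (\<integral>\<theta>. 1 \<partial>theta)"
  proof (intro integral_cong_AE)
    show "AE \<theta> in theta. refresh_weight t x \<theta> = 1"
      using AE_theta
    proof eventually_elim
      case (elim \<theta>)
      then show ?case using sin_cos_theta[OF elim] t True by (simp add: refresh_weight_def)
    qed
  qed simp_all
  then show ?thesis using True theta.prob_space by (simp add: survival_def)
next
  case False
  interpret theta: prob_space theta by (rule prob_space_theta)
  define c where "c = 1 - x"
  have c: "0 < c" using False x by (simp add: c_def)
  \<comment> \<open>Chosen so that \<open>(cos \<theta>)^2 + r^2 * (sin \<theta>)^2\<close> is
    \<open>(t * (sin \<theta>)^2 + c) / c\<close>; then \<open>1 / r\<close> is
    \<open>survival t x\<close>.\<close>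
  define r where "r = sqrt ((c + t) / c)"
  have r: "0 < r" "r\<^sup>2 = (c + t) / c" using c t by (simp_all add: r_def)
  define F where "F \<theta> = \<theta> + arctan ((r - 1) * (sin \<theta> * cos \<theta>) / ((cos \<theta>)\<^sup>2 + r * (sin \<theta>)\<^sup>2))" for \<theta>
  have w: "1 - refresh_weight t x \<theta> = 1 / r * (r / ((cos \<theta>)\<^sup>2 + r\<^sup>2 * (sin \<theta>)\<^sup>2))" for \<theta>
  proof -
    have pos: "0 < t * (sin \<theta>)\<^sup>2 + c" using c t by (simp add: add_nonneg_pos)
    have "(cos \<theta>)\<^sup>2 + r\<^sup>2 * (sin \<theta>)\<^sup>2 = (t * (sin \<theta>)\<^sup>2 + c) / c"
      using c by (simp add: r(2) cos_squared_eq field_simps)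
    moreover have "1 - refresh_weight t x \<theta> = c / (t * (sin \<theta>)\<^sup>2 + c)"
      using pos by (simp add: refresh_weight_def c_def field_simps)
    ultimately show ?thesis using r(1) by simp
  qed
  have "has_bochner_integral lborel (\<lambda>\<theta>. 1 / r * (r / ((cos \<theta>)\<^sup>2 + r\<^sup>2 * (sin \<theta>)\<^sup>2)) * indicator {0..pi / 2} \<theta>) (1 / r * F (pi / 2) - 1 / r * F 0)"
  proof (rule has_bochner_integral_FTC_Icc_real)
    show "((\<lambda>\<theta>. 1 / r * F \<theta>) has_real_derivative 1 / r * (r / ((cos \<theta>)\<^sup>2 + r\<^sup>2 * (sin \<theta>)\<^sup>2))) (at \<theta>)" for \<theta>
      unfolding F_def[abs_def] by (intro DERIV_cmult has_real_derivative_arctan_tan_sin_cos r)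
    show "isCont (\<lambda>\<theta>. 1 / r * (r / ((cos \<theta>)\<^sup>2 + r\<^sup>2 * (sin \<theta>)\<^sup>2))) \<theta>" for \<theta>
      unfolding w[symmetric] refresh_weight_def c_def[symmetric] add_diff_eq[symmetric]
      using c t by (auto intro!: continuous_intros simp: add_nonneg_pos less_imp_neq[symmetric] add_diff_eq)
  qed simp
  then have "(\<integral>\<theta>. (1 - refresh_weight t x \<theta>) * indicator {0..pi / 2} \<theta> \<partial>lborel) = 1 / r * (pi / 2)"
    unfolding w[symmetric] F_def by (simp add: has_bochner_integral_iff)
  then have "(\<integral>\<theta>. 1 - refresh_weight t x \<theta> \<partial>theta) = 2 / pi * (1 / r * (pi / 2))"
    by (subst integral_theta) (simp_all add: mult_ac)
  moreover have "integrable theta (refresh_weight t x)"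
    using refresh_weight_bounds[of t x] t x by (intro theta.integrable_const_bound[where B = 1]) auto
  ultimately have "1 - (\<integral>\<theta>. refresh_weight t x \<theta> \<partial>theta) = 1 / r"
    using theta.prob_space by simp
  moreover have "1 / r = survival t x"
    using c t by (simp add: r_def survival_def c_def real_sqrt_divide)
  ultimately show ?thesis by simp
qed

section \<open>Continuity of the kernel in the starting point and in time\<close>

lemma continuous_on_integral_theta:
  fixes h :: "real \<Rightarrow> real \<Rightarrow> real"
  assumes cont: "\<And>\<theta>. \<theta> \<in> {0<..<pi / 2} \<Longrightarrow> continuous_on S (\<lambda>x. h x \<theta>)"
    and meas: "\<And>x. x \<in> S \<Longrightarrow> h x \<in> borel_measurable theta"
    and bound: "\<And>x \<theta>. x \<in> S \<Longrightarrow> \<theta> \<in> {0<..<pi / 2} \<Longrightarrow> \<bar>h x \<theta>\<bar> \<le> C"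
  shows "continuous_on S (\<lambda>x. \<integral>\<theta>. h x \<theta> \<partial>theta)"
  unfolding continuous_on_sequentially
proof (intro allI ballI impI, elim conjE)
  interpret theta: prob_space theta by (rule prob_space_theta)
  fix X a assume a: "a \<in> S" "\<forall>n. X n \<in> S" "X \<longlonglongrightarrow> a"
  show "((\<lambda>x. \<integral>\<theta>. h x \<theta> \<partial>theta) \<circ> X) \<longlonglongrightarrow> (\<integral>\<theta>. h a \<theta> \<partial>theta)"
    unfolding comp_def
  proof (rule integral_dominated_convergence[where w = "\<lambda>_. C"])
    show "AE \<theta> in theta. (\<lambda>i. h (X i) \<theta>) \<longlonglongrightarrow> h a \<theta>"
      using AE_theta
    proof eventually_elim
      case (elim \<theta>)
      show ?case using cont[OF elim] a unfolding continuous_on_sequentially comp_def by blast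
    qed
    show "AE \<theta> in theta. norm (h (X i) \<theta>) \<le> C" for i
      using AE_theta by eventually_elim (use a bound in auto)
  qed (use a meas in auto)
qed

lemma continuous_on_01_bounded:
  fixes f :: "real \<Rightarrow> real"
  assumes "continuous_on {0..1} f"
  obtains C where "0 \<le> C" "\<And>y. y \<in> {0..1} \<Longrightarrow> \<bar>f y\<bar> \<le> C"
proof -
  have "bounded (f ` {0..1})"
    using assms by (intro compact_imp_bounded compact_continuous_image) auto
  then obtain C where "\<forall>y\<in>{0..1}. norm (f y) \<le> C" by (auto simp: bounded_iff)
  then show ?thesis by (intro that[of "max C 0"]) (auto simp: le_max_iff_disj)
qed

lemma continuous_on_01_measurable:
  fixes f :: "real \<Rightarrow> real"
  shows "continuous_on {0..1} f \<Longrightarrow> f \<in> borel_measurable borel_01"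
  by (rule borel_measurable_continuous_on_restrict)

text \<open>The passage from the atom to the density at \<open>x = t\<close> is the point
  \<open>a = 0\<close>, where both branches of \<open>jump\<close> vanish. The second branch is
  continuous there for each fixed angle below \<open>pi / 2\<close>, because
  \<open>cos \<theta>\<close> is positive.\<close>

lemma continuous_on_jump_integral:
  fixes f :: "real \<Rightarrow> real"
  assumes f: "continuous_on {0..1} f"
  shows "continuous_on {-1..1} (\<lambda>a. \<integral>\<theta>. f (jump a \<theta>) \<partial>theta)"
proof -
  obtain C where C: "\<And>y. y \<in> {0..1} \<Longrightarrow> \<bar>f y\<bar> \<le> C"
    using continuous_on_01_bounded[OF f] by blast
  show ?thesis
  proof (rule continuous_on_integral_theta)
    fix \<theta> :: real assume \<theta>: "\<theta> \<in> {0<..<pi / 2}"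
    note sc = sin_cos_theta[OF \<theta>]
    have "continuous_on {-1..1} (\<lambda>a. jump a \<theta>)"
    proof -
      have "continuous_on ({-1..0} \<union> {0..1}) (\<lambda>a. if a \<le> 0 then - a else a * (sin \<theta>)\<^sup>2 / (a + (cos \<theta>)\<^sup>2))"
      proof (rule continuous_on_If)
        show "continuous_on {0..1} (\<lambda>a. a * (sin \<theta>)\<^sup>2 / (a + (cos \<theta>)\<^sup>2))"
          using sc by (intro continuous_intros) (auto simp: add_nonneg_pos less_imp_neq[symmetric])
      qed (auto intro!: continuous_intros)
      moreover have "{-1..0} \<union> {0..1} = {-1..1 :: real}" by auto
      ultimately show ?thesis by (simp add: jump_def[abs_def])
    qed
    then show "continuous_on {-1..1} (\<lambda>a. f (jump a \<theta>))"
      by (rule continuous_on_compose2[OF f]) (use jump_01 in auto)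
  next
    show "(\<lambda>\<theta>. f (jump a \<theta>)) \<in> borel_measurable theta" if "a \<in> {-1..1}" for a
      using that by (intro measurable_compose[OF jump_borel_01 continuous_on_01_measurable[OF f]]) auto
    show "\<bar>f (jump a \<theta>)\<bar> \<le> C" if "a \<in> {-1..1}" for a \<theta>
      using that jump_01[of a \<theta>] by (intro C) auto
  qed
qed

lemma continuous_on_argmin_kernel_integral:
  fixes f :: "real \<Rightarrow> real"
  assumes t: "0 \<le> t" and f: "continuous_on {0..1} f"
  shows "continuous_on {0..1} (\<lambda>x. \<integral>y. f y \<partial>argmin_kernel t x)"
proof -
  obtain C where C: "\<And>y. y \<in> {0..1} \<Longrightarrow> \<bar>f y\<bar> \<le> C"
    using continuous_on_01_bounded[OF f] by blast
  note fm = continuous_on_01_measurable[OF f]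
  consider "t = 0" | "1 < t" | "0 < t" "t \<le> 1" using t by linarith
  then show ?thesis
  proof cases
    case 1
    have "(\<integral>y. f y \<partial>argmin_kernel t x) = f x" if "x \<in> {0..1}" for x
      using that 1 fm by (simp add: argmin_kernel_def integral_return space_restrict_space)
    then show ?thesis by (intro continuous_on_eq[OF f]) simp
  next
    case 2
    then show ?thesis by (simp add: argmin_kernel_after_1)
  next
    case 3
    have "continuous_on {0..1} (\<lambda>x. survival t x * (\<integral>\<theta>. f (jump (t - x) \<theta>) \<partial>theta)
        + (\<integral>\<theta>. refresh_weight t x \<theta> * f (1 - t * (cos \<theta>)\<^sup>2) \<partial>theta))"
    proof (intro continuous_on_add continuous_on_mult)
      show "continuous_on {0..1} (survival t)"
        unfolding survival_def[abs_def] using 3 by (intro continuous_intros) auto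
      show "continuous_on {0..1} (\<lambda>x. \<integral>\<theta>. f (jump (t - x) \<theta>) \<partial>theta)"
        using 3 by (intro continuous_on_compose2[OF continuous_on_jump_integral[OF f]] continuous_intros) auto
      show "continuous_on {0..1} (\<lambda>x. \<integral>\<theta>. refresh_weight t x \<theta> * f (1 - t * (cos \<theta>)\<^sup>2) \<partial>theta)"
      proof (rule continuous_on_integral_theta)
        fix \<theta> :: real assume \<theta>: "\<theta> \<in> {0<..<pi / 2}"
        \<comment> \<open>This keeps the denominator of the weight positive even at
          \<open>x = 1\<close>.\<close>
        have "0 < t * (sin \<theta>)\<^sup>2" using sin_cos_theta[OF \<theta>] 3 by simp
        then show "continuous_on {0..1} (\<lambda>x. refresh_weight t x \<theta> * f (1 - t * (cos \<theta>)\<^sup>2))"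
          unfolding refresh_weight_def by (intro continuous_intros) auto
      next
        fix x :: real assume x: "x \<in> {0..1}"
        have "(\<lambda>\<theta>. f (1 - t * (cos \<theta>)\<^sup>2)) \<in> borel_measurable theta"
          using 3 by (intro measurable_compose[OF refresh_borel_01 fm]) auto
        then show "(\<lambda>\<theta>. refresh_weight t x \<theta> * f (1 - t * (cos \<theta>)\<^sup>2)) \<in> borel_measurable theta" by simp
        fix \<theta>
        have "\<bar>refresh_weight t x \<theta>\<bar> * \<bar>f (1 - t * (cos \<theta>)\<^sup>2)\<bar> \<le> 1 * C"
          using refresh_weight_bounds[of t x \<theta>] C refresh_range[of t \<theta>] 3 x by (intro mult_mono) auto
        then show "\<bar>refresh_weight t x \<theta> * f (1 - t * (cos \<theta>)\<^sup>2)\<bar> \<le> C" by (simp add: abs_mult)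
      qed
    qed
    moreover have "(\<integral>y. f y \<partial>argmin_kernel t x) = survival t x * (\<integral>\<theta>. f (jump (t - x) \<theta>) \<partial>theta)
        + (\<integral>\<theta>. refresh_weight t x \<theta> * f (1 - t * (cos \<theta>)\<^sup>2) \<partial>theta)" if "x \<in> {0..1}" for x
      using that 3 C by (intro integral_argmin_kernel fm) auto
    ultimately show ?thesis by (elim continuous_on_eq) simp
  qed
qed

lemma prob_space_argmin_kernel:
  assumes t: "0 \<le> t" and x: "x \<in> {0..1}"
  shows "prob_space (argmin_kernel t x)"
proof -
  have *: "prob_space (argmin_kernel t x)" if t: "0 < t" "t \<le> 1" and x: "x \<in> {0..1}" for t x
  proof -
    interpret theta: prob_space theta by (rule prob_space_theta)
    have S: "{0..1} \<in> sets borel_01" using sets.top[of borel_01] by (simp add: space_restrict_space)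
    have c: "0 \<le> survival t x" "survival t x \<le> 1" using survival_bounds[of t x] t x by auto
    have w: "integrable theta (refresh_weight t x)"
      using refresh_weight_bounds[of t x] t x by (intro theta.integrable_const_bound[where B = 1]) auto
    have j: "jump (t - x) \<in> theta \<rightarrow>\<^sub>M borel_01" using t x by (intro jump_borel_01) auto
    have g: "(\<lambda>\<theta>. 1 - t * (cos \<theta>)\<^sup>2) \<in> theta \<rightarrow>\<^sub>M borel_01" using t by (intro refresh_borel_01) auto
    have g': "(\<lambda>\<theta>. 1 - t * (cos \<theta>)\<^sup>2) \<in> density theta (\<lambda>\<theta>. ennreal (refresh_weight t x \<theta>)) \<rightarrow>\<^sub>M borel_01"
      using g by (simp add: measurable_cong_sets[OF sets_density refl])
    have "emeasure (density theta (\<lambda>\<theta>. ennreal (refresh_weight t x \<theta>))) UNIV = (\<integral>\<^sup>+\<theta>. ennreal (refresh_weight t x \<theta>) \<partial>theta)"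
      by (subst emeasure_density) auto
    also have "\<dots> = ennreal (1 - survival t x)"
      using nn_integral_eq_integral[OF w] refresh_weight_bounds[of t x] t x by (simp add: integral_refresh_weight)
    finally have m: "emeasure (density theta (\<lambda>\<theta>. ennreal (refresh_weight t x \<theta>))) UNIV = ennreal (1 - survival t x)" .
    have vim: "jump (t - x) -` {0..1} = UNIV" "(\<lambda>\<theta>. 1 - t * (cos \<theta>)\<^sup>2) -` {0..1} = UNIV"
      using jump_01[of "t - x"] refresh_range[of t] t x by auto
    have "emeasure (argmin_kernel t x) {0..1} = ennreal (survival t x) * 1 + ennreal (1 - survival t x)"
      unfolding argmin_kernel_eq[OF t x] using S j g' m vim theta.emeasure_space_1
      by (simp add: emeasure_sum_measure emeasure_distr)
    also have "\<dots> = 1" using c by (simp flip: ennreal_plus)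
    finally show ?thesis by (intro prob_spaceI) simp
  qed
  consider "t = 0" | "1 < t" | "0 < t" "t \<le> 1" using t by linarith
  then show ?thesis
  proof cases
    case 1
    then show ?thesis using x by (auto simp: argmin_kernel_def space_restrict_space intro!: prob_space_return)
  next
    case 2
    then show ?thesis using *[of 1 0] by (simp add: argmin_kernel_after_1)
  qed (use * x in auto)
qed

lemma measurable_argmin_kernel:
  assumes t: "0 \<le> t"
  shows "argmin_kernel t \<in> borel_01 \<rightarrow>\<^sub>M prob_algebra borel_01"
proof (intro measurable_prob_algebraI measurable_subprob_algebra)
  show p: "prob_space (argmin_kernel t x)" if "x \<in> space borel_01" for x
    using that t prob_space_argmin_kernel by (auto simp: space_restrict_space)
  show "subprob_space (argmin_kernel t x)" if "x \<in> space borel_01" for x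
    using p[OF that] by (rule prob_space_imp_subprob_space)
  fix A assume A: "A \<in> sets borel_01"
  then have [measurable]: "A \<in> sets borel" using sets_borel_01D by blast
  consider "t = 0" | "1 < t" | "0 < t" "t \<le> 1" using t by linarith
  then show "(\<lambda>x. emeasure (argmin_kernel t x) A) \<in> borel_measurable borel_01"
  proof cases
    case 1
    then show ?thesis using A by (simp add: argmin_kernel_def)
  next
    case 2
    then show ?thesis by (simp add: argmin_kernel_after_1)
  next
    case 3
    interpret theta: prob_space theta by (rule prob_space_theta)
    have eq: "emeasure (argmin_kernel t x) A = ennreal (survival t x) * (\<integral>\<^sup>+\<theta>. indicator A (jump (t - x) \<theta>) \<partial>theta)
       + (\<integral>\<^sup>+\<theta>. ennreal (refresh_weight t x \<theta>) * indicator A (1 - t * (cos \<theta>)\<^sup>2) \<partial>theta)" if x: "x \<in> {0..1}" for x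
    proof -
      have j: "jump (t - x) \<in> theta \<rightarrow>\<^sub>M borel_01" using 3 x by (intro jump_borel_01) auto
      have g: "(\<lambda>\<theta>. 1 - t * (cos \<theta>)\<^sup>2) \<in> theta \<rightarrow>\<^sub>M borel_01" using 3 by (intro refresh_borel_01) auto
      have g': "(\<lambda>\<theta>. 1 - t * (cos \<theta>)\<^sup>2) \<in> density theta (\<lambda>\<theta>. ennreal (refresh_weight t x \<theta>)) \<rightarrow>\<^sub>M borel_01"
        using g by (simp add: measurable_cong_sets[OF sets_density refl])
      have "(\<integral>\<^sup>+\<theta>. indicator A (jump (t - x) \<theta>) \<partial>theta) = (\<integral>\<^sup>+y. indicator A y \<partial>distr theta borel_01 (jump (t - x)))"
        using A by (intro nn_integral_distr[OF j, symmetric]) simp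
      moreover have "(\<integral>\<^sup>+\<theta>. ennreal (refresh_weight t x \<theta>) * indicator A (1 - t * (cos \<theta>)\<^sup>2) \<partial>theta)
         = (\<integral>\<^sup>+y. indicator A y \<partial>distr (density theta (\<lambda>\<theta>. ennreal (refresh_weight t x \<theta>))) borel_01 (\<lambda>\<theta>. 1 - t * (cos \<theta>)\<^sup>2))"
        using A by (subst nn_integral_distr[OF g']) (simp_all add: nn_integral_density)
      ultimately show ?thesis
        unfolding argmin_kernel_eq[OF 3 x] using A by (simp add: emeasure_sum_measure)
    qed
    \<comment> \<open>The right-hand side makes sense for every real \<open>x\<close> and its
      integrands are jointly measurable in \<open>x\<close> and \<open>\<theta>\<close>, so
      measurability is shown on the whole line and then restricted.\<close>
    have "(\<lambda>x. ennreal (survival t x) * (\<integral>\<^sup>+\<theta>. indicator A (jump (t - x) \<theta>) \<partial>theta)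
       + (\<integral>\<^sup>+\<theta>. ennreal (refresh_weight t x \<theta>) * indicator A (1 - t * (cos \<theta>)\<^sup>2) \<partial>theta)) \<in> borel_measurable borel"
      unfolding survival_def jump_def refresh_weight_def by measurable
    from measurable_restrict_space1[OF this, of "{0..1}"] show ?thesis
      by (rule measurable_cong[THEN iffD2, rotated]) (auto simp: eq space_restrict_space)
  qed
qed simp

text \<open>The \<open>jump\<close> part translates by \<open>t\<close>, or stays close to 0 when
  \<open>x < t\<close>, uniformly in \<open>x\<close>. The refreshed part lands near 1, which is
  harmless if \<open>x\<close> is near 1 and otherwise has small weight.\<close>

lemma argmin_kernel_strongly_continuous:
  fixes f :: "real \<Rightarrow> real"
  assumes f: "continuous_on {0..1} f" and "0 < e"
  shows "\<forall>\<^sub>F t in at_right 0. \<forall>x\<in>{0..1}. \<bar>(\<integral>y. f y \<partial>argmin_kernel t x) - f x\<bar> \<le> e"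
proof -
  interpret theta: prob_space theta by (rule prob_space_theta)
  obtain C where C: "0 \<le> C" "\<And>y. y \<in> {0..1} \<Longrightarrow> \<bar>f y\<bar> \<le> C"
    using continuous_on_01_bounded[OF f] by blast
  note fm = continuous_on_01_measurable[OF f]
  \<comment> \<open>Two thirds of the error are spent on the \<open>jump\<close> part and one third
    on the refreshed part.\<close>
  define e' where "e' = e / 3"
  have e': "0 < e'" using \<open>0 < e\<close> by (simp add: e'_def)
  have "uniformly_continuous_on {0..1} f" using f by (rule compact_uniformly_continuous) simp
  then obtain d where d: "0 < d" "\<And>x y. x \<in> {0..1} \<Longrightarrow> y \<in> {0..1} \<Longrightarrow> \<bar>y - x\<bar> < d \<Longrightarrow> \<bar>f y - f x\<bar> < e'"
    using e' unfolding uniformly_continuous_on_def dist_real_def by metis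
  define h where "h a = (\<integral>\<theta>. f (jump a \<theta>) \<partial>theta)" for a
  have h0: "h a = f (- a)" if "a \<le> 0" for a
    using that theta.prob_space by (simp add: h_def jump_def)
  obtain d2 where d2: "0 < d2" "\<And>a. a \<in> {-1..1} \<Longrightarrow> \<bar>a\<bar> < d2 \<Longrightarrow> \<bar>h a - f 0\<bar> < e'"
  proof -
    have "continuous_on {-1..1} h" using continuous_on_jump_integral[OF f] by (simp add: h_def[abs_def])
    then have "\<exists>d>0. \<forall>a\<in>{-1..1}. dist a 0 < d \<longrightarrow> dist (h a) (h 0) < e'"
      using e' unfolding continuous_on_iff by (elim ballE[of _ _ 0]) auto
    then show ?thesis using h0[of 0] that by (auto simp: dist_real_def)
  qed
  \<comment> \<open>The bound 1 gives access to the angular representation, \<open>d / 2\<close>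
    keeps displacements below \<open>d\<close>, and \<open>d2\<close> controls the jumps near 0. The
    last entry makes the weight bound \<open>t / (d / 2)\<close> times the oscillation bound
    \<open>2 * (C + 1)\<close> at most \<open>e'\<close>.\<close>
  define t0 where "t0 = Min {1, d / 2, d2, e' * d / (4 * (C + 1))}"
  have "0 < e' * d / (4 * (C + 1))" using e' d(1) C(1) by (intro divide_pos_pos mult_pos_pos) auto
  then have "0 < t0" using d(1) d2(1) unfolding t0_def by (subst Min_gr_iff) auto
  moreover have "t0 \<le> 1" "t0 \<le> d / 2" "t0 \<le> d2" "t0 \<le> e' * d / (4 * (C + 1))"
    unfolding t0_def by (rule Min_le; simp)+
  ultimately have t0: "0 < t0" "t0 \<le> 1" "t0 \<le> d / 2" "t0 \<le> d2" "t0 \<le> e' * d / (4 * (C + 1))" .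
  have "\<bar>(\<integral>y. f y \<partial>argmin_kernel t x) - f x\<bar> \<le> e" if t: "0 < t" "t < t0" and x: "x \<in> {0..1}" for t x
  proof -
    have t1: "t \<le> 1" using t t0 by simp
    define w where "w = refresh_weight t x"
    define g where "g \<theta> = f (1 - t * (cos \<theta>)\<^sup>2)" for \<theta>
    have w: "0 \<le> w \<theta>" "w \<theta> \<le> 1" for \<theta>
      using refresh_weight_bounds[of t x \<theta>] t x by (auto simp: w_def)
    have c: "0 \<le> survival t x" "survival t x \<le> 1" using survival_bounds[of t x] t x by auto
    have [measurable]: "g \<in> borel_measurable theta" "w \<in> borel_measurable theta"
      unfolding g_def[abs_def] w_def using t t1 by (auto intro!: measurable_compose[OF refresh_borel_01 fm])
    have g: "\<bar>g \<theta>\<bar> \<le> C" for \<theta> using C(2) refresh_range[of t \<theta>] t t1 by (auto simp: g_def)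
    have wi: "integrable theta w"
      using w by (intro theta.integrable_const_bound[where B = 1]) auto
    have wg: "integrable theta (\<lambda>\<theta>. w \<theta> * g \<theta>)"
      using w mult_mono[OF w(2) g _ abs_ge_zero]
      by (intro theta.integrable_const_bound[where B = C]) (auto simp: abs_mult)
    have 1: "\<bar>h (t - x) - f x\<bar> \<le> 2 * e'"
    proof (cases "t \<le> x")
      case True
      then have "\<bar>f (x - t) - f x\<bar> < e'" using d(2)[of x "x - t"] t t0 x by auto
      then show ?thesis using h0[of "t - x"] True e' by simp
    next
      case False
      have "\<bar>h (t - x) - f 0\<bar> < e'" using d2(2)[of "t - x"] False t t0 x by auto
      moreover have "\<bar>f 0 - f x\<bar> < e'" using d(2)[of x 0] False t t0 x by auto
      ultimately show ?thesis by simp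
    qed
    have 2: "\<bar>w \<theta> * (g \<theta> - f x)\<bar> \<le> e'" for \<theta>
    proof (cases "1 - x < d / 2")
      case True
      have "0 \<le> t * (cos \<theta>)\<^sup>2" "t * (cos \<theta>)\<^sup>2 \<le> t"
        using t mult_left_mono[of "(cos \<theta>)\<^sup>2" 1 t] by (auto simp: abs_square_le_1)
      moreover have "\<bar>1 - q - x\<bar> < d" if "0 \<le> q" "q \<le> t" for q
        using that True t t0 x by auto
      ultimately have "\<bar>1 - t * (cos \<theta>)\<^sup>2 - x\<bar> < d" by blast
      then have "\<bar>g \<theta> - f x\<bar> < e'" using d(2)[of x "1 - t * (cos \<theta>)\<^sup>2"] refresh_range[of t \<theta>] t t1 x by (auto simp: g_def)
      then have "\<bar>w \<theta>\<bar> * \<bar>g \<theta> - f x\<bar> \<le> 1 * e'" using w[of \<theta>] by (intro mult_mono) auto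
      then show ?thesis by (simp add: abs_mult)
    next
      case False
      have s: "0 \<le> t * (sin \<theta>)\<^sup>2" "t * (sin \<theta>)\<^sup>2 \<le> t * 1"
        using t by (auto intro!: mult_left_mono simp: abs_square_le_1)
      have "w \<theta> \<le> t / (d / 2)"
        unfolding w_def refresh_weight_def using s d False by (intro frac_le) auto
      moreover have "\<bar>g \<theta> - f x\<bar> \<le> 2 * (C + 1)" using abs_triangle_ineq4[of "g \<theta>" "f x"] g[of \<theta>] C(1) C(2)[OF x] by simp
      ultimately have "\<bar>w \<theta>\<bar> * \<bar>g \<theta> - f x\<bar> \<le> t / (d / 2) * (2 * (C + 1))"
        using w[of \<theta>] t d by (intro mult_mono) auto
      also have "\<dots> \<le> (e' * d / (4 * (C + 1))) / (d / 2) * (2 * (C + 1))"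
        using t t0 d C by (intro mult_right_mono divide_right_mono) auto
      also have "\<dots> = e'"
      proof -
        have eq: "e' * d / (4 * k) / (d / 2) * (2 * k) = e'" if "0 < k" for k using that d(1) by simp
        show ?thesis using C(1) by (intro eq) simp
      qed
      finally show ?thesis by (simp add: abs_mult)
    qed
    have "(\<integral>y. f y \<partial>argmin_kernel t x) = survival t x * h (t - x) + (\<integral>\<theta>. w \<theta> * g \<theta> \<partial>theta)"
      unfolding h_def w_def g_def using t t1 x C fm by (intro integral_argmin_kernel) auto
    moreover have "f x = survival t x * f x + (\<integral>\<theta>. w \<theta> * f x \<partial>theta)"
    proof -
      have "(\<integral>\<theta>. w \<theta> \<partial>theta) = 1 - survival t x"
        unfolding w_def using t x by (intro integral_refresh_weight) auto
      then have "f x = (survival t x + (\<integral>\<theta>. w \<theta> \<partial>theta)) * f x" by simp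
      also have "\<dots> = survival t x * f x + (\<integral>\<theta>. w \<theta> * f x \<partial>theta)" by (simp add: distrib_right)
      finally show ?thesis .
    qed
    ultimately have "(\<integral>y. f y \<partial>argmin_kernel t x) - f x = survival t x * (h (t - x) - f x) + (\<integral>\<theta>. w \<theta> * (g \<theta> - f x) \<partial>theta)"
      using wg wi by (simp add: right_diff_distrib)
    moreover have "\<bar>survival t x * (h (t - x) - f x)\<bar> \<le> 1 * (2 * e')"
      unfolding abs_mult using c 1 by (intro mult_mono) auto
    moreover have "\<bar>\<integral>\<theta>. w \<theta> * (g \<theta> - f x) \<partial>theta\<bar> \<le> e'"
    proof -
      have "\<bar>\<integral>\<theta>. w \<theta> * (g \<theta> - f x) \<partial>theta\<bar> \<le> (\<integral>\<theta>. \<bar>w \<theta> * (g \<theta> - f x)\<bar> \<partial>theta)"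
        using integral_norm_bound[of theta "\<lambda>\<theta>. w \<theta> * (g \<theta> - f x)"] by simp
      also have "\<dots> \<le> (\<integral>\<theta>. e' \<partial>theta)"
        using 2 e' by (intro integral_mono theta.integrable_const_bound[where B = e']) auto
      finally show ?thesis using theta.prob_space by simp
    qed
    ultimately have "\<bar>(\<integral>y. f y \<partial>argmin_kernel t x) - f x\<bar> \<le> 3 * e'" by linarith
    then show ?thesis by (simp add: e'_def)
  qed
  then show ?thesis
    unfolding eventually_at_right_field using t0(1) by blast
qed

section \<open>The minimum of a Brownian path\<close>

lemma grid_Min_tendsto_Inf:
  fixes f :: "real \<Rightarrow> real"
  assumes f: "continuous_on {a..b} f" and ab: "a \<le> b"
  shows "(\<lambda>n. Min ((\<lambda>i. f (a + (b - a) * real i / real (Suc n))) ` {..Suc n})) \<longlonglongrightarrow> Inf (f ` {a..b})"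
proof -
  define m where "m = Inf (f ` {a..b})"
  obtain x0 where x0: "x0 \<in> {a..b}" "\<And>y. y \<in> {a..b} \<Longrightarrow> f x0 \<le> f y"
    using continuous_attains_inf[OF compact_Icc _ f] ab by auto
  have m: "m = f x0"
    unfolding m_def using x0 by (intro cInf_eq_minimum) auto
  have grid: "a + (b - a) * real i / real (Suc n) \<in> {a..b}" if "i \<le> Suc n" for i n
  proof -
    have "(b - a) * (real i / real (Suc n)) \<le> (b - a) * 1"
      using that ab by (intro mult_left_mono) (auto simp: divide_le_eq_1)
    then show ?thesis using ab by simp
  qed
  show ?thesis
    unfolding m_def[symmetric]
  proof (rule LIMSEQ_I)
    fix e :: real assume "0 < e"
    have "uniformly_continuous_on {a..b} f" using f by (rule compact_uniformly_continuous) simp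
    then obtain d where d: "0 < d" "\<And>x y. x \<in> {a..b} \<Longrightarrow> y \<in> {a..b} \<Longrightarrow> \<bar>y - x\<bar> < d \<Longrightarrow> \<bar>f y - f x\<bar> < e"
      using \<open>0 < e\<close> unfolding uniformly_continuous_on_def dist_real_def by metis
    obtain n0 where n0: "(b - a) / d < real n0" using reals_Archimedean2 by blast
    have "norm (Min ((\<lambda>i. f (a + (b - a) * real i / real (Suc n))) ` {..Suc n}) - m) < e" if "n0 \<le> n" for n
    proof -
      let ?M = "Min ((\<lambda>i. f (a + (b - a) * real i / real (Suc n))) ` {..Suc n})"
      have "m \<le> ?M"
        using grid x0 by (auto simp: m)
      moreover have "\<exists>i\<le>Suc n. \<bar>a + (b - a) * real i / real (Suc n) - x0\<bar> < d"
      proof (cases "a = b")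
        case True
        then show ?thesis using x0 d by auto
      next
        case False
        then have "a < b" using ab by simp
        define y where "y = (x0 - a) / (b - a) * real (Suc n)"
        have y: "0 \<le> y" "y \<le> real (Suc n)"
          unfolding y_def using x0 \<open>a < b\<close> by (auto simp: divide_le_eq intro!: mult_left_le_one_le)
        define i where "i = nat \<lfloor>y\<rfloor>"
        have i: "real i \<le> y" "y < real i + 1" using y unfolding i_def by linarith+
        have "i \<le> Suc n" using i y by linarith
        moreover have "\<bar>a + (b - a) * real i / real (Suc n) - x0\<bar> < d"
        proof -
          have "x0 = a + (b - a) * y / real (Suc n)" using \<open>a < b\<close> by (simp add: y_def)
          then have "x0 - (a + (b - a) * real i / real (Suc n)) = (b - a) * (y - real i) / real (Suc n)"
            by (simp add: diff_divide_distrib right_diff_distrib)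
          moreover have "\<bar>(b - a) * (y - real i) / real (Suc n)\<bar> \<le> (b - a) / real (Suc n)"
            using i \<open>a < b\<close> by (auto simp: abs_mult intro!: divide_right_mono mult_left_le)
          moreover have "(b - a) / real (Suc n) < d"
          proof -
            have "(b - a) / d < real (Suc n)" using n0 that by simp
            then show ?thesis using d by (simp add: field_simps)
          qed
          ultimately show ?thesis by linarith
        qed
        ultimately show ?thesis by blast
      qed
      then obtain i where i: "i \<le> Suc n" "\<bar>a + (b - a) * real i / real (Suc n) - x0\<bar> < d" by blast
      have "f (a + (b - a) * real i / real (Suc n)) < m + e"
        using d(2)[OF x0(1) grid[OF i(1)] i(2)] by (simp add: m)
      moreover have "?M \<le> f (a + (b - a) * real i / real (Suc n))"
        using i(1) by (intro Min_le) auto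
      ultimately show ?thesis by simp
    qed
    then show "\<exists>no. \<forall>n\<ge>no. norm (Min ((\<lambda>i. f (a + (b - a) * real i / real (Suc n))) ` {..Suc n}) - m) < e"
      by blast
  qed
qed

text \<open>By compactness, \<open>f\<close> exceeds its minimum by a fixed gap outside an
  \<open>\<epsilon>\<close>-neighbourhood of \<open>u + p\<close>. By uniform continuity, the grid
  minimum comes within that gap, so the grid minimiser must lie in the neighbourhood.\<close>

lemma grid_argmin_tendsto:
  fixes f :: "real \<Rightarrow> real" and A :: "nat \<Rightarrow> nat"
  assumes f: "continuous_on {0..} f" and u: "0 \<le> u" and p: "p \<in> {0..1}"
    and uniq: "\<And>s. s \<in> {0..1} \<Longrightarrow> s \<noteq> p \<Longrightarrow> f (u + p) < f (u + s)"
    and A: "\<And>n. A n \<le> n" "\<And>n i. i \<le> n \<Longrightarrow> f (real (nat \<lfloor>real n * u\<rfloor> + A n) / real n) \<le> f (real (nat \<lfloor>real n * u\<rfloor> + i) / real n)"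
  shows "(\<lambda>n. real (A n) / real n) \<longlonglongrightarrow> p"
proof (rule LIMSEQ_I)
  fix r :: real assume "0 < r"
  define \<epsilon> where "\<epsilon> = r / 2"
  have \<epsilon>: "0 < \<epsilon>" using \<open>0 < r\<close> by (simp add: \<epsilon>_def)
  define K where "K = {u..u + 1} - {u + p - \<epsilon><..<u + p + \<epsilon>}"
  have "compact K" unfolding K_def by (intro compact_diff) auto
  obtain \<eta> where \<eta>: "0 < \<eta>" "\<And>y. y \<in> K \<Longrightarrow> f (u + p) + 3 * \<eta> \<le> f y"
  proof (cases "K = {}")
    case True
    then show ?thesis using that[of 1] by simp
  next
    case False
    have "continuous_on K f" by (rule continuous_on_subset[OF f]) (use u in \<open>auto simp: K_def\<close>)
    then obtain y where y: "y \<in> K" "\<And>z. z \<in> K \<Longrightarrow> f y \<le> f z"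
      using continuous_attains_inf[OF \<open>compact K\<close> False] by blast
    have "f (u + p) < f (u + (y - u))" using y(1) \<epsilon> by (intro uniq) (auto simp: K_def)
    moreover have "f (u + p) + 3 * ((f y - f (u + p)) / 3) = f y" by (simp add: field_simps)
    ultimately show ?thesis using y(2) by (intro that[of "(f y - f (u + p)) / 3"]) (simp_all only:, simp)
  qed
  have "uniformly_continuous_on {0..u + 2} f"
    by (rule compact_uniformly_continuous) (auto intro: continuous_on_subset[OF f])
  then obtain d where d: "0 < d" "\<And>x y. x \<in> {0..u + 2} \<Longrightarrow> y \<in> {0..u + 2} \<Longrightarrow> \<bar>y - x\<bar> < d \<Longrightarrow> \<bar>f y - f x\<bar> < \<eta>"
    using \<eta>(1) unfolding uniformly_continuous_on_def dist_real_def by metis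
  obtain n0 where n0: "2 / d + 2 / \<epsilon> + 2 < real n0" using reals_Archimedean2 by blast
  have "norm (real (A n) / real n - p) < r" if n: "n0 \<le> n" for n
  proof -
    have pos: "0 < 2 / d" "0 < 2 / \<epsilon>" using d \<epsilon> by auto
    then have n1: "2 / d < real n" "2 / \<epsilon> < real n" "2 < real n" using n0 n by linarith+
    then have n2: "2 / real n < d" "2 / real n < \<epsilon>" "0 < real n" "1 / real n < 1"
      using d \<epsilon> by (auto simp: field_simps)
    define \<sigma> where "\<sigma> = nat \<lfloor>real n * u\<rfloor>"
    have \<sigma>0: "real \<sigma> \<le> real n * u" "real n * u < real \<sigma> + 1" using u unfolding \<sigma>_def by (auto; linarith)+
    then have \<sigma>: "real \<sigma> / real n \<le> u" "u < real \<sigma> / real n + 1 / real n"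
      using n2(3) by (auto simp: field_simps)
    define i where "i = nat \<lfloor>real n * p\<rfloor>"
    have i0: "real i \<le> real n * p" "real n * p < real i + 1" using p unfolding i_def by (auto; linarith)+
    then have i: "real i / real n \<le> p" "p < real i / real n + 1 / real n"
      using n2(3) by (auto simp: field_simps)
    have "real n * p \<le> real n * 1" using p by (intro mult_left_mono) auto
    then have "real i \<le> real n" using i0(1) by linarith
    then have "i \<le> n" by simp
    define y z where "y = real (\<sigma> + A n) / real n" and "z = real (\<sigma> + i) / real n"
    have y: "y = real \<sigma> / real n + real (A n) / real n" and z: "z = real \<sigma> / real n + real i / real n"
      by (simp_all add: y_def z_def add_divide_distrib)
    have An: "0 \<le> real (A n) / real n" "real (A n) / real n \<le> 1" using A(1)[of n] n2(3) by auto
    \<comment> \<open>The grid window starts at the grid point just before \<open>u\<close>, so its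
      minimiser may lie up to \<open>1 / n\<close> to the left of \<open>u\<close>; clamping brings
      it back into the interval on which \<open>p\<close> is the unique minimiser.\<close>
    define y' where "y' = max u y"
    have yu: "u - 1 / real n \<le> y" "y \<le> u + 1" using \<sigma> An unfolding y by linarith+
    from yu have y': "y' \<in> {u..u + 1}" "\<bar>y' - y\<bar> \<le> 1 / real n" by (auto simp: y'_def max_def)
    have y0: "0 \<le> y" "0 \<le> z" by (simp_all add: y_def z_def)
    have "\<bar>f y' - f y\<bar> < \<eta>"
      using y' yu(2) y0 n2 u by (intro d(2)) auto
    moreover have "\<bar>f z - f (u + p)\<bar> < \<eta>"
    proof -
      have "\<bar>z - (u + p)\<bar> \<le> 2 / real n" unfolding z using \<sigma> i by auto
      moreover have "z \<le> u + p" unfolding z using \<sigma> i by linarith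
      ultimately show ?thesis using y0 n2 u p by (intro d(2)) auto
    qed
    moreover have "f y \<le> f z" using A(2)[OF \<open>i \<le> n\<close>] by (simp add: y_def z_def \<sigma>_def)
    ultimately have "f y' < f (u + p) + 3 * \<eta>" using \<eta>(1) by linarith
    then have "y' \<notin> K" using \<eta>(2) by force
    then have "\<bar>y' - (u + p)\<bar> < \<epsilon>" using y' by (auto simp: K_def)
    moreover have "real (A n) / real n - p = (y' - (u + p)) - (y' - y) + (u - real \<sigma> / real n)" by (simp add: y)
    ultimately have "\<bar>real (A n) / real n - p\<bar> < \<epsilon> + 2 / real n" using y' \<sigma> by auto
    then show ?thesis using n2 by (simp add: \<epsilon>_def)
  qed
  then show "\<exists>no. \<forall>n\<ge>no. norm (real (A n) / real n - p) < r" by blast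
qed

lemma normal_density_le: "0 < \<sigma> \<Longrightarrow> normal_density \<mu> \<sigma> x \<le> 1 / sqrt (2 * pi * \<sigma>\<^sup>2)"
  unfolding normal_density_def by (simp add: divide_le_eq)

text \<open>Given \<open>V\<close>, the event confines \<open>Z\<close> to an interval of length
  \<open>2 * e\<close>, and the Gaussian density is bounded by its value at the mean. The bound does
  not depend on the law of \<open>V\<close>.\<close>

lemma (in prob_space) prob_abs_add_normal_le:
  assumes indep: "indep_var borel V borel Z" and Z: "distributed M lborel Z (normal_density 0 \<sigma>)" and "0 < \<sigma>" "0 < e"
  shows "\<P>(\<omega> in M. \<bar>V \<omega> + Z \<omega>\<bar> < e) \<le> 2 * e / sqrt (2 * pi * \<sigma>\<^sup>2)"
proof -
  define C where "C = 1 / sqrt (2 * pi * \<sigma>\<^sup>2)"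
  have C: "0 \<le> C" by (simp add: C_def)
  have rv [measurable]: "random_variable borel V" "random_variable borel Z"
    using indep_var_rv1[OF indep] indep_var_rv2[OF indep] by auto
  interpret PV: prob_space "distr M borel V" by (rule prob_space_distr) simp
  interpret PZ: prob_space "distr M borel Z" by (rule prob_space_distr) simp
  have joint: "distr M borel V \<Otimes>\<^sub>M distr M borel Z = distr M (borel \<Otimes>\<^sub>M borel) (\<lambda>\<omega>. (V \<omega>, Z \<omega>))"
    using indep by (simp add: indep_var_distribution_eq)
  have dZ: "distr M borel Z = density lborel (normal_density 0 \<sigma>)"
  proof -
    have "distr M borel Z = distr M lborel Z" by (rule distr_cong) auto
    then show ?thesis using Z by (simp add: distributed_def)
  qed
  let ?A = "{p :: real \<times> real. \<bar>fst p + snd p\<bar> < e}"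
  have A: "?A \<in> sets (borel \<Otimes>\<^sub>M borel)"
  proof -
    have "{p \<in> space (borel \<Otimes>\<^sub>M borel). \<bar>fst p + snd p :: real\<bar> < e} \<in> sets (borel \<Otimes>\<^sub>M borel)" by measurable
    then show ?thesis by (simp add: space_pair_measure)
  qed
  have "emeasure M {\<omega> \<in> space M. \<bar>V \<omega> + Z \<omega>\<bar> < e} = emeasure (distr M (borel \<Otimes>\<^sub>M borel) (\<lambda>\<omega>. (V \<omega>, Z \<omega>))) ?A"
    using A by (subst emeasure_distr) (auto intro!: arg_cong[where f = "emeasure M"])
  also have "\<dots> = (\<integral>\<^sup>+v. emeasure (distr M borel Z) (Pair v -` ?A) \<partial>distr M borel V)"
    unfolding joint[symmetric] using A by (intro PZ.emeasure_pair_measure_alt) (simp cong: sets_pair_measure_cong)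
  also have "\<dots> \<le> (\<integral>\<^sup>+v. ennreal (C * (2 * e)) \<partial>distr M borel V)"
  proof (rule nn_integral_mono)
    fix v
    have vim: "Pair v -` ?A = {- e - v<..<e - v}" by auto
    have "emeasure (distr M borel Z) (Pair v -` ?A) = (\<integral>\<^sup>+z. ennreal (normal_density 0 \<sigma> z) * indicator {- e - v<..<e - v} z \<partial>lborel)"
      unfolding dZ vim by (rule emeasure_density) auto
    also have "\<dots> \<le> (\<integral>\<^sup>+z. ennreal C * indicator {- e - v<..<e - v} z \<partial>lborel)"
      using normal_density_le[OF \<open>0 < \<sigma>\<close>, of 0] unfolding C_def
      by (intro nn_integral_mono mult_right_mono ennreal_leI) auto
    also have "\<dots> = ennreal (C * (2 * e))"
      using \<open>0 < e\<close> C by (simp add: nn_integral_cmult_indicator ennreal_mult)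
    finally show "emeasure (distr M borel Z) (Pair v -` ?A) \<le> ennreal (C * (2 * e))" .
  qed
  also have "\<dots> = ennreal (C * (2 * e))" using PV.emeasure_space_1 by simp
  finally have "emeasure M {\<omega> \<in> space M. \<bar>V \<omega> + Z \<omega>\<bar> < e} \<le> ennreal (C * (2 * e))" .
  then have "\<P>(\<omega> in M. \<bar>V \<omega> + Z \<omega>\<bar> < e) \<le> C * (2 * e)"
    using C \<open>0 < e\<close> by (simp add: emeasure_eq_measure)
  then show ?thesis by (simp add: C_def)
qed

section \<open>Brownian motion sampled on a grid as a symmetric walk\<close>

context std_brownian_motion
begin

definition increment :: "real \<Rightarrow> real \<Rightarrow> nat \<Rightarrow> 'w \<Rightarrow> real" where
  "increment c h l \<omega> = B (c + h * real (Suc l)) \<omega> - B (c + h * real l) \<omega>"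

lemma symmetric_walk_increment:
  assumes c: "0 \<le> c" and h: "0 < h"
  shows "symmetric_walk M (increment c h) (density lborel (normal_density 0 (sqrt h)))"
proof -
  have t: "0 \<le> c + h * real l" for l using c h by simp
  have distributed: "distributed M lborel (increment c h l) (normal_density 0 (sqrt h))" for l
  proof -
    have "c + h * real (Suc l) - (c + h * real l) = h" by (simp add: algebra_simps)
    then show ?thesis
      using gaussian_increments[OF t[of l], of "c + h * real (Suc l)"] h by (simp add: increment_def[abs_def] algebra_simps)
  qed
  have distr_borel: "distr M borel Y = density lborel (normal_density 0 (sqrt h))"
    if "distributed M lborel Y (normal_density 0 (sqrt h))" for Y
  proof -
    have "distr M borel Y = distr M lborel Y" by (rule distr_cong) auto
    then show ?thesis using that by (simp add: distributed_def)
  qed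
  have rv: "random_variable borel (increment c h l)" for l
    using distributed[of l] by (auto simp: distributed_def)
  show ?thesis
  proof (intro symmetric_walk.intro symmetric_walk_axioms.intro)
    show "prob_space M" by (rule prob_space_axioms)
    have fin: "indep_vars (\<lambda>_. borel) (increment c h) {..<n}" for n
      using indep_increments[of "\<lambda>l. c + h * real l" n] c h
      by (simp add: increment_def[abs_def] mult_left_mono)
    show "indep_vars (\<lambda>_. borel) (increment c h) UNIV"
      unfolding indep_vars_def
    proof (intro conjI ballI rv)
      show "indep_sets (\<lambda>l. sigma_sets (space M) {increment c h l -` A \<inter> space M | A. A \<in> sets borel}) UNIV"
      proof (subst indep_sets_finite_index_sets, intro allI impI)
        fix J :: "nat set" assume "J \<subseteq> UNIV" "J \<noteq> {}" "finite J"
        then have "J \<subseteq> {..<Suc (Max J)}" by (auto simp: less_Suc_eq_le)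
        then show "indep_sets (\<lambda>l. sigma_sets (space M) {increment c h l -` A \<inter> space M | A. A \<in> sets borel}) J"
          using fin[of "Suc (Max J)"] unfolding indep_vars_def by (blast intro: indep_sets_mono_index)
      qed
    qed
    show "distr M borel (increment c h l) = density lborel (normal_density 0 (sqrt h))" for l
      by (rule distr_borel[OF distributed])
    show "distr (density lborel (normal_density 0 (sqrt h))) borel uminus = density lborel (normal_density 0 (sqrt h))"
    proof -
      have "distributed M lborel (\<lambda>\<omega>. 0 + (- 1) * increment c h 0 \<omega>) (normal_density (0 + (- 1) * 0) (\<bar>- 1\<bar> * sqrt h))"
        using h by (intro normal_density_affine[OF distributed]) auto
      then have "distr M borel (\<lambda>\<omega>. - increment c h 0 \<omega>) = density lborel (normal_density 0 (sqrt h))"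
        by (intro distr_borel) simp
      moreover have "distr (distr M borel (increment c h 0)) borel uminus = distr M borel (\<lambda>\<omega>. - increment c h 0 \<omega>)"
        using rv by (subst distr_distr) (auto simp: comp_def)
      ultimately show ?thesis by (simp add: distr_borel[OF distributed])
    qed
    fix a b :: nat assume "a < b"
    have sum: "(\<Sum>l=a..<b. increment c h l \<omega>) = B (c + h * real b) \<omega> - B (c + h * real a) \<omega>" for \<omega>
      unfolding increment_def using \<open>a < b\<close> by (intro sum_Suc_diff') auto
    let ?\<sigma> = "sqrt (c + h * real b - (c + h * real a))"
    have D: "distributed M lborel (\<lambda>\<omega>. \<Sum>l=a..<b. increment c h l \<omega>) (normal_density 0 ?\<sigma>)"
      unfolding sum using \<open>a < b\<close> h by (intro gaussian_increments t) auto
    have "AE x in density lborel (\<lambda>x. ennreal (normal_density 0 ?\<sigma> x)). x \<noteq> 0"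
      using AE_lborel_singleton[of "0 :: real"] by (subst AE_density) auto
    then have "AE x in distr M lborel (\<lambda>\<omega>. \<Sum>l=a..<b. increment c h l \<omega>). x \<noteq> 0"
      using D by (simp only: distributed_def)
    then show "AE \<omega> in M. (\<Sum>l=a..<b. increment c h l \<omega>) \<noteq> 0"
      by (rule AE_distrD[rotated]) (use D in \<open>simp add: distributed_def\<close>)
  qed
qed

lemma S_increment:
  assumes "0 \<le> c" "0 < h"
  shows "symmetric_walk.S (increment c h) n \<omega> = B (c + h * real n) \<omega> - B c \<omega>"
proof -
  interpret walk: symmetric_walk M "increment c h" "density lborel (normal_density 0 (sqrt h))"
    using assms by (rule symmetric_walk_increment)
  have "(\<Sum>l<n. increment c h l \<omega>) = B (c + h * real n) \<omega> - B (c + h * real 0) \<omega>"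
    unfolding increment_def by (rule sum_lessThan_telescope)
  then show ?thesis by (simp add: walk.S_def)
qed

section \<open>Path infima and uniqueness of the minimiser\<close>

definition path_inf :: "real \<Rightarrow> real \<Rightarrow> 'w \<Rightarrow> real" where
  "path_inf a b \<omega> = Inf ((\<lambda>s. B s \<omega>) ` {a..b})"

lemma continuous_on_path:
  "\<omega> \<in> space M \<Longrightarrow> I \<subseteq> {0..} \<Longrightarrow> continuous_on I (\<lambda>s. B s \<omega>)"
  by (rule continuous_on_subset[OF continuous_paths])

lemma path_inf_le:
  assumes "\<omega> \<in> space M" "0 \<le> a" "s \<in> {a..b}"
  shows "path_inf a b \<omega> \<le> B s \<omega>"
proof -
  have "compact ((\<lambda>s. B s \<omega>) ` {a..b})"
    using assms by (intro compact_continuous_image continuous_on_path) auto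
  then have "bdd_below ((\<lambda>s. B s \<omega>) ` {a..b})" by (intro bounded_imp_bdd_below compact_imp_bounded)
  then show ?thesis unfolding path_inf_def using assms by (intro cInf_lower) auto
qed

lemma path_inf_attained:
  assumes "\<omega> \<in> space M" "0 \<le> a" "a \<le> b"
  obtains s where "s \<in> {a..b}" "path_inf a b \<omega> = B s \<omega>"
proof -
  have "continuous_on {a..b} (\<lambda>s. B s \<omega>)" using assms by (intro continuous_on_path) auto
  then obtain s where s: "s \<in> {a..b}" "\<forall>y\<in>{a..b}. B s \<omega> \<le> B y \<omega>"
    using continuous_attains_inf[OF compact_Icc, of a b "\<lambda>s. B s \<omega>"] assms by auto
  then have "path_inf a b \<omega> = B s \<omega>"
    unfolding path_inf_def by (intro cInf_eq_minimum) auto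
  then show ?thesis using s that by blast
qed

lemma path_inf_measurable [measurable]:
  assumes "0 \<le> a" "a \<le> b"
  shows "path_inf a b \<in> borel_measurable M"
proof (rule borel_measurable_LIMSEQ_real)
  show "(\<lambda>n. Min ((\<lambda>i. B (a + (b - a) * real i / real (Suc n)) \<omega>) ` {..Suc n})) \<longlonglongrightarrow> path_inf a b \<omega>" if "\<omega> \<in> space M" for \<omega>
    unfolding path_inf_def using that assms by (intro grid_Min_tendsto_Inf continuous_on_path) auto
  show "(\<lambda>\<omega>. Min ((\<lambda>i. B (a + (b - a) * real i / real (Suc n)) \<omega>) ` {..Suc n})) \<in> borel_measurable M" for n
    using assms by (intro borel_measurable_Min random_variable_B) (auto intro!: add_nonneg_nonneg)
qed

text \<open>The difference of the minima over two disjoint intervals contains the increment over the gap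
  between them as an independent Gaussian summand, so that it has a bounded density.\<close>

lemma AE_path_inf_neq:
  assumes u: "0 \<le> u" and q: "Suc r < q"
  shows "AE \<omega> in M. path_inf u (u + real r / real q) \<omega> \<noteq> path_inf (u + real (Suc r) / real q) (u + 1) \<omega>"
proof -
  define b c where "b = u + real r / real q" and "c = u + real (Suc r) / real q"
  have "real (Suc r) / real q \<le> 1" using q by (intro divide_le_eq_1_pos[THEN iffD2]) auto
  then have bc: "u \<le> b" "b < c" "c \<le> u + 1" using q by (auto simp: b_def c_def divide_strict_right_mono)
  define \<sigma> where "\<sigma> = sqrt (c - b)"
  have \<sigma>: "0 < \<sigma>" using bc by (simp add: \<sigma>_def)
  define D where "D \<omega> = path_inf c (u + 1) \<omega> - path_inf u b \<omega>" for \<omega>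
  have [measurable]: "D \<in> borel_measurable M"
    unfolding D_def[abs_def] using bc u by (intro borel_measurable_diff path_inf_measurable) auto
  define m1 where "m1 n \<omega> = Min ((\<lambda>i. B (u + (b - u) * real i / real (Suc n)) \<omega>) ` {..Suc n})" for n \<omega>
  define m2 where "m2 n \<omega> = Min ((\<lambda>i. B (c + (u + 1 - c) * real i / real (Suc n)) \<omega>) ` {..Suc n})" for n \<omega>
  have lim: "(\<lambda>n. m2 n \<omega> - m1 n \<omega>) \<longlonglongrightarrow> D \<omega>" if "\<omega> \<in> space M" for \<omega>
    unfolding D_def path_inf_def m1_def m2_def using that u bc
    by (intro tendsto_diff grid_Min_tendsto_Inf continuous_on_path) auto
  have small: "\<P>(\<omega> in M. \<bar>m2 n \<omega> - m1 n \<omega>\<bar> < e) \<le> 2 * e / sqrt (2 * pi * \<sigma>\<^sup>2)" if "0 < e" for n e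
  proof -
    \<comment> \<open>With this mesh the grid points of both intervals and the two ends of the gap
      are all values of a single walk, the gap being the steps from \<open>rb\<close> to
      \<open>rc\<close>.\<close>
    define h where "h = 1 / (real q * real (Suc n))"
    have h: "0 < h" using q by (simp add: h_def)
    interpret walk: symmetric_walk M "increment u h" "density lborel (normal_density 0 (sqrt h))"
      using u h by (rule symmetric_walk_increment)
    define rb rc where "rb = r * Suc n" and "rc = Suc r * Suc n"
    have S: "walk.S l \<omega> = B (u + h * real l) \<omega> - B u \<omega>" for l \<omega> by (rule S_increment[OF u h])
    have pb: "u + h * real rb = b" and pc: "u + h * real rc = c"
    proof -
      have "1 / (x * k) * (y * k) = y / x" if "k \<noteq> 0" for x y k :: real using that by simp
      from this[of "real (Suc n)" "real q"] show "u + h * real rb = b" "u + h * real rc = c"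
        by (simp_all only: h_def rb_def rc_def b_def c_def of_nat_mult of_nat_eq_0_iff nat.distinct not_False_eq_True)
    qed
    have p1: "B (u + (b - u) * real i / real (Suc n)) \<omega> = walk.S (r * i) \<omega> + B u \<omega>" for i \<omega>
    proof -
      have "(b - u) * real i / real (Suc n) = h * real (r * i)" by (simp add: h_def b_def)
      then show ?thesis by (simp add: S)
    qed
    have p2: "B (c + (u + 1 - c) * real i / real (Suc n)) \<omega> = walk.S (rc + (q - Suc r) * i) \<omega> + B u \<omega>" for i \<omega>
    proof -
      have "h * real (rc + (q - Suc r) * i) = h * real rc + h * (real (q - Suc r) * real i)"
        by (simp only: of_nat_add of_nat_mult distrib_left)
      also have "h * (real (q - Suc r) * real i) = (u + 1 - c) * real i / real (Suc n)"
      proof -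
        have "u + 1 - c = real (q - Suc r) / real q"
          using q by (simp add: c_def of_nat_diff diff_divide_distrib del: of_nat_Suc)
        then show ?thesis by (simp add: h_def)
      qed
      finally have "u + h * real (rc + (q - Suc r) * i) = c + (u + 1 - c) * real i / real (Suc n)" using pc by simp
      then show ?thesis by (simp add: S)
    qed
    have Min_add: "Min ((\<lambda>i. f i + x) ` {..k}) = Min (f ` {..k}) + x" for f :: "nat \<Rightarrow> real" and x and k :: nat
      using Min_add_commute[of "{..k}" f x] by simp
    \<comment> \<open>The minima are measured relative to the ends of the gap, so that
      \<open>V\<close> uses no step inside it and \<open>Z\<close> only such steps.\<close>
    define V where "V \<omega> = Min ((\<lambda>i. walk.S (rc + (q - Suc r) * i) \<omega> - walk.S rc \<omega>) ` {..Suc n})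
        - Min ((\<lambda>i. walk.S (r * i) \<omega> - walk.S rb \<omega>) ` {..Suc n})" for \<omega>
    define Z where "Z \<omega> = walk.S rc \<omega> - walk.S rb \<omega>" for \<omega>
    have VZ: "m2 n \<omega> - m1 n \<omega> = V \<omega> + Z \<omega>" for \<omega>
    proof -
      have "m2 n \<omega> = Min ((\<lambda>i. walk.S (rc + (q - Suc r) * i) \<omega> - walk.S rc \<omega>) ` {..Suc n}) + (walk.S rc \<omega> + B u \<omega>)"
        unfolding m2_def p2 Min_add[symmetric] by simp
      moreover have "m1 n \<omega> = Min ((\<lambda>i. walk.S (r * i) \<omega> - walk.S rb \<omega>) ` {..Suc n}) + (walk.S rb \<omega> + B u \<omega>)"
        unfolding m1_def p1 Min_add[symmetric] by simp
      ultimately show ?thesis by (simp add: V_def Z_def)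
    qed
    have "rb < rc" by (simp add: rb_def rc_def)
    have "indep_var borel V borel Z"
    proof (rule walk.indep_var_steps[where J = "- {rb..<rc}" and K = "{rb..<rc}"])
      show "V \<in> borel_measurable (walk.steps (- {rb..<rc}))"
        unfolding V_def[abs_def]
      proof (rule borel_measurable_diff; rule borel_measurable_Min)
        show "(\<lambda>\<omega>. walk.S (rc + (q - Suc r) * i) \<omega> - walk.S rc \<omega>) \<in> borel_measurable (walk.steps (- {rb..<rc}))" for i
          by (rule walk.S_diff_steps) auto
        fix i assume "i \<in> {..Suc n}"
        then have "r * i \<le> rb" unfolding rb_def by (intro mult_le_mono) auto
        then show "(\<lambda>\<omega>. walk.S (r * i) \<omega> - walk.S rb \<omega>) \<in> borel_measurable (walk.steps (- {rb..<rc}))"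
          by (intro walk.S_diff_steps) auto
      qed auto
      show "Z \<in> borel_measurable (walk.steps {rb..<rc})"
        unfolding Z_def[abs_def] using \<open>rb < rc\<close> by (intro walk.S_diff_steps) auto
    qed auto
    moreover have "distributed M lborel Z (normal_density 0 \<sigma>)"
      unfolding Z_def[abs_def] S pb pc \<sigma>_def using gaussian_increments[of b c] bc u by simp
    ultimately show ?thesis
      unfolding VZ using \<sigma> that by (intro prob_abs_add_normal_le)
  qed
  have [measurable]: "m1 n \<in> borel_measurable M" "m2 n \<in> borel_measurable M" for n
    unfolding m1_def[abs_def] m2_def[abs_def] using u bc
    by (auto intro!: borel_measurable_Min random_variable_B add_nonneg_nonneg)
  have le: "\<P>(\<omega> in M. D \<omega> = 0) \<le> 2 * e / sqrt (2 * pi * \<sigma>\<^sup>2)" if "0 < e" for e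
  proof -
    \<comment> \<open>A continuous tent between the indicator of 0 and that of
      \<open>\<bar>x\<bar> < e\<close>. It carries the bound for the grid minima over to their limit
      \<open>D\<close>.\<close>
    define \<phi> where "\<phi> x = max 0 (1 - \<bar>x\<bar> / e)" for x :: real
    have \<phi>: "0 \<le> \<phi> x" "\<phi> x \<le> 1" "\<phi> x \<noteq> 0 \<Longrightarrow> \<bar>x\<bar> < e" "\<phi> 0 = 1" for x
      using that by (auto simp: \<phi>_def max_def field_simps split: if_splits)
    have \<phi>0: "\<phi> x = 0" if "\<not> \<bar>x\<bar> < e" for x using \<phi>(3)[of x] that by blast
    have [measurable]: "\<phi> \<in> borel_measurable borel" unfolding \<phi>_def[abs_def] by measurable
    have cont: "isCont \<phi> x" for x unfolding \<phi>_def[abs_def] using that by (intro continuous_intros) auto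
    have "\<P>(\<omega> in M. D \<omega> = 0) = expectation (indicat_real {\<omega> \<in> space M. D \<omega> = 0})" by simp
    also have "\<dots> \<le> expectation (\<lambda>\<omega>. \<phi> (D \<omega>))"
      using \<phi> by (intro integral_mono integrable_const_bound[where B = 1]) (auto split: split_indicator)
    also have "\<dots> \<le> 2 * e / sqrt (2 * pi * \<sigma>\<^sup>2)"
    proof (rule LIMSEQ_le_const2)
      show "(\<lambda>n. expectation (\<lambda>\<omega>. \<phi> (m2 n \<omega> - m1 n \<omega>))) \<longlonglongrightarrow> expectation (\<lambda>\<omega>. \<phi> (D \<omega>))"
        using \<phi>(1,2) lim by (intro integral_dominated_convergence[where w = "\<lambda>_. 1"]) (auto intro!: AE_I2 isCont_tendsto_compose[OF cont])
      have "expectation (\<lambda>\<omega>. \<phi> (m2 n \<omega> - m1 n \<omega>)) \<le> expectation (indicat_real {\<omega> \<in> space M. \<bar>m2 n \<omega> - m1 n \<omega>\<bar> < e})" for n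
        using \<phi>(1,2) \<phi>0 by (intro integral_mono integrable_const_bound[where B = 1]) (auto split: split_indicator)
      then have "expectation (\<lambda>\<omega>. \<phi> (m2 n \<omega> - m1 n \<omega>)) \<le> 2 * e / sqrt (2 * pi * \<sigma>\<^sup>2)" for n
        using small[OF that, of n] by (auto intro: order_trans)
      then show "\<exists>N. \<forall>n\<ge>N. expectation (\<lambda>\<omega>. \<phi> (m2 n \<omega> - m1 n \<omega>)) \<le> 2 * e / sqrt (2 * pi * \<sigma>\<^sup>2)" by blast
    qed
    finally show ?thesis .
  qed
  have "\<P>(\<omega> in M. D \<omega> = 0) \<le> 0"
  proof (rule field_le_epsilon)
    fix e :: real assume "0 < e"
    have s: "0 < sqrt (2 * pi * \<sigma>\<^sup>2)" using \<sigma> by simp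
    show "\<P>(\<omega> in M. D \<omega> = 0) \<le> 0 + e"
      using le[of "e * sqrt (2 * pi * \<sigma>\<^sup>2) / 2"] s \<open>0 < e\<close> \<sigma> by simp
  qed
  then have "\<P>(\<omega> in M. D \<omega> = 0) = 0" by (simp add: measure_le_0_iff)
  then have "AE \<omega> in M. D \<omega> \<noteq> 0" by (subst (asm) prob_Collect_eq_0) auto
  then show ?thesis unfolding D_def b_def c_def by eventually_elim auto
qed

text \<open>Two distinct minimisers would be separated by a gap between consecutive multiples of
  some \<open>1 / q\<close>, and the infima on both sides of the gap would equal the overall
  infimum. There are only countably many gaps, and each is covered by
  \<open>AE_path_inf_neq\<close>.\<close>

lemma AE_unique_argmin:
  assumes u: "0 \<le> u"
  shows "AE \<omega> in M. \<forall>x\<in>{0..1}. \<forall>y\<in>{0..1}. B (u + x) \<omega> = path_inf u (u + 1) \<omega> \<longrightarrow> B (u + y) \<omega> = path_inf u (u + 1) \<omega> \<longrightarrow> x = y"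
proof -
  have "AE \<omega> in M. \<forall>r q. Suc r < q \<longrightarrow> path_inf u (u + real r / real q) \<omega> \<noteq> path_inf (u + real (Suc r) / real q) (u + 1) \<omega>"
    unfolding AE_all_countable
  proof (intro allI)
    show "AE \<omega> in M. Suc r < q \<longrightarrow> path_inf u (u + real r / real q) \<omega> \<noteq> path_inf (u + real (Suc r) / real q) (u + 1) \<omega>" for r q
      using AE_path_inf_neq[OF u, of r q] by (cases "Suc r < q") auto
  qed
  then show ?thesis
    using AE_space
  proof eventually_elim
    case (elim \<omega>)
    have "\<not> x < y" if x: "x \<in> {0..1}" "B (u + x) \<omega> = path_inf u (u + 1) \<omega>" and y: "y \<in> {0..1}" "B (u + y) \<omega> = path_inf u (u + 1) \<omega>" for x y
    proof
      assume "x < y"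
      \<comment> \<open>Room for two cells between \<open>x\<close> and \<open>y\<close>: one is
        lost in rounding \<open>x\<close> up to \<open>r / q\<close>, the other is the gap
        itself.\<close>
      obtain q where q: "2 / (y - x) < real q" using reals_Archimedean2 by blast
      have "0 < 2 / (y - x)" using \<open>x < y\<close> by simp
      then have q0: "0 < real q" using q by linarith
      have q2: "2 < real q * (y - x)" using q \<open>x < y\<close> by (simp add: field_simps)
      define r where "r = nat \<lceil>real q * x\<rceil>"
      have r: "real q * x \<le> real r" "real r < real q * x + 1"
        using x q0 unfolding r_def by (auto simp: ceiling_less_iff) linarith+
      have rq: "real q * x + 2 < real q * y" using q2 by (simp add: algebra_simps)
      have "real q * y \<le> real q * 1" using y q0 by (intro mult_left_mono) auto
      then have "real r + 1 < real q" using r rq by linarith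
      then have "Suc r < q" by linarith
      have xr: "x \<le> real r / real q" and ry: "real (Suc r) / real q \<le> y"
        using r rq q0 by (simp_all add: field_simps)
      have "real r / real q \<le> 1" "real (Suc r) / real q \<le> 1" using \<open>Suc r < q\<close> by simp_all
      have ge: "path_inf u (u + 1) \<omega> \<le> path_inf a b \<omega>" if ab: "u \<le> a" "a \<le> b" "b \<le> u + 1" for a b
      proof -
        obtain s where "s \<in> {a..b}" "path_inf a b \<omega> = B s \<omega>"
          using path_inf_attained[OF elim(2), of a b] ab u by auto
        then show ?thesis using path_inf_le[OF elim(2) u, of s "u + 1"] ab by auto
      qed
      have "path_inf u (u + real r / real q) \<omega> = path_inf u (u + 1) \<omega>"
      proof (rule antisym)
        show "path_inf u (u + real r / real q) \<omega> \<le> path_inf u (u + 1) \<omega>"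
          unfolding x(2)[symmetric] using x(1) xr u by (intro path_inf_le elim) auto
      qed (rule ge, use \<open>real r / real q \<le> 1\<close> in auto)
      moreover have "path_inf (u + real (Suc r) / real q) (u + 1) \<omega> = path_inf u (u + 1) \<omega>"
      proof (rule antisym)
        show "path_inf (u + real (Suc r) / real q) (u + 1) \<omega> \<le> path_inf u (u + 1) \<omega>"
          unfolding y(2)[symmetric] using y(1) ry u by (intro path_inf_le elim) auto
      qed (rule ge, use \<open>real (Suc r) / real q \<le> 1\<close> in auto)
      ultimately show False using elim(1)[rule_format, OF \<open>Suc r < q\<close>] by metis
    qed
    then show ?case by (meson linorder_neqE_linordered_idom)
  qed
qed

text \<open>The set of minimisers is closed and nonempty by continuity of the path, so its supremum
  belongs to it.\<close>

lemma argmin_process_greatest: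
  assumes \<omega>: "\<omega> \<in> space M" and t: "0 \<le> t"
  shows "argmin_process B t \<omega> \<in> {0..1}"
    and "B (t + argmin_process B t \<omega>) \<omega> = path_inf t (t + 1) \<omega>"
    and "s \<in> {0..1} \<Longrightarrow> B (t + s) \<omega> = path_inf t (t + 1) \<omega> \<Longrightarrow> s \<le> argmin_process B t \<omega>"
proof -
  have inf: "(INF u\<in>{0..1}. B (t + u) \<omega>) = path_inf t (t + 1) \<omega>"
  proof -
    have "{t..t + 1} = (\<lambda>u. t + u) ` {0..1}" by simp
    then show ?thesis by (simp only: path_inf_def image_image)
  qed
  let ?E = "{s \<in> {0..1}. B (t + s) \<omega> = path_inf t (t + 1) \<omega>}"
  have cont: "continuous_on {0..1} (\<lambda>s. B (t + s) \<omega>)"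
    using t by (intro continuous_on_compose2[OF continuous_paths[OF \<omega>]] continuous_intros) auto
  have eq: "argmin_process B t \<omega> = Sup ?E" by (simp add: argmin_process_def inf)
  obtain r where "r \<in> {t..t + 1}" "path_inf t (t + 1) \<omega> = B r \<omega>"
    using path_inf_attained[OF \<omega> t, of "t + 1"] by auto
  then have "r - t \<in> ?E" by auto
  then have ne: "?E \<noteq> {}" by blast
  have bdd: "bdd_above ?E" by (rule bdd_aboveI[of _ 1]) auto
  have "closed ?E" using cont by (intro continuous_closed_preimage_constant) auto
  then have "Sup ?E \<in> ?E" using ne bdd by (intro closed_contains_Sup)
  then show "argmin_process B t \<omega> \<in> {0..1}" "B (t + argmin_process B t \<omega>) \<omega> = path_inf t (t + 1) \<omega>"
    by (auto simp: eq)
  show "s \<le> argmin_process B t \<omega>" if "s \<in> {0..1}" "B (t + s) \<omega> = path_inf t (t + 1) \<omega>"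
    unfolding eq using that bdd by (intro cSup_upper) auto
qed

text \<open>Reduces measurability of the argmin to that of path infima. The inequality is not strict
  because, among several minimisers, the argmin is the last.\<close>

lemma argmin_process_ge_iff:
  assumes \<omega>: "\<omega> \<in> space M" and t: "0 \<le> t" and c: "c \<in> {0..1}"
  shows "c \<le> argmin_process B t \<omega> \<longleftrightarrow> path_inf (t + c) (t + 1) \<omega> \<le> path_inf t (t + c) \<omega>"
proof -
  note \<alpha> = argmin_process_greatest[OF \<omega> t]
  obtain s where s: "s \<in> {t..t + c}" "path_inf t (t + c) \<omega> = B s \<omega>"
    using path_inf_attained[OF \<omega> t, of "t + c"] c by auto
  obtain r where r: "r \<in> {t + c..t + 1}" "path_inf (t + c) (t + 1) \<omega> = B r \<omega>"
    using path_inf_attained[OF \<omega>, of "t + c" "t + 1"] t c by auto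
  have s1: "path_inf t (t + 1) \<omega> \<le> B s \<omega>" using s(1) c by (intro path_inf_le[OF \<omega> t]) auto
  have r1: "path_inf t (t + 1) \<omega> \<le> B r \<omega>" using r(1) c by (intro path_inf_le[OF \<omega> t]) auto
  show ?thesis
  proof
    assume "c \<le> argmin_process B t \<omega>"
    then have "path_inf (t + c) (t + 1) \<omega> \<le> B (t + argmin_process B t \<omega>) \<omega>"
      using \<alpha>(1) t c by (intro path_inf_le[OF \<omega>]) auto
    then show "path_inf (t + c) (t + 1) \<omega> \<le> path_inf t (t + c) \<omega>"
      using \<alpha>(2) s1 s(2) by simp
  next
    assume le: "path_inf (t + c) (t + 1) \<omega> \<le> path_inf t (t + c) \<omega>"
    show "c \<le> argmin_process B t \<omega>"
    proof (rule ccontr)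
      assume "\<not> c \<le> argmin_process B t \<omega>"
      then have "path_inf t (t + c) \<omega> \<le> B (t + argmin_process B t \<omega>) \<omega>"
        using \<alpha>(1) by (intro path_inf_le[OF \<omega> t]) auto
      then have "B r \<omega> = path_inf t (t + 1) \<omega>" using \<alpha>(2) le r(2) r1 by simp
      then have "r - t \<le> argmin_process B t \<omega>" using r(1) c by (intro \<alpha>(3)) auto
      then show False using r(1) \<open>\<not> c \<le> argmin_process B t \<omega>\<close> by auto
    qed
  qed
qed

lemma argmin_process_borel_measurable [measurable]:
  assumes t: "0 \<le> t"
  shows "argmin_process B t \<in> borel_measurable M"
  unfolding borel_measurable_iff_ge
proof
  fix c :: real
  note \<alpha> = argmin_process_greatest(1)[OF _ t]
  consider "c \<le> 0" | "1 < c" | "c \<in> {0..1}" by fastforce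
  then show "{\<omega> \<in> space M. c \<le> argmin_process B t \<omega>} \<in> sets M"
  proof cases
    case 1
    then have "{\<omega> \<in> space M. c \<le> argmin_process B t \<omega>} = space M" using \<alpha> by fastforce
    then show ?thesis by (simp only: sets.top)
  next
    case 2
    then have "{\<omega> \<in> space M. c \<le> argmin_process B t \<omega>} = {}" using \<alpha> by fastforce
    then show ?thesis by (simp only: sets.empty_sets)
  next
    case 3
    have [measurable]: "path_inf t (t + c) \<in> borel_measurable M" "path_inf (t + c) (t + 1) \<in> borel_measurable M"
      using t 3 by (auto intro!: path_inf_measurable)
    have "{\<omega> \<in> space M. path_inf (t + c) (t + 1) \<omega> \<le> path_inf t (t + c) \<omega>} \<in> sets M" by measurable
    moreover have "{\<omega> \<in> space M. path_inf (t + c) (t + 1) \<omega> \<le> path_inf t (t + c) \<omega>} = {\<omega> \<in> space M. c \<le> argmin_process B t \<omega>}"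
      using argmin_process_ge_iff[OF _ t 3] by auto
    ultimately show ?thesis by simp
  qed
qed

lemma argmin_process_measurable:
  "0 \<le> t \<Longrightarrow> argmin_process B t \<in> M \<rightarrow>\<^sub>M borel_01"
  using argmin_process_greatest(1) by (intro measurable_restrict_space2) auto

text \<open>The start of the window is rounded down to a multiple of \<open>1 / n\<close>, so that
  for each \<open>n\<close> the windows of all times \<open>u\<close> belong to one walk and the
  discrete Markov property applies to them jointly.\<close>

definition grid_argmin :: "nat \<Rightarrow> real \<Rightarrow> 'w \<Rightarrow> nat" where
  "grid_argmin n u \<omega> = last_argmin (\<lambda>i. B (real (nat \<lfloor>real n * u\<rfloor> + i) / real n) \<omega>) n"

lemma grid_argmin_le: "grid_argmin n u \<omega> \<le> n"
  unfolding grid_argmin_def by (rule last_argmin_le)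

lemma AE_grid_argmin_tendsto:
  assumes u: "0 \<le> u"
  shows "AE \<omega> in M. (\<lambda>n. real (grid_argmin n u \<omega>) / real n) \<longlonglongrightarrow> argmin_process B u \<omega>"
  using AE_unique_argmin[OF u] AE_space
proof eventually_elim
  case (elim \<omega>)
  note \<alpha> = argmin_process_greatest[OF elim(2) u]
  show ?case
  proof (rule grid_argmin_tendsto[where f = "\<lambda>s. B s \<omega>" and u = u])
    fix s :: real assume s: "s \<in> {0..1}" "s \<noteq> argmin_process B u \<omega>"
    then have "B (u + s) \<omega> \<noteq> path_inf u (u + 1) \<omega>" using elim(1) \<alpha>(1,2) by blast
    moreover have "path_inf u (u + 1) \<omega> \<le> B (u + s) \<omega>" using s by (intro path_inf_le[OF elim(2) u]) auto
    ultimately show "B (u + argmin_process B u \<omega>) \<omega> < B (u + s) \<omega>" using \<alpha>(2) by simp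
  next
    show "B (real (nat \<lfloor>real n * u\<rfloor> + grid_argmin n u \<omega>) / real n) \<omega> \<le> B (real (nat \<lfloor>real n * u\<rfloor> + i) / real n) \<omega>"
      if "i \<le> n" for n i
      unfolding grid_argmin_def using last_argmin_min[OF that, of "\<lambda>i. B (real (nat \<lfloor>real n * u\<rfloor> + i) / real n) \<omega>"] .
  qed (use \<alpha>(1) u grid_argmin_le continuous_paths[OF elim(2)] in auto)
qed

text \<open>A minimum at \<open>x < 1\<close> forces every walk sampled from \<open>u + x\<close> to
  the end of the window to stay above its start. A minimum at \<open>x = 1\<close> forces the same
  backwards over the whole window. Either event has probability \<open>persist (Suc n)\<close> for a
  sample of \<open>n + 1\<close> steps, which tends to 0.\<close>

lemma AE_argmin_process_neq:
  assumes u: "0 \<le> u"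
  shows "AE \<omega> in M. argmin_process B u \<omega> \<noteq> x"
proof -
  have [measurable]: "argmin_process B u \<in> borel_measurable M" using u by simp
  consider "x \<notin> {0..1}" | "x = 1" | "0 \<le> x" "x < 1" by fastforce
  then show ?thesis
  proof cases
    case 1
    then show ?thesis
      using argmin_process_greatest(1)[OF _ u] by (intro AE_I2) force
  next
    case 2
    have "\<P>(\<omega> in M. argmin_process B u \<omega> = x) \<le> persist (Suc n)" for n
    proof -
      define h where "h = 1 / real (Suc n)"
      have h: "0 < h" by (simp add: h_def)
      interpret walk: symmetric_walk M "increment u h" "density lborel (normal_density 0 (sqrt h))"
        using u h by (rule symmetric_walk_increment)
      have "\<P>(\<omega> in M. argmin_process B u \<omega> = x) \<le> \<P>(\<omega> in M. walk.below \<omega> (0 + Suc n) {0..<0 + Suc n})"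
      proof (rule finite_measure_mono_AE)
        show "AE \<omega> in M. \<omega> \<in> {\<omega> \<in> space M. argmin_process B u \<omega> = x} \<longrightarrow> \<omega> \<in> {\<omega> \<in> space M. walk.below \<omega> (0 + Suc n) {0..<0 + Suc n}}"
          using walk.AE_inj_S
        proof eventually_elim
          case (elim \<omega>)
          have "walk.S (Suc n) \<omega> < walk.S q \<omega>" if \<omega>: "\<omega> \<in> space M" "argmin_process B u \<omega> = 1" and q: "q < Suc n" for q
          proof -
            have "B (u + 1) \<omega> \<le> B (u + h * real q) \<omega>"
              using argmin_process_greatest(2)[OF \<omega>(1) u] \<omega>(2) path_inf_le[OF \<omega>(1) u, of "u + h * real q" "u + 1"] q
              by (auto simp: h_def)
            moreover have "h * real (Suc n) = 1" by (simp add: h_def)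
            ultimately have "walk.S (Suc n) \<omega> \<le> walk.S q \<omega>" by (simp only: S_increment[OF u h])
            moreover have "walk.S (Suc n) \<omega> \<noteq> walk.S q \<omega>" using elim q by (auto dest: injD)
            ultimately show ?thesis by simp
          qed
          then show ?case using 2 by (auto simp: walk.below_def)
        qed
      qed auto
      then show ?thesis by (simp only: walk.prob_below_left)
    qed
    then have "\<P>(\<omega> in M. argmin_process B u \<omega> = x) \<le> 0"
      by (intro LIMSEQ_le_const[OF LIMSEQ_Suc[OF persist_tendsto_0]]) blast
    then have "\<P>(\<omega> in M. argmin_process B u \<omega> = x) = 0" by (simp add: measure_le_0_iff)
    then show ?thesis by (subst (asm) prob_Collect_eq_0) auto
  next
    case 3
    have "\<P>(\<omega> in M. argmin_process B u \<omega> = x) \<le> persist (Suc n)" for n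
    proof -
      define h where "h = (1 - x) / real (Suc n)"
      have h: "0 < h" using 3 by (simp add: h_def)
      have ux: "0 \<le> u + x" using u 3 by simp
      interpret walk: symmetric_walk M "increment (u + x) h" "density lborel (normal_density 0 (sqrt h))"
        using ux h by (rule symmetric_walk_increment)
      have "\<P>(\<omega> in M. argmin_process B u \<omega> = x) \<le> \<P>(\<omega> in M. walk.below \<omega> 0 {0<..0 + Suc n})"
      proof (rule finite_measure_mono_AE)
        show "AE \<omega> in M. \<omega> \<in> {\<omega> \<in> space M. argmin_process B u \<omega> = x} \<longrightarrow> \<omega> \<in> {\<omega> \<in> space M. walk.below \<omega> 0 {0<..0 + Suc n}}"
          using walk.AE_inj_S
        proof eventually_elim
          case (elim \<omega>)
          have "walk.S 0 \<omega> < walk.S q \<omega>" if \<omega>: "\<omega> \<in> space M" "argmin_process B u \<omega> = x" and q: "0 < q" "q \<le> Suc n" for q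
          proof -
            have "h * real q \<le> h * real (Suc n)" using q h by (intro mult_left_mono) auto
            also have "h * real (Suc n) = 1 - x" by (simp add: h_def)
            finally have "B (u + x) \<omega> \<le> B (u + x + h * real q) \<omega>"
              using argmin_process_greatest(2)[OF \<omega>(1) u] \<omega>(2) path_inf_le[OF \<omega>(1) u, of "u + x + h * real q" "u + 1"] q 3 h
              by auto
            then have "walk.S 0 \<omega> \<le> walk.S q \<omega>" by (simp add: S_increment[OF ux h])
            moreover have "walk.S 0 \<omega> \<noteq> walk.S q \<omega>" using elim q by (auto dest: injD)
            ultimately show ?thesis by simp
          qed
          then show ?case by (auto simp: walk.below_def)
        qed
      qed auto
      then show ?thesis by (simp only: walk.prob_below_right)
    qed
    then have "\<P>(\<omega> in M. argmin_process B u \<omega> = x) \<le> 0"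
      by (intro LIMSEQ_le_const[OF LIMSEQ_Suc[OF persist_tendsto_0]]) blast
    then have "\<P>(\<omega> in M. argmin_process B u \<omega> = x) = 0" by (simp add: measure_le_0_iff)
    then show ?thesis by (subst (asm) prob_Collect_eq_0) auto
  qed
qed

end

section \<open>Passage to the limit\<close>

lemma floor_div_tendsto: "(\<lambda>n. real_of_int \<lfloor>real n * y\<rfloor> / real n) \<longlonglongrightarrow> y"
proof (rule tendsto_sandwich)
  show "\<forall>\<^sub>F n in sequentially. y - 1 / real n \<le> real_of_int \<lfloor>real n * y\<rfloor> / real n"
    using eventually_gt_at_top[of 0]
  proof eventually_elim
    case (elim n)
    have "real n * y - 1 \<le> real_of_int \<lfloor>real n * y\<rfloor>" by linarith
    then have "(real n * y - 1) / real n \<le> real_of_int \<lfloor>real n * y\<rfloor> / real n" by (rule divide_right_mono) simp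
    then show ?case using elim by (simp add: diff_divide_distrib)
  qed
  show "\<forall>\<^sub>F n in sequentially. real_of_int \<lfloor>real n * y\<rfloor> / real n \<le> y"
    using eventually_gt_at_top[of 0]
  proof eventually_elim
    case (elim n)
    have "real_of_int \<lfloor>real n * y\<rfloor> / real n \<le> real n * y / real n" by (rule divide_right_mono) auto
    then show ?case using elim by simp
  qed
  show "(\<lambda>n. y - 1 / real n) \<longlonglongrightarrow> y"
    using tendsto_diff[OF tendsto_const[of y] lim_1_over_n] by simp
qed simp

lemma nat_floor_div_tendsto: "0 \<le> y \<Longrightarrow> (\<lambda>n. real (nat \<lfloor>real n * y\<rfloor>) / real n) \<longlonglongrightarrow> y"
  using floor_div_tendsto[of y] by simp

text \<open>The weights are spread over cells of length \<open>1 / n\<close> as a step function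
  \<open>\<Phi> n\<close> with the same total mass. Pointwise convergence together with convergence
  of the masses gives convergence in mean by Scheffe's lemma. The test function, sampled at the left
  ends of the cells, then follows by dominated convergence.\<close>

lemma sum_mult_tendsto_integral:
  fixes G :: "nat \<Rightarrow> nat \<Rightarrow> real" and \<phi> f :: "real \<Rightarrow> real"
  assumes G: "\<And>n m. 0 \<le> G n m" and \<phi>: "integrable lborel \<phi>" "\<And>y. 0 \<le> \<phi> y"
    and lim: "AE y in lborel. (\<lambda>n. if 0 \<le> y \<and> nat \<lfloor>real n * y\<rfloor> \<le> n then real n * G n (nat \<lfloor>real n * y\<rfloor>) else 0) \<longlonglongrightarrow> \<phi> y"
    and mass: "(\<lambda>n. \<Sum>m\<le>n. G n m) \<longlonglongrightarrow> (\<integral>y. \<phi> y \<partial>lborel)"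
    and f: "continuous_on UNIV f" "\<And>y. \<bar>f y\<bar> \<le> C"
  shows "(\<lambda>n. \<Sum>m\<le>n. G n m * f (real m / real n)) \<longlonglongrightarrow> (\<integral>y. \<phi> y * f y \<partial>lborel)"
proof -
  define \<Phi> where "\<Phi> n y = (if 0 \<le> y \<and> nat \<lfloor>real n * y\<rfloor> \<le> n then real n * G n (nat \<lfloor>real n * y\<rfloor>) else 0)" for n y
  define fn where "fn n y = f (real_of_int \<lfloor>real n * y\<rfloor> / real n)" for n y
  have C: "0 \<le> C" using f(2)[of 0] by simp
  have [measurable]: "f \<in> borel_measurable borel" using f(1) by (rule borel_measurable_continuous_onI)
  have [measurable]: "fn n \<in> borel_measurable lborel" for n unfolding fn_def[abs_def] by measurable
  have [measurable]: "\<phi> \<in> borel_measurable lborel" using \<phi>(1) by simp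
  have cell: "0 \<le> y \<and> nat \<lfloor>real n * y\<rfloor> = m \<longleftrightarrow> y \<in> {real m / real n..<real (Suc m) / real n}" if "0 < n" for n m y
  proof -
    have "y \<in> {real m / real n..<real (Suc m) / real n} \<longleftrightarrow> real m \<le> real n * y \<and> real n * y < real m + 1"
      using that by (auto simp: field_simps)
    also have "\<dots> \<longleftrightarrow> \<lfloor>real n * y\<rfloor> = int m" by (simp add: floor_eq_iff)
    also have "\<dots> \<longleftrightarrow> 0 \<le> y \<and> nat \<lfloor>real n * y\<rfloor> = m"
    proof
      assume *: "\<lfloor>real n * y\<rfloor> = int m"
      then have "0 \<le> real n * y" by linarith
      then show "0 \<le> y \<and> nat \<lfloor>real n * y\<rfloor> = m" using * that by (simp add: zero_le_mult_iff)
    next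
      assume "0 \<le> y \<and> nat \<lfloor>real n * y\<rfloor> = m"
      then show "\<lfloor>real n * y\<rfloor> = int m" by auto
    qed
    finally show ?thesis by simp
  qed
  have sum_form: "\<Phi> n y * h (real_of_int \<lfloor>real n * y\<rfloor> / real n)
      = (\<Sum>m\<le>n. real n * G n m * h (real m / real n) * indicator {real m / real n..<real (Suc m) / real n} y)"
    if n: "0 < n" for n y and h :: "real \<Rightarrow> real"
  proof (cases "0 \<le> y \<and> nat \<lfloor>real n * y\<rfloor> \<le> n")
    case True
    have "(\<Sum>m\<le>n. real n * G n m * h (real m / real n) * indicator {real m / real n..<real (Suc m) / real n} y)
       = (\<Sum>m\<le>n. if m = nat \<lfloor>real n * y\<rfloor> then real n * G n m * h (real m / real n) else 0)"
    proof (intro sum.cong refl)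
      fix m
      have "y \<in> {real m / real n..<real (Suc m) / real n} \<longleftrightarrow> m = nat \<lfloor>real n * y\<rfloor>"
        using cell[OF n, of y m] True by blast
      then have "indicator {real m / real n..<real (Suc m) / real n} y = (if m = nat \<lfloor>real n * y\<rfloor> then 1 else 0 :: real)"
        by (simp only: indicator_def of_bool_def)
      then show "real n * G n m * h (real m / real n) * indicator {real m / real n..<real (Suc m) / real n} y
        = (if m = nat \<lfloor>real n * y\<rfloor> then real n * G n m * h (real m / real n) else 0)"
        by (simp only:) simp
    qed
    also have "\<dots> = \<Phi> n y * h (real_of_int \<lfloor>real n * y\<rfloor> / real n)"
      using True by (simp add: \<Phi>_def)
    finally show ?thesis by simp
  next
    case False
    have "(\<Sum>m\<le>n. real n * G n m * h (real m / real n) * indicator {real m / real n..<real (Suc m) / real n} y) = 0"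
    proof (rule sum.neutral, intro ballI)
      fix m assume m: "m \<in> {..n}"
      have "y \<notin> {real m / real n..<real (Suc m) / real n}"
        using cell[OF n, of y m] False m by auto
      then show "real n * G n m * h (real m / real n) * indicator {real m / real n..<real (Suc m) / real n} y = 0" by simp
    qed
    moreover have "\<Phi> n y = 0" unfolding \<Phi>_def using False by (rule if_not_P)
    ultimately show ?thesis by (simp only: mult_zero_left)
  qed
  \<comment> \<open>The height \<open>n * G n m\<close> on a cell of length \<open>1 / n\<close>
    returns the weight \<open>G n m\<close>.\<close>
  have bochner: "has_bochner_integral lborel (\<lambda>y. \<Phi> n y * h (real_of_int \<lfloor>real n * y\<rfloor> / real n)) (\<Sum>m\<le>n. G n m * h (real m / real n))"
    if n: "0 < n" for n and h :: "real \<Rightarrow> real"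
  proof -
    have le: "real m / real n \<le> real (Suc m) / real n" for m by (rule divide_right_mono) auto
    have "has_bochner_integral lborel (\<lambda>y. \<Sum>m\<le>n. real n * G n m * h (real m / real n) * indicator {real m / real n..<real (Suc m) / real n} y)
       (\<Sum>m\<le>n. real n * G n m * h (real m / real n) * measure lborel {real m / real n..<real (Suc m) / real n})"
      by (intro has_bochner_integral_sum has_bochner_integral_mult_right has_bochner_integral_real_indicator) (auto simp del: of_nat_Suc simp: emeasure_lborel_Ico le)
    moreover have "real n * G n m * h (real m / real n) * measure lborel {real m / real n..<real (Suc m) / real n} = G n m * h (real m / real n)" for m
    proof -
      have "measure lborel {real m / real n..<real (Suc m) / real n} = real (Suc m) / real n - real m / real n"
        using le[of m] by (simp del: of_nat_Suc)
      also have "\<dots> = 1 / real n" by (simp add: diff_divide_distrib[symmetric])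
      finally show ?thesis using n by simp
    qed
    ultimately show ?thesis by (simp only: sum_form[OF n])
  qed
  have \<Phi>_nonneg: "0 \<le> \<Phi> n y" for n y using G by (simp add: \<Phi>_def)
  have \<Phi>_bochner: "has_bochner_integral lborel (\<Phi> n) (\<Sum>m\<le>n. G n m)" if "0 < n" for n
    using bochner[OF that, of "\<lambda>_. 1"] by simp
  have \<Phi>_int: "integrable lborel (\<Phi> n)" for n
  proof (cases "n = 0")
    case True
    then have "\<Phi> n = (\<lambda>_. 0)" by (auto simp: \<Phi>_def)
    then show ?thesis by simp
  qed (use \<Phi>_bochner[of n] in \<open>simp add: has_bochner_integral_iff\<close>)
  have [measurable]: "\<Phi> n \<in> borel_measurable lborel" for n using \<Phi>_int[of n] by simp
  have "(\<lambda>n. \<integral>\<^sup>+y. norm (\<Phi> n y - \<phi> y) \<partial>lborel) \<longlonglongrightarrow> 0"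
  proof (rule Scheffe_lemma1[OF \<Phi>_int \<phi>(1)])
    show "AE y in lborel. (\<lambda>n. \<Phi> n y) \<longlonglongrightarrow> \<phi> y" using lim by (simp add: \<Phi>_def)
    have "(\<integral>\<^sup>+y. ennreal (norm (\<phi> y)) \<partial>lborel) = ennreal (\<integral>y. \<phi> y \<partial>lborel)"
      using nn_integral_eq_integral[OF \<phi>(1)] \<phi>(2) by simp
    moreover have "(\<lambda>n. \<integral>\<^sup>+y. ennreal (norm (\<Phi> n y)) \<partial>lborel) \<longlonglongrightarrow> ennreal (\<integral>y. \<phi> y \<partial>lborel)"
    proof (rule Lim_transform_eventually[OF tendsto_ennrealI[OF mass]])
      show "\<forall>\<^sub>F n in sequentially. ennreal (\<Sum>m\<le>n. G n m) = (\<integral>\<^sup>+y. ennreal (norm (\<Phi> n y)) \<partial>lborel)"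
        using eventually_gt_at_top[of 0]
      proof eventually_elim
        case (elim n)
        show ?case
          using nn_integral_eq_integral[OF \<Phi>_int[of n]] \<Phi>_bochner[OF elim] \<Phi>_nonneg
          by (simp add: has_bochner_integral_iff)
      qed
    qed
    ultimately show "limsup (\<lambda>n. \<integral>\<^sup>+y. ennreal (norm (\<Phi> n y)) \<partial>lborel) \<le> (\<integral>\<^sup>+y. ennreal (norm (\<phi> y)) \<partial>lborel)"
      by (simp add: lim_imp_Limsup)
  qed
  moreover have diff_int: "integrable lborel (\<lambda>y. \<Phi> n y - \<phi> y)" for n
    using \<Phi>_int \<phi>(1) by (rule Bochner_Integration.integrable_diff)
  ultimately have "(\<lambda>n. ennreal (\<integral>y. norm (\<Phi> n y - \<phi> y) \<partial>lborel)) \<longlonglongrightarrow> ennreal 0"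
    using nn_integral_eq_integral[OF integrable_norm[OF diff_int]] by simp
  then have L1: "(\<lambda>n. \<integral>y. norm (\<Phi> n y - \<phi> y) \<partial>lborel) \<longlonglongrightarrow> 0"
    by (subst (asm) tendsto_ennreal_iff) auto
  have fn: "\<bar>fn n y\<bar> \<le> C" for n y using f(2) by (simp add: fn_def)
  have dfn_int: "integrable lborel (\<lambda>y. (\<Phi> n y - \<phi> y) * fn n y)" for n
    using fn by (intro Bochner_Integration.integrable_bound[OF integrable_mult_right[OF diff_int[of n], of C]])
      (auto simp: abs_mult C mult.commute intro!: AE_I2 mult_right_mono)
  have 1: "(\<lambda>n. \<integral>y. (\<Phi> n y - \<phi> y) * fn n y \<partial>lborel) \<longlonglongrightarrow> 0"
  proof (rule Lim_null_comparison)
    show "(\<lambda>n. C * (\<integral>y. norm (\<Phi> n y - \<phi> y) \<partial>lborel)) \<longlonglongrightarrow> 0"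
      using tendsto_mult[OF tendsto_const[of C] L1] by simp
    have "norm (\<integral>y. (\<Phi> n y - \<phi> y) * fn n y \<partial>lborel) \<le> C * (\<integral>y. norm (\<Phi> n y - \<phi> y) \<partial>lborel)" for n
    proof -
      have "norm (\<integral>y. (\<Phi> n y - \<phi> y) * fn n y \<partial>lborel) \<le> (\<integral>y. norm ((\<Phi> n y - \<phi> y) * fn n y) \<partial>lborel)"
        by (rule integral_norm_bound)
      also have "\<dots> \<le> (\<integral>y. C * norm (\<Phi> n y - \<phi> y) \<partial>lborel)"
      proof (intro integral_mono integrable_norm dfn_int integrable_mult_right diff_int)
        show "norm ((\<Phi> n y - \<phi> y) * fn n y) \<le> C * norm (\<Phi> n y - \<phi> y)" for y
          using mult_right_mono[OF fn[of n y], of "norm (\<Phi> n y - \<phi> y)"] by (simp add: abs_mult mult.commute)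
      qed
      finally show ?thesis by simp
    qed
    then show "\<forall>\<^sub>F n in sequentially. norm (\<integral>y. (\<Phi> n y - \<phi> y) * fn n y \<partial>lborel) \<le> C * (\<integral>y. norm (\<Phi> n y - \<phi> y) \<partial>lborel)" by simp
  qed
  have \<phi>fn_bound: "\<bar>\<phi> y * fn n y\<bar> \<le> C * \<phi> y" for n y
    using mult_right_mono[OF fn[of n y] \<phi>(2)[of y]] \<phi>(2)[of y] by (simp add: abs_mult mult.commute)
  have \<phi>fn_int: "integrable lborel (\<lambda>y. \<phi> y * fn n y)" for n
    using \<phi>fn_bound[of _ n] \<phi>(2) C by (intro Bochner_Integration.integrable_bound[OF integrable_mult_right[OF \<phi>(1), of C]]) auto
  have 2: "(\<lambda>n. \<integral>y. \<phi> y * fn n y \<partial>lborel) \<longlonglongrightarrow> (\<integral>y. \<phi> y * f y \<partial>lborel)"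
  proof (rule integral_dominated_convergence[where w = "\<lambda>y. C * \<phi> y"])
    show "AE y in lborel. (\<lambda>n. \<phi> y * fn n y) \<longlonglongrightarrow> \<phi> y * f y"
    proof (intro AE_I2 tendsto_mult tendsto_const)
      fix y
      have "isCont f y" using f(1) by (simp add: continuous_on_eq_continuous_at)
      then show "(\<lambda>n. fn n y) \<longlonglongrightarrow> f y"
        unfolding fn_def by (rule isCont_tendsto_compose[OF _ floor_div_tendsto])
    qed
  qed (use \<phi>fn_bound \<phi>(1) in auto)
  have "(\<lambda>n. (\<integral>y. (\<Phi> n y - \<phi> y) * fn n y \<partial>lborel) + (\<integral>y. \<phi> y * fn n y \<partial>lborel)) \<longlonglongrightarrow> 0 + (\<integral>y. \<phi> y * f y \<partial>lborel)"
    by (intro tendsto_add 1 2)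
  moreover have "\<forall>\<^sub>F n in sequentially. (\<integral>y. (\<Phi> n y - \<phi> y) * fn n y \<partial>lborel) + (\<integral>y. \<phi> y * fn n y \<partial>lborel) = (\<Sum>m\<le>n. G n m * f (real m / real n))"
    using eventually_gt_at_top[of 0]
  proof eventually_elim
    case (elim n)
    have "(\<integral>y. (\<Phi> n y - \<phi> y) * fn n y \<partial>lborel) + (\<integral>y. \<phi> y * fn n y \<partial>lborel) = (\<integral>y. \<Phi> n y * fn n y \<partial>lborel)"
      by (subst Bochner_Integration.integral_add[OF dfn_int \<phi>fn_int, symmetric]) (simp add: algebra_simps)
    also have "\<dots> = (\<Sum>m\<le>n. G n m * f (real m / real n))"
      using bochner[OF elim, of f] by (simp add: fn_def has_bochner_integral_iff)
    finally show ?case .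
  qed
  ultimately show ?thesis by (simp add: Lim_transform_eventually)
qed

lemma integral_density_01:
  fixes f q :: "real \<Rightarrow> real"
  assumes [measurable]: "q \<in> borel_measurable borel" and q: "\<And>y. y \<in> {0<..<1} \<Longrightarrow> 0 \<le> q y"
    and f: "f \<in> borel_measurable borel_01"
  shows "(\<integral>y. f y \<partial>density_01 q) = (\<integral>y. indicator {0<..<1} y * q y * f y \<partial>lborel)"
proof -
  have sets: "sets (restrict_space lborel {0..1 :: real}) = sets borel_01" by (simp add: sets_restrict_space)
  have fm: "f \<in> borel_measurable (restrict_space lborel {0..1})" using f by (simp add: measurable_cong_sets[OF sets refl])
  have qm: "(\<lambda>y. indicator {0<..<1} y * q y) \<in> borel_measurable (restrict_space lborel {0..1})"
    by (intro measurable_restrict_space1) measurable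
  have "(\<integral>y. f y \<partial>density_01 q) = (\<integral>y. (indicator {0<..<1} y * q y) *\<^sub>R f y \<partial>restrict_space lborel {0..1})"
    unfolding density_01_def using fm qm q by (intro integral_density) (auto intro!: AE_I2 split: split_indicator)
  also have "\<dots> = (\<integral>y. indicator {0..1} y *\<^sub>R ((indicator {0<..<1} y * q y) *\<^sub>R f y) \<partial>lborel)"
    by (rule integral_restrict_space) simp
  also have "\<dots> = (\<integral>y. indicator {0<..<1} y * q y * f y \<partial>lborel)"
    by (intro Bochner_Integration.integral_cong) (auto split: split_indicator)
  finally show ?thesis .
qed

section \<open>Limits of the transition probabilities\<close>

lemma of_nat_diff_div_tendsto:
  assumes "(\<lambda>n. real (a n) / real n) \<longlonglongrightarrow> \<alpha>" "(\<lambda>n. real (b n) / real n) \<longlonglongrightarrow> \<beta>"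
  shows "(\<lambda>n. real (a n - b n) / real n) \<longlonglongrightarrow> max 0 (\<alpha> - \<beta>)"
proof -
  have "real (a n - b n) / real n = max 0 (real (a n) / real n - real (b n) / real n)" for n
  proof -
    have "real (a n - b n) = max 0 (real (a n) - real (b n))" by (cases "b n \<le> a n") (auto simp: of_nat_diff)
    then have "real (a n - b n) / real n = max 0 (real (a n) - real (b n)) / real n" by simp
    also have "\<dots> = max 0 (real (a n) / real n - real (b n) / real n)"
      by (simp add: max_divide_distrib_right diff_divide_distrib)
    finally show ?thesis .
  qed
  then show ?thesis using assms by (auto intro!: tendsto_intros)
qed

lemma of_nat_add_div_tendsto:
  assumes "(\<lambda>n. real (a n) / real n) \<longlonglongrightarrow> \<alpha>" "(\<lambda>n. real (b n) / real n) \<longlonglongrightarrow> \<beta>"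
  shows "(\<lambda>n. real (a n + b n) / real n) \<longlonglongrightarrow> \<alpha> + \<beta>"
  using tendsto_add[OF assms] by (simp add: add_divide_distrib)

text \<open>The absolutely continuous part of the kernel for \<open>0 < t \<le> 1\<close> and
  interior starting points, in a form covering both regimes. The factor \<open>sqrt y\<close> has
  been cancelled from the second summand.\<close>

definition transition_density :: "real \<Rightarrow> real \<Rightarrow> real \<Rightarrow> real" where
  "transition_density t x y = (if x < t then sqrt ((1 - x) * (t - x)) / (pi * (y + t - x) * sqrt (y * (1 - y))) else 0)
     + sqrt (max (y + t - 1) 0) / (pi * (y + t - x) * sqrt (1 - y))"

lemma transition_density_measurable [measurable]: "transition_density t x \<in> borel_measurable borel"
  unfolding transition_density_def[abs_def] by measurable

lemma transition_density_nonneg: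
  assumes "0 < t" "x < 1" "y \<in> {0<..<1}"
  shows "0 \<le> transition_density t x y"
proof (cases "y + t - 1 \<le> 0")
  case True
  then show ?thesis using assms by (auto simp: transition_density_def max_def)
next
  case False
  then have "0 < y + t - x" using assms by simp
  then show ?thesis using assms by (auto simp: transition_density_def intro!: add_nonneg_nonneg)
qed

lemma argmin_kernel_density:
  assumes t: "0 < t" "t \<le> 1" and x: "0 < x" "x < 1"
  shows "argmin_kernel t x = (if t \<le> x then
     sum_measure (scale_measure (ennreal (survival t x)) (return borel_01 (x - t))) (density_01 (transition_density t x))
     else density_01 (transition_density t x))"
proof (cases "t \<le> x")
  case True
  then have "transition_density t x = (\<lambda>y. sqrt (max (y + t - 1) 0) / (pi * (y + t - x) * sqrt (1 - y)))"
    by (auto simp: transition_density_def)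
  then show ?thesis using True t by (simp add: argmin_kernel_def survival_def)
next
  case False
  have "density_01 (transition_density t x) = density_01 (\<lambda>y. (sqrt ((1 - x) * (t - x)) + sqrt (y * max (y + t - 1) 0)) / (pi * (y + t - x) * sqrt (y * (1 - y))))"
    unfolding density_01_def
  proof (intro arg_cong[where f = "density _"] ext)
    fix y
    show "ennreal (indicator {0<..<1} y * transition_density t x y) =
      ennreal (indicator {0<..<1} y * ((sqrt ((1 - x) * (t - x)) + sqrt (y * max (y + t - 1) 0)) / (pi * (y + t - x) * sqrt (y * (1 - y)))))"
    proof (cases "y \<in> {0<..<1}")
      case True
      then have "sqrt (y * max (y + t - 1) 0) / (pi * (y + t - x) * sqrt (y * (1 - y))) = sqrt (max (y + t - 1) 0) / (pi * (y + t - x) * sqrt (1 - y))"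
        by (simp add: real_sqrt_mult)
      then show ?thesis using False by (simp add: transition_density_def add_divide_distrib)
    qed simp
  qed
  then show ?thesis using False t by (simp add: argmin_kernel_def)
qed

text \<open>Integrability needs no estimate of the singularities: the density is a part of the
  kernel, whose total mass is one.\<close>

lemma integral_argmin_kernel_density:
  fixes f :: "real \<Rightarrow> real"
  assumes t: "0 < t" "t \<le> 1" and x: "0 < x" "x < 1"
    and f: "f \<in> borel_measurable borel" "\<And>y. \<bar>f y\<bar> \<le> C"
  shows "integrable lborel (\<lambda>y. indicator {0<..<1} y * transition_density t x y)"
    and "(\<integral>y. f y \<partial>argmin_kernel t x) = (if t \<le> x then survival t x * f (x - t) else 0)
      + (\<integral>y. (indicator {0<..<1} y * transition_density t x y) * f y \<partial>lborel)"
proof -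
  interpret Q: prob_space "argmin_kernel t x" using t x by (intro prob_space_argmin_kernel) auto
  have fm: "f \<in> borel_measurable borel_01" using f(1) by (rule measurable_restrict_space1)
  have S: "{0..1} \<in> sets borel_01" using sets.top[of borel_01] by (simp add: space_restrict_space)
  have nonneg: "0 \<le> indicator {0<..<1} y * transition_density t x y" for y
    using transition_density_nonneg[of t x y] t x by (auto split: split_indicator)
  have D: "emeasure (density_01 (transition_density t x)) {0..1} = (\<integral>\<^sup>+y. ennreal (indicator {0<..<1} y * transition_density t x y) \<partial>lborel)"
  proof -
    have "{0<..<1} \<inter> {0..1} = {0<..<1::real}" by auto
    then show ?thesis by (simp add: emeasure_density_01[OF _ S])
  qed
  have le: "emeasure (density_01 (transition_density t x)) {0..1} \<le> emeasure (argmin_kernel t x) {0..1}"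
    unfolding argmin_kernel_density[OF t x] using S by (auto simp: emeasure_sum_measure)
  also have "\<dots> = 1" using Q.emeasure_space_1 by simp
  finally have fin: "emeasure (density_01 (transition_density t x)) {0..1} \<le> 1" .
  show int: "integrable lborel (\<lambda>y. indicator {0<..<1} y * transition_density t x y)"
    using fin nonneg unfolding D by (auto simp: integrable_iff_bounded less_top[symmetric] dest: order.strict_trans1[OF _ ennreal_one_less_top])
  interpret D: finite_measure "density_01 (transition_density t x)"
  proof (rule finite_measureI)
    have "space (density_01 (transition_density t x)) = {0..1}"
      using sets_eq_imp_space_eq[OF sets_density_01] by (simp add: space_restrict_space)
    then show "emeasure (density_01 (transition_density t x)) (space (density_01 (transition_density t x))) \<noteq> \<infinity>"
      using fin by (auto simp: top_unique)
  qed
  have fD: "integrable (density_01 (transition_density t x)) f"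
    using fm f(2) by (intro D.integrable_const_bound[where B = C]) (auto simp: measurable_cong_sets[OF sets_density_01 refl])
  have ID: "(\<integral>y. f y \<partial>density_01 (transition_density t x)) = (\<integral>y. (indicator {0<..<1} y * transition_density t x y) * f y \<partial>lborel)"
    using fm transition_density_nonneg[of t x] t x by (subst integral_density_01) auto
  show "(\<integral>y. f y \<partial>argmin_kernel t x) = (if t \<le> x then survival t x * f (x - t) else 0)
      + (\<integral>y. (indicator {0<..<1} y * transition_density t x y) * f y \<partial>lborel)"
  proof (cases "t \<le> x")
    case True
    have c: "0 \<le> survival t x" using survival_bounds[of t x] t x by auto
    have xt: "x - t \<in> space borel_01" using True t x by (simp add: space_restrict_space)
    interpret R: prob_space "return borel_01 (x - t)" using xt by (rule prob_space_return)
    have R: "integrable (return borel_01 (x - t)) f"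
      using fm f(2) by (intro R.integrable_const_bound[where B = C]) auto
    have "(\<integral>y. f y \<partial>argmin_kernel t x) = (\<integral>y. f y \<partial>scale_measure (ennreal (survival t x)) (return borel_01 (x - t))) + (\<integral>y. f y \<partial>density_01 (transition_density t x))"
      unfolding argmin_kernel_density[OF t x] using True integral_scale_measure[OF R c] fD
      by (simp add: integral_sum_measure)
    also have "(\<integral>y. f y \<partial>scale_measure (ennreal (survival t x)) (return borel_01 (x - t))) = survival t x * f (x - t)"
      using integral_scale_measure[OF R c] integral_return[OF xt fm] by simp
    finally show ?thesis using True ID by simp
  next
    case False
    then show ?thesis unfolding argmin_kernel_density[OF t x] using ID by simp
  qed
qed

lemma sum_argmin_transition_split:
  assumes "j \<le> N"
  shows "(\<Sum>m\<le>N. argmin_transition N k j m * f m)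
       = (\<Sum>m\<le>N. refresh_transition N k j m * f m) + (if k \<le> j then persist (N - j + k) / persist (N - j) * f (j - k) else 0)"
proof -
  have "(\<Sum>m\<le>N. argmin_transition N k j m * f m) = (\<Sum>m\<le>N. refresh_transition N k j m * f m
      + (if m = j - k then (if k \<le> j then persist (N - j + k) / persist (N - j) * f (j - k) else 0) else 0))"
    by (intro sum.cong refl) (auto simp: argmin_transition_def distrib_right)
  also have "\<dots> = (\<Sum>m\<le>N. refresh_transition N k j m * f m) + (if k \<le> j then persist (N - j + k) / persist (N - j) * f (j - k) else 0)"
  proof -
    have "j - k \<le> N" using assms by simp
    then show ?thesis by (simp add: sum.distrib)
  qed
  finally show ?thesis .
qed

text \<open>Each summand contains, after cancellation, \<open>persist\<close> to the second power,
  hence is of order \<open>1 / n\<close>, and the remaining factors are ratios of indices. The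
  exclusions \<open>x \<noteq> t\<close> and \<open>y \<noteq> 1 - t\<close> make the conditions in
  the two summands eventually constant.\<close>

lemma refresh_transition_tendsto:
  assumes t: "0 < t" "t \<le> 1" and x: "0 < x" "x < 1" "x \<noteq> t" and y: "y \<in> {0<..<1}" "y \<noteq> 1 - t"
    and k: "(\<lambda>n. real (k n) / real n) \<longlonglongrightarrow> t" and j: "\<And>n. j n \<le> n" "(\<lambda>n. real (j n) / real n) \<longlonglongrightarrow> x"
    and m: "\<And>n. m n \<le> n" "(\<lambda>n. real (m n) / real n) \<longlonglongrightarrow> y"
  shows "(\<lambda>n. real n * refresh_transition n (k n) (j n) (m n)) \<longlonglongrightarrow> transition_density t x y"
proof -
  have n1: "(\<lambda>n. real n / real n) \<longlonglongrightarrow> 1"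
    by (rule tendsto_eventually) (use eventually_gt_at_top[of 0] in \<open>eventually_elim, simp\<close>)
  have nm: "(\<lambda>n. real (n - m n) / real n) \<longlonglongrightarrow> 1 - y"
    using of_nat_diff_div_tendsto[OF n1 m(2)] y by simp
  have nj: "(\<lambda>n. real (n - j n) / real n) \<longlonglongrightarrow> 1 - x"
    using of_nat_diff_div_tendsto[OF n1 j(2)] x by simp
  have mk: "(\<lambda>n. real (m n + k n) / real n) \<longlonglongrightarrow> y + t"
    by (rule of_nat_add_div_tendsto[OF m(2) k])
  have mkj: "(\<lambda>n. real (m n + k n - j n) / real n) \<longlonglongrightarrow> max 0 (y + t - x)"
    by (rule of_nat_diff_div_tendsto[OF mk j(2)])
  have pnm: "(\<lambda>n. sqrt (real n) * persist (n - m n)) \<longlonglongrightarrow> 1 / sqrt (pi * (1 - y))"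
    by (rule persist_scaling[OF nm]) (use y in simp)
  have pnj: "(\<lambda>n. sqrt (real n) * persist (n - j n)) \<longlonglongrightarrow> 1 / sqrt (pi * (1 - x))"
    by (rule persist_scaling[OF nj]) (use x in simp)
  have pm: "(\<lambda>n. sqrt (real n) * persist (m n)) \<longlonglongrightarrow> 1 / sqrt (pi * y)"
    by (rule persist_scaling[OF m(2)]) (use y in simp)
  have first: "(\<lambda>n. if j n < k n then real n * (persist (m n) * persist (k n - j n) * real (k n - j n) / (real (m n + k n - j n) * persist (n - j n)) * persist (n - m n)) else 0)
      \<longlonglongrightarrow> (if x < t then sqrt ((1 - x) * (t - x)) / (pi * (y + t - x) * sqrt (y * (1 - y))) else 0)"
  proof (cases "x < t")
    case True
    have kj: "(\<lambda>n. real (k n - j n) / real n) \<longlonglongrightarrow> t - x"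
      using of_nat_diff_div_tendsto[OF k j(2)] True by simp
    have pkj: "(\<lambda>n. sqrt (real n) * persist (k n - j n)) \<longlonglongrightarrow> 1 / sqrt (pi * (t - x))"
      by (rule persist_scaling[OF kj]) (use True in simp)
    have mkj': "(\<lambda>n. real (m n + k n - j n) / real n) \<longlonglongrightarrow> y + t - x"
      using mkj True y by (simp add: max_def)
    have L: "(\<lambda>n. (sqrt (real n) * persist (m n)) * (sqrt (real n) * persist (n - m n)) * ((sqrt (real n) * persist (k n - j n)) / (sqrt (real n) * persist (n - j n)))
        * ((real (k n - j n) / real n) / (real (m n + k n - j n) / real n)))
      \<longlonglongrightarrow> (1 / sqrt (pi * y)) * (1 / sqrt (pi * (1 - y))) * ((1 / sqrt (pi * (t - x))) / (1 / sqrt (pi * (1 - x)))) * ((t - x) / (y + t - x))"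
      using True x y by (intro tendsto_mult tendsto_divide pm pnm pkj pnj kj mkj') auto
    have Ev: "\<forall>\<^sub>F n in sequentially. (sqrt (real n) * persist (m n)) * (sqrt (real n) * persist (n - m n)) * ((sqrt (real n) * persist (k n - j n)) / (sqrt (real n) * persist (n - j n)))
        * ((real (k n - j n) / real n) / (real (m n + k n - j n) / real n))
       = (if j n < k n then real n * (persist (m n) * persist (k n - j n) * real (k n - j n) / (real (m n + k n - j n) * persist (n - j n)) * persist (n - m n)) else 0)"
      using eventually_gt_at_top[of 0]
    proof eventually_elim
      case (elim n)
      have "sqrt r * a * (sqrt r * b) * (sqrt r * c / (sqrt r * d)) * ((e / r) / (g / r)) = r * (a * c * e / (g * d) * b)"
        if "0 < r" for a b c d e g r :: real
      proof -
        have "sqrt r * a * (sqrt r * b) = r * (a * b)"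
          using that by (metis mult.assoc mult.left_commute less_imp_le real_sqrt_mult_self abs_of_pos)
        moreover have "sqrt r * c / (sqrt r * d) = c / d" "(e / r) / (g / r) = e / g" using that by simp_all
        ultimately have "sqrt r * a * (sqrt r * b) * (sqrt r * c / (sqrt r * d)) * ((e / r) / (g / r)) = r * (a * b) * (c / d) * (e / g)"
          by (simp only:)
        then show ?thesis by (simp add: mult_ac)
      qed
      from this[of "real n"] elim show ?case by simp
    qed
    have eq: "(1 / sqrt (pi * y)) * (1 / sqrt (pi * (1 - y))) * ((1 / sqrt (pi * (t - x))) / (1 / sqrt (pi * (1 - x)))) * ((t - x) / (y + t - x))
      = sqrt ((1 - x) * (t - x)) / (pi * (y + t - x) * sqrt (y * (1 - y)))"
    proof -
      have "1 / (p * T) / (1 / (p * A)) * (T * T) = A * T" if "p \<noteq> 0" "T \<noteq> 0" for p A T :: real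
        using that by simp
      from this[of "sqrt pi" "sqrt (t - x)" "sqrt (1 - x)"]
      have "(1 / sqrt (pi * (t - x))) / (1 / sqrt (pi * (1 - x))) * (t - x) = sqrt ((1 - x) * (t - x))"
        using True by (simp add: real_sqrt_mult)
      moreover have "(1 / sqrt (pi * y)) * (1 / sqrt (pi * (1 - y))) = 1 / (pi * sqrt (y * (1 - y)))"
        by (simp add: real_sqrt_mult)
      moreover have "u * v * (w / z) = u * (v * w) / z" for u v w z :: real by simp
      ultimately show ?thesis by (simp only:) simp
    qed
    show ?thesis using Lim_transform_eventually[OF L Ev] True by (simp only: eq if_True)
  next
    case False
    then have "t < x" using x(3) by simp
    have "\<forall>\<^sub>F n in sequentially. real (k n) / real n < (x + t) / 2" "\<forall>\<^sub>F n in sequentially. (x + t) / 2 < real (j n) / real n"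
      using \<open>t < x\<close> by (intro order_tendstoD(2)[OF k] order_tendstoD(1)[OF j(2)]; simp)+
    then have "\<forall>\<^sub>F n in sequentially. real (k n) / real n < real (j n) / real n" by eventually_elim linarith
    then have "\<forall>\<^sub>F n in sequentially. (if j n < k n then real n * (persist (m n) * persist (k n - j n) * real (k n - j n) / (real (m n + k n - j n) * persist (n - j n)) * persist (n - m n)) else 0) = 0"
      by eventually_elim (auto simp: divide_less_cancel)
    then show ?thesis using False by (simp add: tendsto_eventually)
  qed
  have second: "(\<lambda>n. if n < m n + k n then real n * (persist (m n + k n - n) * real (m n + k n - n) / real (m n + k n - j n) * persist (n - m n)) else 0)
      \<longlonglongrightarrow> sqrt (max (y + t - 1) 0) / (pi * (y + t - x) * sqrt (1 - y))"
  proof (cases "1 < y + t")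
    case True
    have mkn: "(\<lambda>n. real (m n + k n - n) / real n) \<longlonglongrightarrow> y + t - 1"
      using of_nat_diff_div_tendsto[OF mk n1] True by simp
    have pmkn: "(\<lambda>n. sqrt (real n) * persist (m n + k n - n)) \<longlonglongrightarrow> 1 / sqrt (pi * (y + t - 1))"
      by (rule persist_scaling[OF mkn]) (use True in simp)
    have mkj': "(\<lambda>n. real (m n + k n - j n) / real n) \<longlonglongrightarrow> y + t - x"
      using mkj True x by (simp add: max_def)
    have L: "(\<lambda>n. (sqrt (real n) * persist (m n + k n - n)) * (sqrt (real n) * persist (n - m n)) * ((real (m n + k n - n) / real n) / (real (m n + k n - j n) / real n)))
      \<longlonglongrightarrow> (1 / sqrt (pi * (y + t - 1))) * (1 / sqrt (pi * (1 - y))) * ((y + t - 1) / (y + t - x))"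
      using True x by (intro tendsto_mult tendsto_divide pmkn pnm mkn mkj') auto
    have Ev: "\<forall>\<^sub>F n in sequentially. (sqrt (real n) * persist (m n + k n - n)) * (sqrt (real n) * persist (n - m n)) * ((real (m n + k n - n) / real n) / (real (m n + k n - j n) / real n))
       = (if n < m n + k n then real n * (persist (m n + k n - n) * real (m n + k n - n) / real (m n + k n - j n) * persist (n - m n)) else 0)"
      using eventually_gt_at_top[of 0]
    proof eventually_elim
      case (elim n)
      have "sqrt r * a * (sqrt r * b) * ((e / r) / (g / r)) = r * (a * e / g * b)"
        if "0 < r" for a b e g r :: real
        using that by simp
      from this[of "real n"] elim show ?case by simp
    qed
    have eq: "(1 / sqrt (pi * (y + t - 1))) * (1 / sqrt (pi * (1 - y))) * ((y + t - 1) / (y + t - x))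
      = sqrt (max (y + t - 1) 0) / (pi * (y + t - x) * sqrt (1 - y))"
    proof -
      have "1 / (p * T) * (1 / (p * Y)) * (T * T / D) = T / (p * p * D * Y)" if "p \<noteq> 0" "T \<noteq> 0" for p T Y D :: real
        using that by simp
      from this[of "sqrt pi" "sqrt (y + t - 1)" "sqrt (1 - y)" "y + t - x"] show ?thesis
        using True by (simp add: real_sqrt_mult)
    qed
    show ?thesis using Lim_transform_eventually[OF L Ev] by (simp only: eq)
  next
    case False
    then have "y + t < 1" using y(2) by simp
    then have "\<forall>\<^sub>F n in sequentially. real (m n + k n) / real n < 1"
      using order_tendstoD(2)[OF mk] by simp
    then have "\<forall>\<^sub>F n in sequentially. (if n < m n + k n then real n * (persist (m n + k n - n) * real (m n + k n - n) / real (m n + k n - j n) * persist (n - m n)) else 0) = 0"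
      using eventually_gt_at_top[of 0] by eventually_elim (auto simp: divide_less_eq)
    then show ?thesis using \<open>y + t < 1\<close> by (simp add: tendsto_eventually max_def)
  qed
  have "real n * refresh_transition n (k n) (j n) (m n)
     = (if j n < k n then real n * (persist (m n) * persist (k n - j n) * real (k n - j n) / (real (m n + k n - j n) * persist (n - j n)) * persist (n - m n)) else 0)
     + (if n < m n + k n then real n * (persist (m n + k n - n) * real (m n + k n - n) / real (m n + k n - j n) * persist (n - m n)) else 0)" for n
    by (simp only: refresh_transition_def distrib_left if_distrib[of "(*) _"] mult_zero_right)
  then show ?thesis
    unfolding transition_density_def using tendsto_add[OF first second] by simp
qed

text \<open>The atom is treated by itself, since it has no density. Total mass one on the grid and
  in the limit then turns convergence of the atom into the convergence of masses that
  \<open>sum_mult_tendsto_integral\<close> requires for the rest. The starting index may vary with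
  \<open>n\<close>, because it will be a random grid argmin.\<close>

lemma argmin_transition_tendsto:
  fixes f :: "real \<Rightarrow> real"
  assumes t: "0 < t" "t \<le> 1" and x: "0 < x" "x < 1" "x \<noteq> t"
    and k: "(\<lambda>n. real (k n) / real n) \<longlonglongrightarrow> t" and j: "\<And>n. j n \<le> n" "(\<lambda>n. real (j n) / real n) \<longlonglongrightarrow> x"
    and mass: "\<forall>\<^sub>F n in sequentially. (\<Sum>m\<le>n. argmin_transition n (k n) (j n) m) = 1"
    and f: "continuous_on UNIV f" "\<And>y. \<bar>f y\<bar> \<le> C"
  shows "(\<lambda>n. \<Sum>m\<le>n. argmin_transition n (k n) (j n) m * f (real m / real n)) \<longlonglongrightarrow> (\<integral>y. f y \<partial>argmin_kernel t x)"
proof -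
  interpret Q: prob_space "argmin_kernel t x" using t x by (intro prob_space_argmin_kernel) auto
  let ?\<phi> = "\<lambda>y. indicator {0<..<1} y * transition_density t x y"
  let ?c = "if t \<le> x then survival t x else 0"
  have fm: "f \<in> borel_measurable borel" using f(1) by (rule borel_measurable_continuous_onI)
  have n1: "(\<lambda>n. real n / real n) \<longlonglongrightarrow> 1"
    by (rule tendsto_eventually) (use eventually_gt_at_top[of 0] in \<open>eventually_elim, simp\<close>)
  have atom: "(\<lambda>n. if k n \<le> j n then persist (n - j n + k n) / persist (n - j n) * h (real (j n - k n) / real n) else 0)
      \<longlonglongrightarrow> (if t \<le> x then survival t x * h (x - t) else 0)" if h: "continuous_on UNIV h" for h :: "real \<Rightarrow> real"
  proof (cases "t \<le> x")
    case True
    then have "t < x" using x by simp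
    have nj: "(\<lambda>n. real (n - j n) / real n) \<longlonglongrightarrow> 1 - x"
      using of_nat_diff_div_tendsto[OF n1 j(2)] x by simp
    have njk: "(\<lambda>n. real (n - j n + k n) / real n) \<longlonglongrightarrow> 1 - x + t"
      by (rule of_nat_add_div_tendsto[OF nj k])
    have jk: "(\<lambda>n. real (j n - k n) / real n) \<longlonglongrightarrow> x - t"
      using of_nat_diff_div_tendsto[OF j(2) k] True by simp
    have p1: "(\<lambda>n. sqrt (real n) * persist (n - j n)) \<longlonglongrightarrow> 1 / sqrt (pi * (1 - x))"
      by (rule persist_scaling[OF nj]) (use x in simp)
    have p2: "(\<lambda>n. sqrt (real n) * persist (n - j n + k n)) \<longlonglongrightarrow> 1 / sqrt (pi * (1 - x + t))"
      by (rule persist_scaling[OF njk]) (use x t in simp)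
    have "isCont h (x - t)" using h by (simp add: continuous_on_eq_continuous_at)
    then have hlim: "(\<lambda>n. h (real (j n - k n) / real n)) \<longlonglongrightarrow> h (x - t)" using jk by (rule isCont_tendsto_compose)
    have L: "(\<lambda>n. (sqrt (real n) * persist (n - j n + k n)) / (sqrt (real n) * persist (n - j n)) * h (real (j n - k n) / real n))
      \<longlonglongrightarrow> (1 / sqrt (pi * (1 - x + t))) / (1 / sqrt (pi * (1 - x))) * h (x - t)"
      using x by (intro tendsto_mult tendsto_divide p1 p2 hlim) auto
    have eq: "(1 / sqrt (pi * (1 - x + t))) / (1 / sqrt (pi * (1 - x))) = survival t x"
      by (simp add: survival_def real_sqrt_mult real_sqrt_divide)
    have Ev: "\<forall>\<^sub>F n in sequentially. (sqrt (real n) * persist (n - j n + k n)) / (sqrt (real n) * persist (n - j n)) * h (real (j n - k n) / real n)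
      = (if k n \<le> j n then persist (n - j n + k n) / persist (n - j n) * h (real (j n - k n) / real n) else 0)"
    proof -
    have "\<forall>\<^sub>F n in sequentially. real (k n) / real n < (x + t) / 2" "\<forall>\<^sub>F n in sequentially. (x + t) / 2 < real (j n) / real n"
      using \<open>t < x\<close> by (intro order_tendstoD(2)[OF k] order_tendstoD(1)[OF j(2)]; simp)+
    then have "\<forall>\<^sub>F n in sequentially. real (k n) / real n < real (j n) / real n" by eventually_elim linarith
      then show ?thesis
        using eventually_gt_at_top[of 0] by eventually_elim (auto simp: divide_less_cancel)
    qed
    show ?thesis using Lim_transform_eventually[OF L Ev] True by (simp only: eq if_True)
  next
    case False
    then have "x < t" by simp
    have "\<forall>\<^sub>F n in sequentially. (x + t) / 2 < real (k n) / real n" "\<forall>\<^sub>F n in sequentially. real (j n) / real n < (x + t) / 2"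
      using \<open>x < t\<close> by (intro order_tendstoD(1)[OF k] order_tendstoD(2)[OF j(2)]; simp)+
    then have "\<forall>\<^sub>F n in sequentially. real (j n) / real n < real (k n) / real n" by eventually_elim linarith
    then have "\<forall>\<^sub>F n in sequentially. (if k n \<le> j n then persist (n - j n + k n) / persist (n - j n) * h (real (j n - k n) / real n) else 0) = 0"
      by eventually_elim (auto simp: divide_less_cancel)
    then show ?thesis using False by (simp add: tendsto_eventually)
  qed
  have int\<phi>: "integrable lborel ?\<phi>" and one: "1 = ?c + (\<integral>y. ?\<phi> y \<partial>lborel)"
    using integral_argmin_kernel_density[OF t x(1,2), of "\<lambda>_. 1" 1] Q.prob_space by auto
  have "(\<lambda>n. \<Sum>m\<le>n. refresh_transition n (k n) (j n) m * f (real m / real n)) \<longlonglongrightarrow> (\<integral>y. ?\<phi> y * f y \<partial>lborel)"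
  proof (rule sum_mult_tendsto_integral[OF refresh_transition_nonneg int\<phi> _ _ _ f])
    show "0 \<le> ?\<phi> y" for y
      using transition_density_nonneg[of t x y] t x by (auto split: split_indicator)
    show "AE y in lborel. (\<lambda>n. if 0 \<le> y \<and> nat \<lfloor>real n * y\<rfloor> \<le> n then real n * refresh_transition n (k n) (j n) (nat \<lfloor>real n * y\<rfloor>) else 0) \<longlonglongrightarrow> ?\<phi> y"
      using AE_lborel_singleton[of 0] AE_lborel_singleton[of 1] AE_lborel_singleton[of "1 - t"]
    proof eventually_elim
      case (elim y)
      consider "y < 0" | "0 < y" "y < 1" | "1 < y" using elim by linarith
      then show ?case
      proof cases
        case 1
        then show ?thesis by simp
      next
        case 2
        have le: "nat \<lfloor>real n * y\<rfloor> \<le> n" for n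
        proof -
          have "real n * y \<le> real n * 1" using 2 by (intro mult_left_mono) auto
          then show ?thesis by linarith
        qed
        have "(\<lambda>n. real n * refresh_transition n (k n) (j n) (nat \<lfloor>real n * y\<rfloor>)) \<longlonglongrightarrow> transition_density t x y"
          using 2 elim by (intro refresh_transition_tendsto[OF t x _ _ k j le nat_floor_div_tendsto]) auto
        then show ?thesis using 2 le by simp
      next
        case 3
        obtain n0 where n0: "2 / (y - 1) < real n0" using reals_Archimedean2 by blast
        have "\<forall>\<^sub>F n in sequentially. (if 0 \<le> y \<and> nat \<lfloor>real n * y\<rfloor> \<le> n then real n * refresh_transition n (k n) (j n) (nat \<lfloor>real n * y\<rfloor>) else 0) = 0"
          using eventually_ge_at_top[of n0]
        proof eventually_elim
          case (elim n)
          then have "2 / (y - 1) < real n" using n0 by simp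
          then have "2 < real n * (y - 1)" using 3 by (simp add: field_simps)
          then have "real n + 2 < real n * y" by (simp add: algebra_simps)
          then have "\<not> nat \<lfloor>real n * y\<rfloor> \<le> n" by linarith
          then show ?case by simp
        qed
        then show ?thesis using 3 by (simp add: tendsto_eventually)
      qed
    qed
    \<comment> \<open>The mass of the part with a density is the complement of the atom, before and
      after the limit.\<close>
    have "(\<lambda>n. 1 - (if k n \<le> j n then persist (n - j n + k n) / persist (n - j n) * 1 else 0)) \<longlonglongrightarrow> 1 - ?c"
      using tendsto_diff[OF tendsto_const[of 1] atom[OF continuous_on_const[of _ 1]]] by (simp only: mult_1_right)
    moreover have "\<forall>\<^sub>F n in sequentially. 1 - (if k n \<le> j n then persist (n - j n + k n) / persist (n - j n) * 1 else 0) = (\<Sum>m\<le>n. refresh_transition n (k n) (j n) m)"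
      using mass
    proof eventually_elim
      case (elim n)
      then show ?case using sum_argmin_transition_split[OF j(1)[of n], of "k n" "\<lambda>_. 1"] by (simp only: mult_1_right)
    qed
    ultimately have "(\<lambda>n. \<Sum>m\<le>n. refresh_transition n (k n) (j n) m) \<longlonglongrightarrow> 1 - ?c"
      by (rule Lim_transform_eventually)
    moreover have "1 - ?c = (\<integral>y. ?\<phi> y \<partial>lborel)" using one by linarith
    ultimately show "(\<lambda>n. \<Sum>m\<le>n. refresh_transition n (k n) (j n) m) \<longlonglongrightarrow> (\<integral>y. ?\<phi> y \<partial>lborel)" by simp
  qed
  from tendsto_add[OF this atom[OF f(1)]] show ?thesis
    unfolding sum_argmin_transition_split[OF j(1)] integral_argmin_kernel_density(2)[OF t x(1,2) fm f(2)]
    by (simp add: add.commute)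
qed

context std_brownian_motion
begin

text \<open>The discrete Markov property on the grid of mesh \<open>1 / n\<close>, passed to the
  limit by dominated convergence. On both sides the grid argmins converge almost surely, and on the
  right the transition sums converge along the random starting index.\<close>

lemma expectation_argmin_process:
  fixes f :: "real \<Rightarrow> real \<Rightarrow> real" and g :: "real \<Rightarrow> real"
  assumes U: "finite U" "U \<subseteq> {0..s}" and t: "0 < t" "t \<le> 1" and s: "0 \<le> s"
    and f: "\<And>u. u \<in> U \<Longrightarrow> continuous_on UNIV (f u)" "\<And>u y. u \<in> U \<Longrightarrow> \<bar>f u y\<bar> \<le> 1"
    and g: "continuous_on UNIV g" "\<And>y. \<bar>g y\<bar> \<le> C"
  shows "expectation (\<lambda>\<omega>. (\<Prod>u\<in>U. f u (argmin_process B u \<omega>)) * g (argmin_process B (s + t) \<omega>))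
       = expectation (\<lambda>\<omega>. (\<Prod>u\<in>U. f u (argmin_process B u \<omega>)) * (\<integral>y. g y \<partial>argmin_kernel t (argmin_process B s \<omega>)))"
proof -
  define a where "a n = nat \<lfloor>real n * s\<rfloor>" for n
  \<comment> \<open>A difference of rounded times rather than a rounded difference, so that
    \<open>a n + k n\<close> is exactly the start of the grid window at time \<open>s + t\<close>.
    It is at most \<open>n\<close> because \<open>t \<le> 1\<close>.\<close>
  define k where "k n = nat \<lfloor>real n * (s + t)\<rfloor> - a n" for n
  have ak: "nat \<lfloor>real n * (s + t)\<rfloor> = a n + k n" for n
  proof -
    have "real n * s \<le> real n * (s + t)" using t by (intro mult_left_mono) auto
    then have "a n \<le> nat \<lfloor>real n * (s + t)\<rfloor>" unfolding a_def by (intro nat_mono floor_mono)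
    then show ?thesis by (simp add: k_def)
  qed
  have kn: "k n \<le> n" for n
  proof -
    have "real n * (s + t) \<le> real n * (s + 1)" using t by (intro mult_left_mono) auto
    then have "real n * (s + t) \<le> real n * s + real n" by (simp add: distrib_left)
    moreover have "0 \<le> real n * s" using s by simp
    ultimately show ?thesis unfolding k_def a_def by linarith
  qed
  have klim: "(\<lambda>n. real (k n) / real n) \<longlonglongrightarrow> t"
  proof -
    have "(\<lambda>n. real (nat \<lfloor>real n * (s + t)\<rfloor> - a n) / real n) \<longlonglongrightarrow> max 0 (s + t - s)"
      unfolding a_def using s t by (intro of_nat_diff_div_tendsto nat_floor_div_tendsto) auto
    then show ?thesis using t by (simp add: k_def[abs_def])
  qed
  define \<alpha> where "\<alpha> n u \<omega> = real (grid_argmin n u \<omega>) / real n" for n u \<omega>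
  define F where "F n \<omega> = (\<Prod>u\<in>U. f u (\<alpha> n u \<omega>))" for n \<omega>
  define P where "P n \<omega> = (\<Sum>m\<le>n. argmin_transition n (k n) (grid_argmin n s \<omega>) m * g (real m / real n))" for n \<omega>
  have [measurable]: "argmin_process B u \<in> borel_measurable M" if "0 \<le> u" for u
    using that by simp
  have C: "0 \<le> C" using g(2)[of 0] by simp
  have fin: "(\<lambda>\<omega>. h (grid_argmin n u \<omega>)) \<in> borel_measurable M"
    and disc: "expectation (\<lambda>\<omega>. F n \<omega> * g (\<alpha> n (s + t) \<omega>)) = expectation (\<lambda>\<omega>. F n \<omega> * P n \<omega>)"
    and mass: "i \<le> n \<Longrightarrow> (\<Sum>m\<le>n. argmin_transition n (k n) i m) = 1"
    if n: "0 < n" for n u i and h :: "nat \<Rightarrow> real"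
  proof -
    define \<delta> where "\<delta> = 1 / real n"
    have \<delta>: "0 < \<delta>" using n by (simp add: \<delta>_def)
    interpret walk: symmetric_walk M "increment 0 \<delta>" "density lborel (normal_density 0 (sqrt \<delta>))"
      using \<delta> by (intro symmetric_walk_increment) auto
    have grid: "grid_argmin n u \<omega> = walk.window_argmin n (nat \<lfloor>real n * u\<rfloor>) \<omega>" for u \<omega>
    proof -
      have "walk.S i \<omega> = B (real i / real n) \<omega> - B 0 \<omega>" for i
        using S_increment[OF _ \<delta>, of 0 i \<omega>] by (simp add: \<delta>_def)
      then show ?thesis by (simp add: grid_argmin_def walk.window_argmin_def last_argmin_def)
    qed
    show "(\<lambda>\<omega>. h (grid_argmin n u \<omega>)) \<in> borel_measurable M"
      unfolding grid walk.window_argmin_def by (rule walk.measurable_steps_imp[OF walk.last_argmin_fun_steps[OF subset_UNIV]])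
    show "(\<Sum>m\<le>n. argmin_transition n (k n) i m) = 1" if "i \<le> n"
      using that kn by (rule walk.sum_argmin_transition)
    show "expectation (\<lambda>\<omega>. F n \<omega> * g (\<alpha> n (s + t) \<omega>)) = expectation (\<lambda>\<omega>. F n \<omega> * P n \<omega>)"
      unfolding F_def P_def \<alpha>_def grid ak a_def[symmetric]
    proof (rule walk.expectation_window_argmin[where f = "\<lambda>u i. f u (real i / real n)" and g = "\<lambda>i. g (real i / real n)"])
      fix u assume u: "u \<in> U"
      then have "real n * u \<le> real n * s" using U(2) by (intro mult_left_mono) auto
      then show "nat \<lfloor>real n * u\<rfloor> \<le> a n" unfolding a_def by (intro nat_mono floor_mono)
    qed (use U f kn in auto)
  qed
  have lim\<alpha>: "AE \<omega> in M. \<forall>u\<in>insert s (insert (s + t) U). (\<lambda>n. \<alpha> n u \<omega>) \<longlonglongrightarrow> argmin_process B u \<omega>"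
    unfolding \<alpha>_def using U s t by (intro AE_finite_allI AE_grid_argmin_tendsto) auto
  have Fbound: "\<bar>F n \<omega>\<bar> \<le> 1" for n \<omega>
    unfolding F_def abs_prod using f(2) by (intro prod_le_1) auto
  have Pbound: "\<bar>P n \<omega>\<bar> \<le> C" if "0 < n" for n \<omega>
  proof -
    have "\<bar>P n \<omega>\<bar> \<le> (\<Sum>m\<le>n. \<bar>argmin_transition n (k n) (grid_argmin n s \<omega>) m * g (real m / real n)\<bar>)"
      unfolding P_def by (rule sum_abs)
    also have "\<dots> \<le> (\<Sum>m\<le>n. argmin_transition n (k n) (grid_argmin n s \<omega>) m * C)"
      using g(2) argmin_transition_nonneg by (intro sum_mono) (auto simp: abs_mult intro!: mult_left_mono)
    also have "\<dots> = C" using mass[OF that grid_argmin_le] by (simp add: sum_distrib_right[symmetric])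
    finally show ?thesis .
  qed
  have Flim: "AE \<omega> in M. (\<lambda>n. F n \<omega>) \<longlonglongrightarrow> (\<Prod>u\<in>U. f u (argmin_process B u \<omega>))"
    using lim\<alpha>
  proof eventually_elim
    case (elim \<omega>)
    show ?case unfolding F_def
    proof (intro tendsto_prod)
      fix u assume u: "u \<in> U"
      then have "isCont (f u) (argmin_process B u \<omega>)" using f(1) by (simp add: continuous_on_eq_continuous_at)
      then show "(\<lambda>n. f u (\<alpha> n u \<omega>)) \<longlonglongrightarrow> f u (argmin_process B u \<omega>)"
        using elim u by (auto intro: isCont_tendsto_compose)
    qed
  qed
  have glim: "AE \<omega> in M. (\<lambda>n. g (\<alpha> n (s + t) \<omega>)) \<longlonglongrightarrow> g (argmin_process B (s + t) \<omega>)"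
    using lim\<alpha>
  proof eventually_elim
    case (elim \<omega>)
    have "isCont g (argmin_process B (s + t) \<omega>)" using g(1) by (simp add: continuous_on_eq_continuous_at)
    then show ?case using elim by (auto intro: isCont_tendsto_compose)
  qed
  \<comment> \<open>The values 0, 1 and \<open>t\<close>, excluded as starting points in
    \<open>argmin_transition_tendsto\<close>, are almost surely not taken.\<close>
  have Plim: "AE \<omega> in M. (\<lambda>n. P n \<omega>) \<longlonglongrightarrow> (\<integral>y. g y \<partial>argmin_kernel t (argmin_process B s \<omega>))"
    using lim\<alpha> AE_argmin_process_neq[OF s, of 0] AE_argmin_process_neq[OF s, of 1] AE_argmin_process_neq[OF s, of t] AE_space
  proof eventually_elim
    case (elim \<omega>)
    have x: "argmin_process B s \<omega> \<in> {0..1}" using argmin_process_greatest(1)[OF elim(5) s] .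
    show ?case
      unfolding P_def
    proof (rule argmin_transition_tendsto[OF t _ _ elim(4) klim grid_argmin_le _ _ g])
      show "(\<lambda>n. real (grid_argmin n s \<omega>) / real n) \<longlonglongrightarrow> argmin_process B s \<omega>"
        using elim(1) by (simp add: \<alpha>_def)
      show "\<forall>\<^sub>F n in sequentially. (\<Sum>m\<le>n. argmin_transition n (k n) (grid_argmin n s \<omega>) m) = 1"
        using eventually_gt_at_top[of 0] by eventually_elim (rule mass[OF _ grid_argmin_le])
    qed (use x elim in auto)
  qed
  \<comment> \<open>From here on the index is shifted, since a mesh \<open>1 / n\<close> makes sense
    only for positive \<open>n\<close>.\<close>
  have [measurable]: "F (Suc n) \<in> borel_measurable M" "(\<lambda>\<omega>. g (\<alpha> (Suc n) (s + t) \<omega>)) \<in> borel_measurable M" "P (Suc n) \<in> borel_measurable M" for n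
    unfolding F_def[abs_def] P_def[abs_def] \<alpha>_def by (auto intro!: borel_measurable_prod fin)
  have [measurable]: "(\<lambda>\<omega>. \<Prod>u\<in>U. f u (argmin_process B u \<omega>)) \<in> borel_measurable M"
  proof (rule borel_measurable_prod)
    fix u assume u: "u \<in> U"
    then have "f u \<in> borel_measurable borel" using f(1) by (intro borel_measurable_continuous_onI)
    moreover have "argmin_process B u \<in> borel_measurable M" using u U(2) by auto
    ultimately show "(\<lambda>\<omega>. f u (argmin_process B u \<omega>)) \<in> borel_measurable M" by (rule measurable_compose[rotated])
  qed
  have [measurable]: "g \<in> borel_measurable borel" using g(1) by (rule borel_measurable_continuous_onI)
  have [measurable]: "argmin_process B (s + t) \<in> borel_measurable M" using s t by simp
  have [measurable]: "(\<lambda>\<omega>. \<integral>y. g y \<partial>argmin_kernel t (argmin_process B s \<omega>)) \<in> borel_measurable M"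
  proof -
    have "(\<lambda>x. \<integral>y. g y \<partial>argmin_kernel t x) \<in> borel_measurable borel_01"
      using t continuous_on_subset[OF g(1)] by (intro continuous_on_01_measurable continuous_on_argmin_kernel_integral) auto
    then show ?thesis by (rule measurable_compose[OF argmin_process_measurable[OF s]])
  qed
  have "(\<lambda>n. expectation (\<lambda>\<omega>. F (Suc n) \<omega> * g (\<alpha> (Suc n) (s + t) \<omega>)))
     \<longlonglongrightarrow> expectation (\<lambda>\<omega>. (\<Prod>u\<in>U. f u (argmin_process B u \<omega>)) * g (argmin_process B (s + t) \<omega>))"
  proof (rule integral_dominated_convergence[where w = "\<lambda>_. C"])
    show "AE \<omega> in M. (\<lambda>n. F (Suc n) \<omega> * g (\<alpha> (Suc n) (s + t) \<omega>)) \<longlonglongrightarrow> (\<Prod>u\<in>U. f u (argmin_process B u \<omega>)) * g (argmin_process B (s + t) \<omega>)"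
      using Flim glim by eventually_elim (intro tendsto_mult LIMSEQ_Suc)
    have "\<bar>F n \<omega>\<bar> * \<bar>g z\<bar> \<le> 1 * C" for n \<omega> z using Fbound g(2) by (intro mult_mono) auto
    then show "AE \<omega> in M. norm (F (Suc n) \<omega> * g (\<alpha> (Suc n) (s + t) \<omega>)) \<le> C" for n by (simp add: abs_mult)
  qed auto
  moreover have "(\<lambda>n. expectation (\<lambda>\<omega>. F (Suc n) \<omega> * P (Suc n) \<omega>))
     \<longlonglongrightarrow> expectation (\<lambda>\<omega>. (\<Prod>u\<in>U. f u (argmin_process B u \<omega>)) * (\<integral>y. g y \<partial>argmin_kernel t (argmin_process B s \<omega>)))"
  proof (rule integral_dominated_convergence[where w = "\<lambda>_. C"])
    show "AE \<omega> in M. (\<lambda>n. F (Suc n) \<omega> * P (Suc n) \<omega>) \<longlonglongrightarrow> (\<Prod>u\<in>U. f u (argmin_process B u \<omega>)) * (\<integral>y. g y \<partial>argmin_kernel t (argmin_process B s \<omega>))"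
      using Flim Plim by eventually_elim (intro tendsto_mult LIMSEQ_Suc)
    have "\<bar>F n \<omega>\<bar> * \<bar>P n \<omega>\<bar> \<le> 1 * C" if "0 < n" for n \<omega> using Fbound Pbound[OF that] by (intro mult_mono) auto
    then show "AE \<omega> in M. norm (F (Suc n) \<omega> * P (Suc n) \<omega>) \<le> C" for n by (simp add: abs_mult)
  qed auto
  ultimately show ?thesis
    unfolding disc[OF zero_less_Suc] by (rule LIMSEQ_unique)
qed

end

section \<open>The semigroup property and the Markov property\<close>

text \<open>A continuous approximation, from above, to the indicator of the half-line up to
  \<open>c\<close>.\<close>

definition ramp :: "nat \<Rightarrow> real \<Rightarrow> real \<Rightarrow> real" where
  "ramp n c y = max 0 (min 1 (1 - real n * (y - c)))"

lemma continuous_on_ramp: "continuous_on A (ramp n c)"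
  unfolding ramp_def[abs_def] by (intro continuous_intros)

lemma ramp_bounds: "0 \<le> ramp n c y" "ramp n c y \<le> 1" "\<bar>ramp n c y\<bar> \<le> 1"
  by (auto simp: ramp_def)

lemma ramp_tendsto: "(\<lambda>n. ramp n c y) \<longlonglongrightarrow> of_bool (y \<le> c)"
proof (cases "y \<le> c")
  case True
  then have "ramp n c y = 1" for n
    using mult_nonneg_nonpos[of "real n" "y - c"] by (auto simp: ramp_def)
  then show ?thesis using True by simp
next
  case False
  obtain n0 where n0: "1 / (y - c) < real n0" using reals_Archimedean2 by blast
  have "\<forall>\<^sub>F n in sequentially. ramp n c y = 0"
    using eventually_ge_at_top[of n0]
  proof eventually_elim
    case (elim n)
    then have "1 / (y - c) < real n" using n0 by simp
    then have "1 < real n * (y - c)" using False by (simp add: field_simps)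
    then show ?case by (simp add: ramp_def)
  qed
  then show ?thesis using False by (simp add: tendsto_eventually)
qed

text \<open>Integrals of \<open>ramp\<close> converge to the distribution function, and that
  determines a law on the line; the measures are transported there and back.\<close>

lemma measure_01_eqI:
  fixes \<mu> \<nu> :: "real measure"
  assumes \<mu>: "prob_space \<mu>" "sets \<mu> = sets borel_01" and \<nu>: "prob_space \<nu>" "sets \<nu> = sets borel_01"
    and eq: "\<And>f. continuous_on UNIV f \<Longrightarrow> (\<And>y. 0 \<le> f y) \<Longrightarrow> (\<And>y. f y \<le> 1) \<Longrightarrow> (\<integral>y. f y \<partial>\<mu>) = (\<integral>y. f y \<partial>\<nu> :: real)"
  shows "\<mu> = \<nu>"
proof -
  have id: "(\<lambda>x. x) \<in> \<rho> \<rightarrow>\<^sub>M borel" if "sets \<rho> = sets borel_01" for \<rho> :: "real measure"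
    using that by (simp add: measurable_cong_sets[OF that refl] measurable_restrict_space1)
  have lim: "(\<lambda>n. \<integral>y. ramp n c y \<partial>\<rho>) \<longlonglongrightarrow> measure \<rho> {y \<in> space \<rho>. y \<le> c}"
    if \<rho>: "prob_space \<rho>" "sets \<rho> = sets borel_01" for \<rho> :: "real measure" and c
  proof -
    interpret prob_space \<rho> by fact
    have [measurable]: "(\<lambda>x. x) \<in> borel_measurable \<rho>" by (rule id) fact
    have [measurable]: "ramp n c \<in> borel_measurable \<rho>" for n unfolding ramp_def[abs_def] by measurable
    have "(\<lambda>n. \<integral>y. ramp n c y \<partial>\<rho>) \<longlonglongrightarrow> (\<integral>y. of_bool (y \<le> c) \<partial>\<rho>)"
    proof (rule integral_dominated_convergence[where w = "\<lambda>_. 1"])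
      show "AE y in \<rho>. (\<lambda>n. ramp n c y) \<longlonglongrightarrow> of_bool (y \<le> c)" by (intro AE_I2 ramp_tendsto)
    qed (use ramp_bounds(3) in \<open>auto simp: of_bool_def\<close>)
    also have "(\<integral>y. of_bool (y \<le> c) \<partial>\<rho>) = (\<integral>y. indicat_real {y \<in> space \<rho>. y \<le> c} y \<partial>\<rho>)"
      by (intro Bochner_Integration.integral_cong) (auto simp: indicator_def)
    also have "\<dots> = measure \<rho> {y \<in> space \<rho>. y \<le> c}" by simp
    finally show ?thesis .
  qed
  have "measure \<mu> {y \<in> space \<mu>. y \<le> c} = measure \<nu> {y \<in> space \<nu>. y \<le> c}" for c
  proof (rule LIMSEQ_unique[OF lim[OF \<mu>]])
    have "(\<integral>y. ramp n c y \<partial>\<mu>) = (\<integral>y. ramp n c y \<partial>\<nu>)" for n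
      by (rule eq[OF continuous_on_ramp ramp_bounds(1,2)])
    then show "(\<lambda>n. \<integral>y. ramp n c y \<partial>\<mu>) \<longlonglongrightarrow> measure \<nu> {y \<in> space \<nu>. y \<le> c}"
      using lim[OF \<nu>] by simp
  qed
  moreover have cdf: "cdf (distr \<rho> borel (\<lambda>x. x)) c = measure \<rho> {y \<in> space \<rho>. y \<le> c}"
    if "sets \<rho> = sets borel_01" for \<rho> :: "real measure" and c
    unfolding cdf_def using id[OF that] by (subst measure_distr) (auto intro!: arg_cong[where f = "measure \<rho>"])
  moreover have "real_distribution (distr \<rho> borel (\<lambda>x. x))"
    if "prob_space \<rho>" "sets \<rho> = sets borel_01" for \<rho> :: "real measure"
    using prob_space.prob_space_distr[OF that(1) id[OF that(2)]]
    by (simp add: real_distribution_def real_distribution_axioms_def)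
  ultimately have distr: "distr \<mu> borel (\<lambda>x. x) = distr \<nu> borel (\<lambda>x. x)"
    using \<mu> \<nu> by (intro cdf_unique) auto
  show ?thesis
  proof (rule measure_eqI)
    fix A assume "A \<in> sets \<mu>"
    then have A: "A \<in> sets borel" "A \<subseteq> {0..1}" using \<mu>(2) sets_borel_01D by auto
    have "emeasure (distr \<rho> borel (\<lambda>x. x)) A = emeasure \<rho> A" if "sets \<rho> = sets borel_01" for \<rho> :: "real measure"
    proof -
      have "space \<rho> = {0..1}" using sets_eq_imp_space_eq[OF that] by (simp add: space_restrict_space)
      then have "(\<lambda>x. x) -` A \<inter> space \<rho> = A" using A by auto
      then show ?thesis using A id[OF that] by (simp add: emeasure_distr)
    qed
    then show "emeasure \<mu> A = emeasure \<nu> A" using distr \<mu> \<nu> by metis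
  qed (use \<mu> \<nu> in simp)
qed

lemma integral_bind_kernel:
  fixes f :: "real \<Rightarrow> real"
  assumes \<mu>: "\<mu> \<in> space (prob_algebra borel_01)" and K: "K \<in> borel_01 \<rightarrow>\<^sub>M prob_algebra borel_01"
    and f: "f \<in> borel_measurable borel_01" "\<And>y. y \<in> {0..1} \<Longrightarrow> \<bar>f y\<bar> \<le> C"
  shows "(\<integral>y. f y \<partial>(\<mu> \<bind> K)) = (\<integral>x. (\<integral>y. f y \<partial>K x) \<partial>\<mu>)"
proof -
  have \<mu>': "prob_space \<mu>" "sets \<mu> = sets borel_01" using \<mu> by (auto simp: space_prob_algebra)
  interpret \<mu>: prob_space \<mu> by fact
  have sp\<mu>: "space \<mu> = {0..1}" using sets_eq_imp_space_eq[OF \<mu>'(2)] by (simp add: space_restrict_space)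
  have bind: "prob_space (\<mu> \<bind> K)" "sets (\<mu> \<bind> K) = sets borel_01"
    using prob_space_bind'[OF \<mu> K] sets_bind'[OF \<mu> K] by auto
  have Kx: "prob_space (K x)" "sets (K x) = sets borel_01" if "x \<in> {0..1}" for x
    using measurable_space[OF K, of x] that by (auto simp: space_prob_algebra space_restrict_space)
  have int: "integrable \<rho> h" and bounds: "0 \<le> (\<integral>y. h y \<partial>\<rho>)" "(\<integral>y. h y \<partial>\<rho>) \<le> D"
    if \<rho>: "prob_space \<rho>" "sets \<rho> = sets borel_01" and h: "h \<in> borel_measurable borel_01" "\<And>y. y \<in> {0..1} \<Longrightarrow> 0 \<le> h y \<and> h y \<le> D"
    for \<rho> :: "real measure" and h :: "real \<Rightarrow> real" and D
  proof -
    interpret prob_space \<rho> by fact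
    have sp: "space \<rho> = {0..1}" using sets_eq_imp_space_eq[OF \<rho>(2)] by (simp add: space_restrict_space)
    show i: "integrable \<rho> h"
      using h by (intro integrable_const_bound[where B = D]) (auto simp: measurable_cong_sets[OF \<rho>(2) refl] sp intro!: AE_I2)
    show "0 \<le> (\<integral>y. h y \<partial>\<rho>)" using h sp by (intro Bochner_Integration.integral_nonneg) auto
    have "(\<integral>y. h y \<partial>\<rho>) \<le> (\<integral>y. D \<partial>\<rho>)" using h sp i by (intro integral_mono) auto
    then show "(\<integral>y. h y \<partial>\<rho>) \<le> D" using prob_space by simp
  qed
  have pos: "(\<integral>y. h y \<partial>(\<mu> \<bind> K)) = (\<integral>x. (\<integral>y. h y \<partial>K x) \<partial>\<mu>)"
    and posint: "integrable \<mu> (\<lambda>x. \<integral>y. h y \<partial>K x)"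
    if h: "h \<in> borel_measurable borel_01" "\<And>y. y \<in> {0..1} \<Longrightarrow> 0 \<le> h y \<and> h y \<le> D" for h :: "real \<Rightarrow> real" and D
  proof -
    have Ks: "K \<in> \<mu> \<rightarrow>\<^sub>M subprob_algebra borel_01"
      using measurable_prob_algebraD[OF K] by (simp add: measurable_cong_sets[OF \<mu>'(2) refl])
    have hm: "(\<lambda>x. \<integral>y. h y \<partial>K x) \<in> borel_measurable \<mu>"
      using measurable_compose[OF Ks integral_measurable_subprob_algebra[OF h(1)]] .
    show posint: "integrable \<mu> (\<lambda>x. \<integral>y. h y \<partial>K x)"
      using bounds[OF Kx h] by (intro \<mu>.integrable_const_bound[where B = D] hm) (auto simp: sp\<mu> intro!: AE_I2)
    have "ennreal (\<integral>y. h y \<partial>(\<mu> \<bind> K)) = (\<integral>\<^sup>+y. ennreal (h y) \<partial>(\<mu> \<bind> K))"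
      using h int[OF bind h] sets_eq_imp_space_eq[OF bind(2)]
      by (intro nn_integral_eq_integral[symmetric]) (auto simp: space_restrict_space intro!: AE_I2)
    also have "\<dots> = (\<integral>\<^sup>+x. (\<integral>\<^sup>+y. ennreal (h y) \<partial>K x) \<partial>\<mu>)"
      using h(1) by (intro nn_integral_bind[OF _ Ks]) measurable
    also have "\<dots> = (\<integral>\<^sup>+x. ennreal (\<integral>y. h y \<partial>K x) \<partial>\<mu>)"
    proof (rule nn_integral_cong)
      fix x assume "x \<in> space \<mu>"
      then have x: "x \<in> {0..1}" by (simp add: sp\<mu>)
      show "(\<integral>\<^sup>+y. ennreal (h y) \<partial>K x) = ennreal (\<integral>y. h y \<partial>K x)"
        using h int[OF Kx[OF x] h] sets_eq_imp_space_eq[OF Kx(2)[OF x]]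
        by (intro nn_integral_eq_integral) (auto simp: space_restrict_space intro!: AE_I2)
    qed
    also have "\<dots> = ennreal (\<integral>x. (\<integral>y. h y \<partial>K x) \<partial>\<mu>)"
      using bounds(1)[OF Kx h] posint by (intro nn_integral_eq_integral) (auto simp: sp\<mu> intro!: AE_I2)
    finally show "(\<integral>y. h y \<partial>(\<mu> \<bind> K)) = (\<integral>x. (\<integral>y. h y \<partial>K x) \<partial>\<mu>)"
    proof (subst (asm) ennreal_inj)
      show "0 \<le> (\<integral>x. (\<integral>y. h y \<partial>K x) \<partial>\<mu>)"
        by (rule Bochner_Integration.integral_nonneg) (rule bounds(1)[OF Kx h], simp_all add: sp\<mu>)
    qed (use bounds(1)[OF bind h] in auto)
  qed
  \<comment> \<open>The shift makes the integrand nonnegative, where the rule for the nonnegative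
    integral over a bind applies. All measures involved have mass one, so the constant can be
    subtracted again.\<close>
  define h where "h y = f y + C" for y
  have h: "h \<in> borel_measurable borel_01" "\<And>y. y \<in> {0..1} \<Longrightarrow> 0 \<le> h y \<and> h y \<le> 2 * C"
    using f(1) f(2) unfolding h_def[abs_def] by (auto simp: abs_le_iff) (smt (verit) f(2) atLeastAtMost_iff)+
  have f_eq: "(\<integral>y. f y \<partial>\<rho>) = (\<integral>y. h y \<partial>\<rho>) - C" if \<rho>: "prob_space \<rho>" "sets \<rho> = sets borel_01" for \<rho> :: "real measure"
  proof -
    interpret prob_space \<rho> by fact
    have "(\<integral>y. f y \<partial>\<rho>) = (\<integral>y. h y - C \<partial>\<rho>)" by (simp add: h_def)
    also have "\<dots> = (\<integral>y. h y \<partial>\<rho>) - C" using int[OF \<rho> h] prob_space by simp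
    finally show ?thesis .
  qed
  have "(\<integral>y. f y \<partial>(\<mu> \<bind> K)) = (\<integral>x. (\<integral>y. h y \<partial>K x) \<partial>\<mu>) - C"
    using f_eq[OF bind] pos[OF h] by simp
  also have "\<dots> = (\<integral>x. (\<integral>y. h y \<partial>K x) - C \<partial>\<mu>)"
    using posint[OF h] \<mu>.prob_space by simp
  also have "\<dots> = (\<integral>x. (\<integral>y. f y \<partial>K x) \<partial>\<mu>)"
    using f_eq[OF Kx] by (intro Bochner_Integration.integral_cong) (auto simp: sp\<mu>)
  finally show ?thesis .
qed

lemma continuous_on_clamp:
  fixes f :: "real \<Rightarrow> real"
  assumes "continuous_on {0..1} f"
  shows "continuous_on UNIV (\<lambda>y. f (max 0 (min 1 y)))"
  by (rule continuous_on_compose2[OF assms]) (auto intro!: continuous_intros)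

text \<open>At lag 1 the numerator is \<open>y + 1 - x\<close> and cancels: consecutive disjoint
  windows do not influence each other. The value \<open>x = 1\<close> falls under the other branch
  of the definition and is left out, being a null event for the process.\<close>

lemma argmin_kernel_1: "x \<in> {0..<1} \<Longrightarrow> argmin_kernel 1 x = argmin_kernel 1 0"
proof -
  assume x: "x \<in> {0..<1}"
  have "(sqrt ((1 - x) * (1 - x)) + sqrt (y * max (y + 1 - 1) 0)) / (pi * (y + 1 - x) * S) = 1 / (pi * S)"
    if "0 < y" "x \<in> {0..<1}" for x y S :: real
  proof -
    have "(sqrt ((1 - x) * (1 - x)) + sqrt (y * max (y + 1 - 1) 0)) = y + 1 - x" using that by simp
    moreover have "(y + 1 - x) / (pi * (y + 1 - x) * S) = 1 / (pi * S)" using that by simp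
    ultimately show ?thesis by (simp only:)
  qed
  note eq = this
  have "density_01 (\<lambda>y. (sqrt ((1 - x) * (1 - x)) + sqrt (y * max (y + 1 - 1) 0)) / (pi * (y + 1 - x) * sqrt (y * (1 - y))))
      = density_01 (\<lambda>y. (sqrt ((1 - 0) * (1 - 0)) + sqrt (y * max (y + 1 - 1) 0)) / (pi * (y + 1 - 0) * sqrt (y * (1 - y))))"
    unfolding density_01_def
  proof (intro arg_cong[where f = "density _"] ext)
    fix y :: real
    show "ennreal (indicator {0<..<1} y * ((sqrt ((1 - x) * (1 - x)) + sqrt (y * max (y + 1 - 1) 0)) / (pi * (y + 1 - x) * sqrt (y * (1 - y)))))
       = ennreal (indicator {0<..<1} y * ((sqrt ((1 - 0) * (1 - 0)) + sqrt (y * max (y + 1 - 1) 0)) / (pi * (y + 1 - 0) * sqrt (y * (1 - y)))))"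
    proof (cases "y \<in> {0<..<1}")
      case True
      have "0 \<in> {0..<1 :: real}" by simp
      then show ?thesis using True eq[of y x] eq[of y 0] x by (simp only: greaterThanLessThan_iff)
    qed simp
  qed
  then show ?thesis using x by (simp add: argmin_kernel_def)
qed

context std_brownian_motion
begin

text \<open>For \<open>t > 1\<close> the lag-one statement is applied at time
  \<open>s + t - 1\<close>, which is still at least \<open>s\<close> and so keeps \<open>U\<close>
  in the past. By \<open>argmin_kernel_1\<close> the kernel there does not depend on the state, and
  it coincides with the kernel at time \<open>t\<close>.\<close>

lemma expectation_argmin_process_product:
  fixes f :: "real \<Rightarrow> real \<Rightarrow> real" and g :: "real \<Rightarrow> real"
  assumes U: "finite U" "U \<subseteq> {0..s}" and t: "0 < t" and s: "0 \<le> s"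
    and f: "\<And>u. u \<in> U \<Longrightarrow> continuous_on UNIV (f u)" "\<And>u y. u \<in> U \<Longrightarrow> \<bar>f u y\<bar> \<le> 1"
    and g: "continuous_on UNIV g" "\<And>y. \<bar>g y\<bar> \<le> C"
  shows "expectation (\<lambda>\<omega>. (\<Prod>u\<in>U. f u (argmin_process B u \<omega>)) * g (argmin_process B (s + t) \<omega>))
       = expectation (\<lambda>\<omega>. (\<Prod>u\<in>U. f u (argmin_process B u \<omega>)) * (\<integral>y. g y \<partial>argmin_kernel t (argmin_process B s \<omega>)))"
proof (cases "t \<le> 1")
  case True
  show ?thesis by (rule expectation_argmin_process[OF U t True s f g])
next
  case False
  define r where "r = s + t - 1"
  have r: "0 \<le> r" "s + t = r + 1" "U \<subseteq> {0..r}" using False s U(2) by (auto simp: r_def)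
  have T: "(\<lambda>\<omega>. \<integral>y. g y \<partial>argmin_kernel 1 (argmin_process B r \<omega>)) \<in> borel_measurable M"
  proof -
    have "(\<lambda>x. \<integral>y. g y \<partial>argmin_kernel 1 x) \<in> borel_measurable borel_01"
      using continuous_on_subset[OF g(1)] by (intro continuous_on_01_measurable continuous_on_argmin_kernel_integral) auto
    then show ?thesis by (rule measurable_compose[OF argmin_process_measurable[OF r(1)]])
  qed
  have F: "(\<lambda>\<omega>. \<Prod>u\<in>U. f u (argmin_process B u \<omega>)) \<in> borel_measurable M"
  proof (rule borel_measurable_prod)
    fix u assume u: "u \<in> U"
    then have "f u \<in> borel_measurable borel" using f(1) by (intro borel_measurable_continuous_onI)
    moreover have "argmin_process B u \<in> borel_measurable M" using u U(2) by auto
    ultimately show "(\<lambda>\<omega>. f u (argmin_process B u \<omega>)) \<in> borel_measurable M" by (rule measurable_compose[rotated])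
  qed
  have "expectation (\<lambda>\<omega>. (\<Prod>u\<in>U. f u (argmin_process B u \<omega>)) * g (argmin_process B (s + t) \<omega>))
      = expectation (\<lambda>\<omega>. (\<Prod>u\<in>U. f u (argmin_process B u \<omega>)) * (\<integral>y. g y \<partial>argmin_kernel 1 (argmin_process B r \<omega>)))"
    unfolding r(2) by (rule expectation_argmin_process[OF U(1) r(3) _ _ r(1) f g]) auto
  also have "\<dots> = expectation (\<lambda>\<omega>. (\<Prod>u\<in>U. f u (argmin_process B u \<omega>)) * (\<integral>y. g y \<partial>argmin_kernel 1 0))"
  proof (rule integral_cong_AE)
    show "AE \<omega> in M. (\<Prod>u\<in>U. f u (argmin_process B u \<omega>)) * (\<integral>y. g y \<partial>argmin_kernel 1 (argmin_process B r \<omega>))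
        = (\<Prod>u\<in>U. f u (argmin_process B u \<omega>)) * (\<integral>y. g y \<partial>argmin_kernel 1 0)"
      using AE_argmin_process_neq[OF r(1), of 1] AE_space
    proof eventually_elim
      case (elim \<omega>)
      then have "argmin_process B r \<omega> \<in> {0..<1}" using argmin_process_greatest(1)[OF elim(2) r(1)] by auto
      then show ?case by (simp only: argmin_kernel_1)
    qed
  qed (use T F in auto)
  also have "\<dots> = expectation (\<lambda>\<omega>. (\<Prod>u\<in>U. f u (argmin_process B u \<omega>)) * (\<integral>y. g y \<partial>argmin_kernel t (argmin_process B s \<omega>)))"
    using False by (simp add: argmin_kernel_after_1)
  finally show ?thesis .
qed

text \<open>Time 2 is at lag greater than 1 from time 0, so the law there is the arcsine law read
  off from the kernel, whatever the state at time 0. Its density is positive on the open unit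
  interval, so a continuous nonnegative function with zero mean cannot be positive anywhere.\<close>

lemma argmin_process_full_support:
  fixes h :: "real \<Rightarrow> real"
  assumes h: "continuous_on {0..1} h" "\<And>y. y \<in> {0..1} \<Longrightarrow> 0 \<le> h y"
    and zero: "expectation (\<lambda>\<omega>. h (argmin_process B 2 \<omega>)) = 0" and x: "x \<in> {0..1}"
  shows "h x = 0"
proof (rule ccontr)
  assume "h x \<noteq> 0"
  then have hx: "0 < h x" using h(2)[OF x] by simp
  define g where "g y = h (max 0 (min 1 y))" for y
  have g: "continuous_on UNIV g" unfolding g_def[abs_def] by (rule continuous_on_clamp[OF h(1)])
  obtain C where C: "\<And>y. y \<in> {0..1} \<Longrightarrow> \<bar>h y\<bar> \<le> C" using continuous_on_01_bounded[OF h(1)] by blast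
  have gb: "\<bar>g y\<bar> \<le> C" "0 \<le> g y" for y unfolding g_def by (auto intro!: C h(2))
  have [measurable]: "g \<in> borel_measurable borel" using g by (rule borel_measurable_continuous_onI)
  define q where "q = (\<lambda>y. 1 / (pi * sqrt (y * (1 - y))))"
  have [measurable]: "q \<in> borel_measurable borel" unfolding q_def by measurable
  have q: "0 < q y" if "y \<in> {0<..<1}" for y using that by (simp add: q_def)
  have "expectation (\<lambda>\<omega>. g (argmin_process B (0 + 2) \<omega>)) = expectation (\<lambda>\<omega>. \<integral>y. g y \<partial>argmin_kernel 2 (argmin_process B 0 \<omega>))"
    using expectation_argmin_process_product[of "{}" 0 2 undefined g C] g gb by simp
  also have "\<dots> = (\<integral>y. g y \<partial>density_01 q)"
    using prob_space by (simp add: argmin_kernel_def q_def)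
  also have "\<dots> = (\<integral>y. indicator {0<..<1} y * q y * g y \<partial>lborel)"
    using q by (intro integral_density_01) (auto simp: less_imp_le intro: measurable_restrict_space1)
  finally have "(\<integral>y. indicator {0<..<1} y * q y * g y \<partial>lborel) = expectation (\<lambda>\<omega>. g (argmin_process B 2 \<omega>))" by simp
  also have "\<dots> = expectation (\<lambda>\<omega>. h (argmin_process B 2 \<omega>))"
  proof (intro Bochner_Integration.integral_cong refl)
    fix \<omega> assume "\<omega> \<in> space M"
    then have "argmin_process B 2 \<omega> \<in> {0..1}" by (intro argmin_process_greatest(1)) auto
    then show "g (argmin_process B 2 \<omega>) = h (argmin_process B 2 \<omega>)" by (simp add: g_def)
  qed
  finally have zero': "(\<integral>y. indicator {0<..<1} y * q y * g y \<partial>lborel) = 0" using zero by simp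
  have int: "integrable lborel (\<lambda>y. indicator {0<..<1} y * q y * g y)"
  proof -
    interpret Q: prob_space "argmin_kernel 2 0" by (rule prob_space_argmin_kernel) auto
    have S: "{0..1} \<in> sets borel_01" using sets.top[of borel_01] by (simp add: space_restrict_space)
    have "{0<..<1} \<inter> {0..1} = {0<..<1 :: real}" by auto
    then have "(\<integral>\<^sup>+y. ennreal (indicator {0<..<1} y * q y) \<partial>lborel) = emeasure (density_01 q) {0..1}"
      by (simp add: emeasure_density_01[OF _ S])
    also have "density_01 q = argmin_kernel 2 0" by (simp add: argmin_kernel_def q_def)
    also have "emeasure (argmin_kernel 2 0) {0..1} = 1" using Q.emeasure_space_1 by (simp only: space_argmin_kernel)
    finally have "integrable lborel (\<lambda>y. indicator {0<..<1} y * q y)"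
      using q by (intro integrableI_nonneg) (auto split: split_indicator simp: less_imp_le)
    then have "integrable lborel (\<lambda>y. C * (indicator {0<..<1} y * q y))" by (rule integrable_mult_right)
    then show ?thesis
    proof (rule Bochner_Integration.integrable_bound)
      show "AE y in lborel. norm (indicator {0<..<1} y * q y * g y) \<le> norm (C * (indicator {0<..<1} y * q y))"
      proof (rule AE_I2)
        fix y
        have "\<bar>indicator {0<..<1} y * q y\<bar> * \<bar>g y\<bar> \<le> \<bar>indicator {0<..<1} y * q y\<bar> * \<bar>C\<bar>"
          using gb(1)[of y] by (intro mult_left_mono) auto
        then show "norm (indicator {0<..<1} y * q y * g y) \<le> norm (C * (indicator {0<..<1} y * q y))"
          by (simp only: abs_mult real_norm_def mult.commute mult.left_commute)
      qed
    qed measurable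
  qed
  have AE0: "AE y in lborel. indicator {0<..<1} y * q y * g y = 0"
    using integral_nonneg_eq_0_iff_AE[OF int] zero' q gb(2)
    by (auto split: split_indicator simp: less_imp_le intro!: AE_I2 mult_nonneg_nonneg)
  have "isCont g x" using g by (simp add: continuous_on_eq_continuous_at)
  moreover have "g x = h x" using x by (simp add: g_def)
  ultimately have "\<forall>\<^sub>F y in nhds x. 0 < g y"
    using hx order_tendstoD(1)[of g "g x" "at x" 0] by (simp add: isCont_def eventually_nhds_conv_at)
  then obtain d where d: "0 < d" "\<And>y. \<bar>y - x\<bar> < d \<Longrightarrow> 0 < g y"
    by (auto simp: eventually_nhds_metric dist_real_def)
  define a b where "a = max 0 (x - d)" and "b = min 1 (x + d)"
  have ab: "a < b" using d x by (auto simp: a_def b_def)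
  have "AE y in lborel. y \<notin> {a<..<b}"
    using AE0
  proof eventually_elim
    case (elim y)
    show ?case
    proof
      assume "y \<in> {a<..<b}"
      then have "y \<in> {0<..<1}" "\<bar>y - x\<bar> < d" by (auto simp: a_def b_def)
      then show False using elim q[of y] d(2)[of y] by auto
    qed
  qed
  then have "emeasure lborel {a<..<b} = 0"
    by (subst (asm) AE_iff_measurable[of "{a<..<b}"]) auto
  then show False using ab by simp
qed

text \<open>Both sides are continuous in \<open>x\<close>, and by the Markov property they agree almost surely at
  \<open>x = argmin_process B 2\<close>.\<close>

lemma chapman_kolmogorov_continuous:
  fixes f :: "real \<Rightarrow> real"
  assumes s: "0 < s" and t: "0 < t" and f: "continuous_on {0..1} f" and x: "x \<in> {0..1}"
  shows "(\<integral>y. f y \<partial>argmin_kernel (s + t) x) = (\<integral>z. (\<integral>y. f y \<partial>argmin_kernel t z) \<partial>argmin_kernel s x)"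
proof -
  define T where "T r h z = (\<integral>y. h y \<partial>argmin_kernel r z)" for r :: real and h :: "real \<Rightarrow> real" and z
  define ext where "ext h y = h (max 0 (min 1 y))" for h :: "real \<Rightarrow> real" and y
  have ext_cont: "continuous_on UNIV (ext h)" if "continuous_on {0..1} h" for h
    unfolding ext_def[abs_def] by (rule continuous_on_clamp[OF that])
  have ext_eq: "ext h y = h y" if "y \<in> {0..1}" for h y using that by (simp add: ext_def)
  have ext_bound: "\<exists>C. \<forall>y. \<bar>ext h y\<bar> \<le> C" if "continuous_on {0..1} h" for h
  proof -
    obtain C where "\<And>y. y \<in> {0..1} \<Longrightarrow> \<bar>h y\<bar> \<le> C" using continuous_on_01_bounded[OF \<open>continuous_on {0..1} h\<close>] by blast
    then show ?thesis by (auto simp: ext_def intro!: exI[of _ C])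
  qed
  have T_ext: "T r (ext h) = T r h" for r h
    unfolding T_def[abs_def] by (intro ext Bochner_Integration.integral_cong refl) (simp add: ext_eq)
  have T: "continuous_on {0..1} (T r h)" if "0 \<le> r" "continuous_on {0..1} h" for r h
    unfolding T_def[abs_def] using that by (rule continuous_on_argmin_kernel_integral)
  have markov: "expectation (\<lambda>\<omega>. \<phi> (argmin_process B u \<omega>) * h (argmin_process B (v + r) \<omega>))
      = expectation (\<lambda>\<omega>. \<phi> (argmin_process B u \<omega>) * T r h (argmin_process B v \<omega>))"
    if uv: "0 \<le> u" "u \<le> v" "0 < r" and \<phi>: "continuous_on UNIV \<phi>" "\<And>y. \<bar>\<phi> y\<bar> \<le> 1" and h: "continuous_on {0..1} h"
    for u v r :: real and \<phi> h :: "real \<Rightarrow> real"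
  proof -
    obtain C where C: "\<And>y. \<bar>ext h y\<bar> \<le> C" using ext_bound[OF h] by blast
    have "expectation (\<lambda>\<omega>. \<phi> (argmin_process B u \<omega>) * h (argmin_process B (v + r) \<omega>))
       = expectation (\<lambda>\<omega>. \<phi> (argmin_process B u \<omega>) * ext h (argmin_process B (v + r) \<omega>))"
    proof (intro Bochner_Integration.integral_cong refl)
      fix \<omega> assume "\<omega> \<in> space M"
      then have "argmin_process B (v + r) \<omega> \<in> {0..1}" using uv by (intro argmin_process_greatest(1)) auto
      then show "\<phi> (argmin_process B u \<omega>) * h (argmin_process B (v + r) \<omega>) = \<phi> (argmin_process B u \<omega>) * ext h (argmin_process B (v + r) \<omega>)"
        by (simp only: ext_eq)
    qed
    also have "\<dots> = expectation (\<lambda>\<omega>. \<phi> (argmin_process B u \<omega>) * T r (ext h) (argmin_process B v \<omega>))"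
      using expectation_argmin_process_product[of "{u}" v r "\<lambda>_. \<phi>" "ext h" C] uv \<phi> ext_cont[OF h] C by (simp add: T_def)
    finally show ?thesis by (simp only: T_ext)
  qed
  define w where "w z = T (s + t) f z - T s (T t f) z" for z
  have w: "continuous_on {0..1} w"
    unfolding w_def[abs_def] using s t f by (intro continuous_on_diff T) auto
  obtain K where K: "0 \<le> K" "\<And>y. y \<in> {0..1} \<Longrightarrow> \<bar>w y\<bar> \<le> K" using continuous_on_01_bounded[OF w] by blast
  \<comment> \<open>The test function is the difference \<open>w\<close> itself, so that the
    vanishing expectation is that of a multiple of its square. Division by \<open>K + 1\<close>
    meets the bound 1 and avoids a zero denominator.\<close>
  define \<phi> where "\<phi> y = ext w y / (K + 1)" for y
  have \<phi>: "continuous_on UNIV \<phi>" "\<bar>\<phi> y\<bar> \<le> 1" for y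
  proof -
    show "continuous_on UNIV \<phi>" unfolding \<phi>_def[abs_def] using ext_cont[OF w] K(1) by (intro continuous_intros) auto
    have "\<bar>ext w y\<bar> \<le> K" unfolding ext_def by (rule K(2)) auto
    then show "\<bar>\<phi> y\<bar> \<le> 1" using K(1) by (simp add: \<phi>_def)
  qed
  have integrable: "integrable M (\<lambda>\<omega>. \<phi> (argmin_process B 2 \<omega>) * h (argmin_process B 2 \<omega>))" if h: "continuous_on {0..1} h" for h
  proof -
    obtain C where C: "\<And>y. y \<in> {0..1} \<Longrightarrow> \<bar>h y\<bar> \<le> C" using continuous_on_01_bounded[OF h] by blast
    have "(\<lambda>\<omega>. h (argmin_process B 2 \<omega>)) \<in> borel_measurable M"
      by (rule measurable_compose[OF argmin_process_measurable continuous_on_01_measurable[OF h]]) simp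
    moreover have "(\<lambda>\<omega>. \<phi> (argmin_process B 2 \<omega>)) \<in> borel_measurable M"
      by (rule measurable_compose[OF argmin_process_measurable continuous_on_01_measurable[OF continuous_on_subset[OF \<phi>(1)]]]) auto
    moreover have "\<bar>\<phi> (argmin_process B 2 \<omega>)\<bar> * \<bar>h (argmin_process B 2 \<omega>)\<bar> \<le> 1 * C" if "\<omega> \<in> space M" for \<omega>
      using C[OF argmin_process_greatest(1)[OF that]] \<phi>(2) by (intro mult_mono) auto
    ultimately show ?thesis by (intro integrable_const_bound[where B = C]) (auto simp: abs_mult intro!: AE_I2)
  qed
  \<comment> \<open>The same expectation at time \<open>2 + s + t\<close> is evaluated by one step
    of length \<open>s + t\<close> and by two steps, with \<open>\<phi>\<close> carried along as a
    function of the past.\<close>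
  have "expectation (\<lambda>\<omega>. \<phi> (argmin_process B 2 \<omega>) * T (s + t) f (argmin_process B 2 \<omega>))
      = expectation (\<lambda>\<omega>. \<phi> (argmin_process B 2 \<omega>) * f (argmin_process B (2 + (s + t)) \<omega>))"
    using s t f \<phi> by (intro markov[symmetric]) auto
  also have "\<dots> = expectation (\<lambda>\<omega>. \<phi> (argmin_process B 2 \<omega>) * f (argmin_process B ((2 + s) + t) \<omega>))"
    by (simp add: add.assoc)
  also have "\<dots> = expectation (\<lambda>\<omega>. \<phi> (argmin_process B 2 \<omega>) * T t f (argmin_process B (2 + s) \<omega>))"
    using s t f \<phi> by (intro markov) auto
  also have "\<dots> = expectation (\<lambda>\<omega>. \<phi> (argmin_process B 2 \<omega>) * T s (T t f) (argmin_process B 2 \<omega>))"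
    using s t f \<phi> by (intro markov T) auto
  finally have "expectation (\<lambda>\<omega>. \<phi> (argmin_process B 2 \<omega>) * w (argmin_process B 2 \<omega>)) = 0"
    unfolding w_def right_diff_distrib using s t f
    by (subst Bochner_Integration.integral_diff) (auto intro!: integrable T)
  moreover have "(\<lambda>y. \<phi> y * w y) x = 0"
    if "expectation (\<lambda>\<omega>. (\<lambda>y. \<phi> y * w y) (argmin_process B 2 \<omega>)) = 0"
  proof (rule argmin_process_full_support[OF _ _ that x])
    show "continuous_on {0..1} (\<lambda>y. \<phi> y * w y)"
      by (intro continuous_on_mult w continuous_on_subset[OF \<phi>(1)]) auto
    show "0 \<le> \<phi> y * w y" if "y \<in> {0..1}" for y
      using that K(1) by (simp add: \<phi>_def ext_eq)
  qed
  ultimately have "\<phi> x * w x = 0" by simp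
  then have "w x = 0" using x K(1) by (simp add: \<phi>_def ext_eq)
  then show ?thesis by (simp add: w_def T_def)
qed

lemma chapman_kolmogorov:
  assumes s: "0 \<le> s" and t: "0 \<le> t" and x: "x \<in> {0..1}"
  shows "argmin_kernel (s + t) x = argmin_kernel s x \<bind> argmin_kernel t"
proof -
  have Q0: "argmin_kernel 0 = return borel_01" by (auto simp: argmin_kernel_def)
  have Qt: "argmin_kernel t \<in> borel_01 \<rightarrow>\<^sub>M prob_algebra borel_01" using t by (rule measurable_argmin_kernel)
  have Qs: "argmin_kernel s x \<in> space (prob_algebra borel_01)"
    using prob_space_argmin_kernel[OF s x] by (simp add: space_prob_algebra)
  consider "s = 0" | "t = 0" | "0 < s" "0 < t" using s t by linarith
  then show ?thesis
  proof cases
    case 1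
    then show ?thesis
      using x Q0 by (simp add: bind_return[OF measurable_prob_algebraD[OF Qt]] space_restrict_space)
  next
    case 2
    then show ?thesis by (simp add: Q0 bind_return'')
  next
    case 3
    show ?thesis
    proof (rule measure_01_eqI)
      show "prob_space (argmin_kernel (s + t) x)" using s t x by (intro prob_space_argmin_kernel) auto
      show "prob_space (argmin_kernel s x \<bind> argmin_kernel t)" by (rule prob_space_bind'[OF Qs Qt])
      show "sets (argmin_kernel s x \<bind> argmin_kernel t) = sets borel_01" by (rule sets_bind'[OF Qs Qt])
      fix f :: "real \<Rightarrow> real" assume f: "continuous_on UNIV f" "\<And>y. 0 \<le> f y" "\<And>y. f y \<le> 1"
      have f01: "continuous_on {0..1} f" using f(1) by (rule continuous_on_subset) simp
      have "(\<integral>y. f y \<partial>(argmin_kernel s x \<bind> argmin_kernel t)) = (\<integral>z. (\<integral>y. f y \<partial>argmin_kernel t z) \<partial>argmin_kernel s x)"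
        using f(2,3) by (intro integral_bind_kernel[OF Qs Qt continuous_on_01_measurable[OF f01], of 1]) auto
      then show "(\<integral>y. f y \<partial>argmin_kernel (s + t) x) = (\<integral>y. f y \<partial>(argmin_kernel s x \<bind> argmin_kernel t))"
        using chapman_kolmogorov_continuous[OF 3 f01 x] by simp
    qed simp
  qed
qed

end

section \<open>Conditional expectations given the natural filtration\<close>

lemma (in prob_space) integral_uniform_measure:
  fixes f :: "'a \<Rightarrow> real"
  assumes A: "A \<in> events" "0 < prob A" and [measurable]: "f \<in> borel_measurable M"
  shows "(\<integral>x. f x \<partial>uniform_measure M A) = (\<integral>x\<in>A. f x \<partial>M) / prob A"
proof -
  note [measurable] = A(1)
  have "indicator A x / emeasure M A = ennreal (indicator A x / prob A)" for x
    using A(2) by (auto simp: emeasure_eq_measure divide_ennreal[symmetric] split: split_indicator)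
  then have "uniform_measure M A = density M (\<lambda>x. ennreal (indicator A x / prob A))"
    unfolding uniform_measure_def by simp
  then have "(\<integral>x. f x \<partial>uniform_measure M A) = (\<integral>x. (indicator A x / prob A) *\<^sub>R f x \<partial>M)"
    by (simp add: integral_density)
  also have "\<dots> = (\<integral>x. (indicator A x *\<^sub>R f x) / prob A \<partial>M)"
    by (intro Bochner_Integration.integral_cong) auto
  also have "\<dots> = (\<integral>x\<in>A. f x \<partial>M) / prob A"
    unfolding set_lebesgue_integral_def by simp
  finally show ?thesis .
qed

context std_brownian_motion
begin

text \<open>A generating system closed under intersection. Half-lines are used because their
  indicators are limits of products of \<open>ramp\<close>; the empty index set contributes the
  whole space.\<close>

definition cylinders :: "real \<Rightarrow> 'w set set" where
  "cylinders s = {{\<omega> \<in> space M. \<forall>u\<in>U. argmin_process B u \<omega> \<le> c u} | U c. finite U \<and> U \<subseteq> {0..s}}"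

lemma cylinders_subset: "cylinders s \<subseteq> Pow (space M)"
  by (auto simp: cylinders_def)

lemma Int_stable_cylinders: "Int_stable (cylinders s)"
proof (rule Int_stableI)
  fix A A' assume "A \<in> cylinders s" "A' \<in> cylinders s"
  then obtain U c U' c' where U: "finite U" "U \<subseteq> {0..s}" "A = {\<omega> \<in> space M. \<forall>u\<in>U. argmin_process B u \<omega> \<le> c u}"
    and U': "finite U'" "U' \<subseteq> {0..s}" "A' = {\<omega> \<in> space M. \<forall>u\<in>U'. argmin_process B u \<omega> \<le> c' u}"
    by (auto simp: cylinders_def)
  define d where "d u = (if u \<in> U then if u \<in> U' then min (c u) (c' u) else c u else c' u)" for u
  have "A \<inter> A' = {\<omega> \<in> space M. \<forall>u\<in>U \<union> U'. argmin_process B u \<omega> \<le> d u}"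
    unfolding U(3) U'(3) by (auto simp: d_def)
  then show "A \<inter> A' \<in> cylinders s"
    unfolding cylinders_def using U U' by blast
qed

lemma cylinders_events: "cylinders s \<subseteq> events"
proof
  fix A assume "A \<in> cylinders s"
  then obtain U c where U: "finite U" "U \<subseteq> {0..s}" "A = {\<omega> \<in> space M. \<forall>u\<in>U. argmin_process B u \<omega> \<le> c u}"
    by (auto simp: cylinders_def)
  have "{\<omega> \<in> space M. argmin_process B u \<omega> \<le> c u} \<in> events" if "u \<in> U" for u
  proof -
    have [measurable]: "argmin_process B u \<in> borel_measurable M" using that U(2) by auto
    show ?thesis by measurable
  qed
  then show "A \<in> events" unfolding U(3) using U(1) by (intro sets.sets_Collect_finite_All) auto
qed

lemma sets_natural_filtration:
  "sets (natural_filtration M borel_01 (argmin_process B) s)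
     = sigma_sets (space M) (\<Union>u\<in>{0..s}. {argmin_process B u -` A \<inter> space M | A. A \<in> sets borel_01})"
  unfolding natural_filtration_def by (rule sets_measure_of) auto

lemma space_natural_filtration [simp]: "space (natural_filtration M borel_01 (argmin_process B) s) = space M"
  unfolding natural_filtration_def by (simp add: space_measure_of_conv)

lemma natural_filtration_cylinders:
  assumes "A \<in> sets (natural_filtration M borel_01 (argmin_process B) s)"
  shows "A \<in> sigma_sets (space M) (cylinders s)"
proof -
  define N where "N = sigma (space M) (cylinders s)"
  have N: "space N = space M" "sets N = sigma_sets (space M) (cylinders s)"
    unfolding N_def using cylinders_subset by (auto simp: space_measure_of_conv)
  have "argmin_process B u \<in> borel_measurable N" if "u \<in> {0..s}" for u
    unfolding borel_measurable_iff_le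
  proof
    fix a
    have "{\<omega> \<in> space N. argmin_process B u \<omega> \<le> a} = {\<omega> \<in> space M. \<forall>v\<in>{u}. argmin_process B v \<omega> \<le> (\<lambda>_. a) v}"
      by (simp add: N)
    also have "\<dots> \<in> cylinders s"
      unfolding cylinders_def using that by (intro CollectI exI[of _ "{u}"] exI[of _ "\<lambda>_. a"]) auto
    finally show "{\<omega> \<in> space N. argmin_process B u \<omega> \<le> a} \<in> sets N" by (simp add: N(2) sigma_sets.Basic)
  qed
  then have "argmin_process B u -` A \<inter> space M \<in> sigma_sets (space M) (cylinders s)" if "u \<in> {0..s}" "A \<in> sets borel_01" for u A
    using measurable_sets[of "argmin_process B u" N borel A] that sets_borel_01D[OF that(2)] by (simp add: N)
  then have "(\<Union>u\<in>{0..s}. {argmin_process B u -` A \<inter> space M | A. A \<in> sets borel_01}) \<subseteq> sets N"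
    by (auto simp: N(2))
  from sets.sigma_sets_subset[OF this] show ?thesis
    using assms by (auto simp: sets_natural_filtration N)
qed

lemma natural_filtration_measurable:
  "u \<in> {0..s} \<Longrightarrow> argmin_process B u \<in> natural_filtration M borel_01 (argmin_process B) s \<rightarrow>\<^sub>M borel_01"
proof (rule measurableI)
  show "argmin_process B u \<omega> \<in> space borel_01"
    if "u \<in> {0..s}" "\<omega> \<in> space (natural_filtration M borel_01 (argmin_process B) s)" for \<omega>
    using that argmin_process_greatest(1)[of \<omega> u] by (simp add: space_restrict_space)
  show "argmin_process B u -` A \<inter> space (natural_filtration M borel_01 (argmin_process B) s) \<in> sets (natural_filtration M borel_01 (argmin_process B) s)"
    if "u \<in> {0..s}" "A \<in> sets borel_01" for A
    unfolding sets_natural_filtration space_natural_filtration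
    using that by (intro sigma_sets.Basic UN_I[of u]) auto
qed

lemma subalgebra_natural_filtration: "subalgebra M (natural_filtration M borel_01 (argmin_process B) s)"
proof -
  have "argmin_process B u -` A \<inter> space M \<in> events" if "u \<in> {0..s}" "A \<in> sets borel_01" for u A
    using that argmin_process_measurable[of u] by (auto intro: measurable_sets)
  then have "sigma_sets (space M) (\<Union>u\<in>{0..s}. {argmin_process B u -` A \<inter> space M | A. A \<in> sets borel_01}) \<subseteq> events"
    by (intro sets.sigma_sets_subset) auto
  then show ?thesis by (simp add: subalgebra_def sets_natural_filtration)
qed

text \<open>On a cylinder the indicator is a bounded limit of products of \<open>ramp\<close>, to
  which the product form of the Markov property applies. The sets on which the integral of the
  difference vanishes are closed under complements and disjoint countable unions, so Dynkin's
  argument reaches the generated sigma-algebra.\<close>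

lemma set_integral_argmin_process:
  fixes g :: "real \<Rightarrow> real"
  assumes s: "0 \<le> s" and t: "0 < t" and g: "continuous_on UNIV g" "\<And>y. \<bar>g y\<bar> \<le> C"
    and A: "A \<in> sigma_sets (space M) (cylinders s)"
  shows "(\<integral>\<omega>\<in>A. g (argmin_process B (s + t) \<omega>) \<partial>M)
       = (\<integral>\<omega>\<in>A. (\<integral>y. g y \<partial>argmin_kernel t (argmin_process B s \<omega>)) \<partial>M)"
proof -
  define Y where "Y \<omega> = g (argmin_process B (s + t) \<omega>)" for \<omega>
  define Z where "Z \<omega> = (\<integral>y. g y \<partial>argmin_kernel t (argmin_process B s \<omega>))" for \<omega>
  have g01: "continuous_on {0..1} g" using g(1) by (rule continuous_on_subset) simp
  have Ym [measurable]: "Y \<in> borel_measurable M"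
    unfolding Y_def[abs_def] using s t
    by (intro measurable_compose[OF argmin_process_measurable continuous_on_01_measurable[OF g01]]) simp
  have Zm [measurable]: "Z \<in> borel_measurable M"
    unfolding Z_def[abs_def] using s t
    by (intro measurable_compose[OF argmin_process_measurable continuous_on_01_measurable[OF continuous_on_argmin_kernel_integral[OF _ g01]]]) auto
  have Yb: "\<bar>Y \<omega>\<bar> \<le> C" for \<omega> using g(2) by (simp add: Y_def)
  have Zb: "\<bar>Z \<omega>\<bar> \<le> C" if "\<omega> \<in> space M" for \<omega>
  proof -
    interpret Q: prob_space "argmin_kernel t (argmin_process B s \<omega>)"
      using t argmin_process_greatest(1)[OF that s] by (intro prob_space_argmin_kernel) auto
    have gm: "g \<in> borel_measurable (argmin_kernel t (argmin_process B s \<omega>))"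
      using continuous_on_01_measurable[OF g01] by (simp add: measurable_cong_sets[OF sets_argmin_kernel refl])
    have "\<bar>Z \<omega>\<bar> \<le> (\<integral>y. \<bar>g y\<bar> \<partial>argmin_kernel t (argmin_process B s \<omega>))"
      unfolding Z_def using integral_norm_bound[of _ g] by simp
    also have "\<dots> \<le> (\<integral>y. C \<partial>argmin_kernel t (argmin_process B s \<omega>))"
      using g(2) gm order_trans[OF abs_ge_zero g(2)[of 0]]
      by (intro integral_mono Q.integrable_const_bound[where B = C]) auto
    finally show ?thesis using Q.prob_space by simp
  qed
  have Yi: "integrable M Y" using Yb by (intro integrable_const_bound[where B = C]) auto
  have Zi: "integrable M Z" using Zb by (intro integrable_const_bound[where B = C]) (auto intro!: AE_I2)
  have base: "(\<integral>\<omega>\<in>A. (Y \<omega> - Z \<omega>) \<partial>M) = 0" if cyl: "A \<in> cylinders s" for A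
  proof -
    obtain U c where U: "finite U" "U \<subseteq> {0..s}" and A: "A = {\<omega> \<in> space M. \<forall>u\<in>U. argmin_process B u \<omega> \<le> c u}"
      using cyl by (auto simp: cylinders_def)
    have [measurable]: "A \<in> events" using cyl cylinders_events by auto
    define F where "F n \<omega> = (\<Prod>u\<in>U. ramp n (c u) (argmin_process B u \<omega>))" for n \<omega>
    have Fm [measurable]: "F n \<in> borel_measurable M" for n
      unfolding F_def[abs_def]
    proof (rule borel_measurable_prod)
      fix u assume "u \<in> U"
      then show "(\<lambda>\<omega>. ramp n (c u) (argmin_process B u \<omega>)) \<in> borel_measurable M"
        using U(2) by (intro measurable_compose[OF argmin_process_measurable continuous_on_01_measurable[OF continuous_on_ramp]]) auto
    qed
    have Fb: "\<bar>F n \<omega>\<bar> \<le> 1" for n \<omega>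
      unfolding F_def abs_prod using ramp_bounds by (intro prod_le_1) auto
    have Flim: "(\<lambda>n. F n \<omega>) \<longlonglongrightarrow> indicator A \<omega>" if \<omega>: "\<omega> \<in> space M" for \<omega>
    proof -
      have "(\<lambda>n. F n \<omega>) \<longlonglongrightarrow> (\<Prod>u\<in>U. of_bool (argmin_process B u \<omega> \<le> c u))"
        unfolding F_def by (intro tendsto_prod ramp_tendsto)
      moreover have "(\<Prod>u\<in>U. of_bool (argmin_process B u \<omega> \<le> c u)) = (indicator A \<omega> :: real)"
      proof (cases "\<omega> \<in> A")
        case True
        then show ?thesis by (auto simp: A)
      next
        case False
        then obtain u where "u \<in> U" "\<not> argmin_process B u \<omega> \<le> c u" using \<omega> by (auto simp: A)
        then show ?thesis using False U(1) by (auto simp: prod_zero_iff)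
      qed
      ultimately show ?thesis by simp
    qed
    have lim: "(\<lambda>n. expectation (\<lambda>\<omega>. F n \<omega> * V \<omega>)) \<longlonglongrightarrow> expectation (\<lambda>\<omega>. indicator A \<omega> * V \<omega>)"
      if [measurable]: "V \<in> borel_measurable M" and V: "\<And>\<omega>. \<omega> \<in> space M \<Longrightarrow> \<bar>V \<omega>\<bar> \<le> C" for V
    proof (rule integral_dominated_convergence[where w = "\<lambda>_. C"])
      show "AE \<omega> in M. (\<lambda>n. F n \<omega> * V \<omega>) \<longlonglongrightarrow> indicator A \<omega> * V \<omega>"
        by (intro AE_I2 tendsto_mult tendsto_const Flim)
      have "\<bar>F n \<omega>\<bar> * \<bar>V \<omega>\<bar> \<le> 1 * C" if "\<omega> \<in> space M" for n \<omega> using V[OF that] Fb by (intro mult_mono) auto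
      then show "AE \<omega> in M. norm (F n \<omega> * V \<omega>) \<le> C" for n by (auto simp: abs_mult intro!: AE_I2)
    qed auto
    have "expectation (\<lambda>\<omega>. F n \<omega> * Y \<omega>) = expectation (\<lambda>\<omega>. F n \<omega> * Z \<omega>)" for n
      unfolding F_def Y_def Z_def using ramp_bounds(3)
      by (intro expectation_argmin_process_product[OF U t s _ _ g] continuous_on_ramp)
    then have "expectation (\<lambda>\<omega>. indicator A \<omega> * Y \<omega>) = expectation (\<lambda>\<omega>. indicator A \<omega> * Z \<omega>)"
      using LIMSEQ_unique[OF lim[OF Ym Yb]] lim[OF Zm Zb] by simp
    moreover have "integrable M (\<lambda>\<omega>. indicator A \<omega> * Y \<omega>)" "integrable M (\<lambda>\<omega>. indicator A \<omega> * Z \<omega>)"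
      using integrable_mult_indicator[OF _ Yi, of A] integrable_mult_indicator[OF _ Zi, of A] by auto
    ultimately show ?thesis
      by (simp add: set_lebesgue_integral_def right_diff_distrib)
  qed
  have diff: "integrable M (\<lambda>\<omega>. Y \<omega> - Z \<omega>)" using Yi Zi by (rule Bochner_Integration.integrable_diff)
  have sigma: "A \<in> sigma_sets (space M) (cylinders s) \<Longrightarrow> A \<in> events" for A
    using sets.sigma_sets_subset[OF cylinders_events] by blast
  have si: "set_integrable M A (\<lambda>\<omega>. Y \<omega> - Z \<omega>)" if "A \<in> sigma_sets (space M) (cylinders s)" for A
    unfolding set_integrable_def using sigma[OF that] diff by (rule integrable_mult_indicator)
  have "(\<integral>\<omega>\<in>A. (Y \<omega> - Z \<omega>) \<partial>M) = 0"
    using Int_stable_cylinders cylinders_subset A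
  proof (induction rule: sigma_sets_induct_disjoint)
    case (basic A)
    then show ?case by (rule base)
  next
    case empty
    then show ?case by (simp add: set_lebesgue_integral_def)
  next
    case (compl A)
    have "space M \<in> cylinders s" unfolding cylinders_def by (auto intro!: exI[of _ "{}"])
    then have "(\<integral>\<omega>. Y \<omega> - Z \<omega> \<partial>M) = 0"
      using base[of "space M"] set_integral_space[OF diff] by simp
    moreover have "(\<integral>\<omega>\<in>space M - A. (Y \<omega> - Z \<omega>) \<partial>M) = (\<integral>\<omega>. Y \<omega> - Z \<omega> \<partial>M) - (\<integral>\<omega>\<in>A. (Y \<omega> - Z \<omega>) \<partial>M)"
    proof -
      have "(\<integral>\<omega>\<in>space M - A. (Y \<omega> - Z \<omega>) \<partial>M) = (\<integral>\<omega>. (Y \<omega> - Z \<omega>) - indicator A \<omega> *\<^sub>R (Y \<omega> - Z \<omega>) \<partial>M)"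
        unfolding set_lebesgue_integral_def by (intro Bochner_Integration.integral_cong) (auto split: split_indicator)
      also have "\<dots> = (\<integral>\<omega>. Y \<omega> - Z \<omega> \<partial>M) - (\<integral>\<omega>. indicator A \<omega> *\<^sub>R (Y \<omega> - Z \<omega>) \<partial>M)"
        using diff si[OF compl.hyps] unfolding set_integrable_def by (rule Bochner_Integration.integral_diff)
      finally show ?thesis by (simp add: set_lebesgue_integral_def)
    qed
    ultimately show ?case using compl by simp
  next
    case (union D)
    have D: "D i \<in> sigma_sets (space M) (cylinders s)" for i using union by auto
    have "(\<integral>\<omega>\<in>(\<Union>i. D i). (Y \<omega> - Z \<omega>) \<partial>M) = (\<Sum>i. \<integral>\<omega>\<in>D i. (Y \<omega> - Z \<omega>) \<partial>M)"
      using union(1) sigma[OF D] D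
      by (intro lebesgue_integral_countable_add si sigma_sets.Union) (auto simp: disjoint_family_on_def)
    then show ?case using union by simp
  qed
  moreover have "set_integrable M A Y" "set_integrable M A Z"
    unfolding set_integrable_def by (rule integrable_mult_indicator[OF sigma[OF A] Yi], rule integrable_mult_indicator[OF sigma[OF A] Zi])
  ultimately show ?thesis by (simp add: set_integral_diff Y_def[symmetric] Z_def[symmetric])
qed

text \<open>The set integrals are known only for continuous test functions. To reach the indicator
  of \<open>A\<close>, an event \<open>\<Gamma>\<close> of the past with positive probability is
  made the whole space by normalisation. The laws of the argmin at \<open>s + t\<close> and of the
  argmin at \<open>s\<close> followed by the kernel then agree on continuous functions, hence as
  measures.\<close>

lemma markov_process_argmin: "markov_process M borel_01 (argmin_process B) argmin_kernel"
  unfolding markov_process_def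
proof (intro conjI allI impI ballI)
  show "argmin_process B t \<in> M \<rightarrow>\<^sub>M borel_01" if "0 \<le> t" for t
    using that by (rule argmin_process_measurable)
  fix s t :: real and A assume s: "0 \<le> s" and t: "0 < t" and A: "A \<in> sets borel_01"
  let ?F = "natural_filtration M borel_01 (argmin_process B) s"
  interpret F: finite_measure_subalgebra M ?F
    by (intro finite_measure_subalgebra.intro finite_measure_subalgebra_axioms.intro subalgebra_natural_filtration finite_measure_axioms)
  have Q: "argmin_kernel t \<in> borel_01 \<rightarrow>\<^sub>M prob_algebra borel_01" using t by (intro measurable_argmin_kernel) simp
  have QA: "(\<lambda>x. measure (argmin_kernel t x) A) \<in> borel_measurable borel_01"
    using measurable_compose[OF measurable_prob_algebraD[OF Q] measurable_measure_subprob_algebra[OF A]] .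
  have \<alpha>s: "argmin_process B s \<in> M \<rightarrow>\<^sub>M borel_01" and \<alpha>st: "argmin_process B (s + t) \<in> M \<rightarrow>\<^sub>M borel_01"
    using s t by (auto intro!: argmin_process_measurable)
  have QM [measurable]: "(\<lambda>\<omega>. measure (argmin_kernel t (argmin_process B s \<omega>)) A) \<in> borel_measurable M"
    by (rule measurable_compose[OF \<alpha>s QA])
  have Q1: "measure (argmin_kernel t (argmin_process B s \<omega>)) A \<le> 1" if "\<omega> \<in> space M" for \<omega>
    using prob_space_argmin_kernel[OF _ argmin_process_greatest(1)[OF that s], of t] t by (simp add: prob_space.prob_le_1)
  have event [measurable]: "argmin_process B (s + t) -` A \<inter> space M \<in> events"
    using \<alpha>st A by (rule measurable_sets)
  show "AE \<omega> in M. real_cond_exp M ?F (indicat_real (argmin_process B (s + t) -` A \<inter> space M)) \<omega>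
      = measure (argmin_kernel t (argmin_process B s \<omega>)) A"
  proof (rule F.real_cond_exp_charact)
    show "integrable M (indicat_real (argmin_process B (s + t) -` A \<inter> space M))"
      by (rule integrable_const_bound[where B = 1]) auto
    show "integrable M (\<lambda>\<omega>. measure (argmin_kernel t (argmin_process B s \<omega>)) A)"
      using Q1 by (intro integrable_const_bound[where B = 1]) (auto intro!: AE_I2)
    show "(\<lambda>\<omega>. measure (argmin_kernel t (argmin_process B s \<omega>)) A) \<in> borel_measurable ?F"
      using s by (intro measurable_compose[OF natural_filtration_measurable QA]) auto
    fix \<Gamma> assume \<Gamma>: "\<Gamma> \<in> sets ?F"
    then have \<Gamma>' [measurable]: "\<Gamma> \<in> events" using subalgebra_natural_filtration by (auto simp: subalgebra_def)
    show "(\<integral>\<omega>\<in>\<Gamma>. indicat_real (argmin_process B (s + t) -` A \<inter> space M) \<omega> \<partial>M)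
       = (\<integral>\<omega>\<in>\<Gamma>. measure (argmin_kernel t (argmin_process B s \<omega>)) A \<partial>M)"
    proof (cases "prob \<Gamma> = 0")
      case True
      then have "AE \<omega> in M. \<omega> \<notin> \<Gamma>" using \<Gamma>' by (simp add: prob_eq_0)
      then have null: "(\<integral>\<omega>\<in>\<Gamma>. h \<omega> \<partial>M) = 0" for h :: "'w \<Rightarrow> real"
        unfolding set_lebesgue_integral_def by (intro integral_eq_zero_AE) (auto elim!: eventually_mono)
      show ?thesis by (simp only: null)
    next
      case False
      then have pos: "0 < prob \<Gamma>" by (simp add: zero_less_measure_iff)
      define N where "N = uniform_measure M \<Gamma>"
      have setsN: "sets N = sets M" by (simp add: N_def)
      interpret N: prob_space N
        unfolding N_def using pos by (intro prob_space_uniform_measure) (auto simp: emeasure_eq_measure)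
      have N\<alpha>: "argmin_process B s \<in> N \<rightarrow>\<^sub>M borel_01" "argmin_process B (s + t) \<in> N \<rightarrow>\<^sub>M borel_01"
        using \<alpha>s \<alpha>st by (simp_all add: measurable_cong_sets[OF setsN refl])
      define \<mu> where "\<mu> = distr N borel_01 (argmin_process B (s + t))"
      define \<rho> where "\<rho> = distr N borel_01 (argmin_process B s)"
      have \<mu>: "prob_space \<mu>" "sets \<mu> = sets borel_01"
        unfolding \<mu>_def using N\<alpha>(2) by (auto intro: N.prob_space_distr)
      have \<rho>: "prob_space \<rho>" "sets \<rho> = sets borel_01"
        unfolding \<rho>_def using N\<alpha>(1) by (auto intro: N.prob_space_distr)
      then have \<rho>': "\<rho> \<in> space (prob_algebra borel_01)" by (simp add: space_prob_algebra)
      have eq: "\<mu> = \<rho> \<bind> argmin_kernel t"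
      proof (rule measure_01_eqI[OF \<mu>])
        show "prob_space (\<rho> \<bind> argmin_kernel t)" by (rule prob_space_bind'[OF \<rho>' Q])
        show "sets (\<rho> \<bind> argmin_kernel t) = sets borel_01" by (rule sets_bind'[OF \<rho>' Q])
        fix f :: "real \<Rightarrow> real" assume f: "continuous_on UNIV f" "\<And>y. 0 \<le> f y" "\<And>y. f y \<le> 1"
        have f01: "continuous_on {0..1} f" using f(1) by (rule continuous_on_subset) simp
        note fm = continuous_on_01_measurable[OF f01]
        have Tm: "(\<lambda>x. \<integral>y. f y \<partial>argmin_kernel t x) \<in> borel_measurable borel_01"
          using t f01 by (intro continuous_on_01_measurable continuous_on_argmin_kernel_integral) auto
        have "(\<integral>y. f y \<partial>\<mu>) = (\<integral>\<omega>. f (argmin_process B (s + t) \<omega>) \<partial>N)"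
          unfolding \<mu>_def by (rule integral_distr[OF N\<alpha>(2) fm])
        also have "\<dots> = (\<integral>\<omega>\<in>\<Gamma>. f (argmin_process B (s + t) \<omega>) \<partial>M) / prob \<Gamma>"
          unfolding N_def by (rule integral_uniform_measure[OF \<Gamma>' pos measurable_compose[OF \<alpha>st fm]])
        also have "(\<integral>\<omega>\<in>\<Gamma>. f (argmin_process B (s + t) \<omega>) \<partial>M) = (\<integral>\<omega>\<in>\<Gamma>. (\<integral>y. f y \<partial>argmin_kernel t (argmin_process B s \<omega>)) \<partial>M)"
          using f by (intro set_integral_argmin_process[OF s t, of _ 1] natural_filtration_cylinders[OF \<Gamma>]) auto
        also have "\<dots> / prob \<Gamma> = (\<integral>\<omega>. (\<integral>y. f y \<partial>argmin_kernel t (argmin_process B s \<omega>)) \<partial>N)"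
          unfolding N_def by (rule integral_uniform_measure[OF \<Gamma>' pos measurable_compose[OF \<alpha>s Tm], symmetric])
        also have "\<dots> = (\<integral>x. (\<integral>y. f y \<partial>argmin_kernel t x) \<partial>\<rho>)"
          unfolding \<rho>_def by (rule integral_distr[OF N\<alpha>(1) Tm, symmetric])
        also have "\<dots> = (\<integral>y. f y \<partial>(\<rho> \<bind> argmin_kernel t))"
          using f by (intro integral_bind_kernel[OF \<rho>' Q fm, of 1, symmetric]) auto
        finally show "(\<integral>y. f y \<partial>\<mu>) = (\<integral>y. f y \<partial>(\<rho> \<bind> argmin_kernel t))" .
      qed
      interpret \<rho>: prob_space \<rho> by fact
      have "(\<integral>\<omega>\<in>\<Gamma>. indicat_real (argmin_process B (s + t) -` A \<inter> space M) \<omega> \<partial>M) / prob \<Gamma>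
          = (\<integral>\<omega>. indicat_real (argmin_process B (s + t) -` A \<inter> space M) \<omega> \<partial>N)"
        unfolding N_def by (rule integral_uniform_measure[OF \<Gamma>' pos, symmetric]) measurable
      also have "\<dots> = measure N (argmin_process B (s + t) -` A \<inter> space N)"
        using sets_eq_imp_space_eq[OF setsN] by simp
      also have "\<dots> = measure \<mu> A" unfolding \<mu>_def using N\<alpha>(2) A by (rule measure_distr[symmetric])
      also have "\<dots> = (\<integral>x. measure (argmin_kernel t x) A \<partial>\<rho>)"
        unfolding eq using measurable_prob_algebraD[OF Q] A
        by (intro \<rho>.measure_bind[where N = borel_01]) (simp_all add: measurable_cong_sets[OF \<rho>(2) refl])
      also have "\<dots> = (\<integral>\<omega>. measure (argmin_kernel t (argmin_process B s \<omega>)) A \<partial>N)"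
        unfolding \<rho>_def by (rule integral_distr[OF N\<alpha>(1) QA])
      also have "\<dots> = (\<integral>\<omega>\<in>\<Gamma>. measure (argmin_kernel t (argmin_process B s \<omega>)) A \<partial>M) / prob \<Gamma>"
        unfolding N_def by (rule integral_uniform_measure[OF \<Gamma>' pos QM])
      finally show ?thesis using pos by simp
    qed
  qed
qed

text \<open>Although only the kernel is mentioned, the proof takes place over a Brownian motion,
  because the Chapman-Kolmogorov equation is inherited from the process.\<close>

lemma feller_transition_semigroup_argmin_kernel: "feller_transition_semigroup_01 argmin_kernel"
proof -
  have Q0: "(\<integral>y. f y \<partial>argmin_kernel 0 x) = f x" if "continuous_on {0..1} f" "x \<in> {0..1}" for f :: "real \<Rightarrow> real" and x
    using that by (simp add: argmin_kernel_def integral_return space_restrict_space continuous_on_01_measurable)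
  have int: "integrable (argmin_kernel t x) f" and bound: "\<bar>\<integral>y. f y \<partial>argmin_kernel t x\<bar> \<le> C"
    if t: "0 \<le> t" and f: "continuous_on {0..1} f" "\<And>y. y \<in> {0..1} \<Longrightarrow> \<bar>f y\<bar> \<le> C" and x: "x \<in> {0..1}"
    for t x C and f :: "real \<Rightarrow> real"
  proof -
    interpret Q: prob_space "argmin_kernel t x" using t x by (rule prob_space_argmin_kernel)
    have fm: "f \<in> borel_measurable (argmin_kernel t x)"
      using continuous_on_01_measurable[OF f(1)] by (simp add: measurable_cong_sets[OF sets_argmin_kernel refl])
    show int: "integrable (argmin_kernel t x) f"
      using fm f(2) by (intro Q.integrable_const_bound[where B = C]) (auto intro!: AE_I2)
    have "\<bar>\<integral>y. f y \<partial>argmin_kernel t x\<bar> \<le> (\<integral>y. \<bar>f y\<bar> \<partial>argmin_kernel t x)"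
      using integral_norm_bound[of "argmin_kernel t x" f] by simp
    also have "\<dots> \<le> (\<integral>y. C \<partial>argmin_kernel t x)"
      using int f(2) by (intro integral_mono) auto
    finally show "\<bar>\<integral>y. f y \<partial>argmin_kernel t x\<bar> \<le> C" using Q.prob_space by simp
  qed
  have bdd: "bdd_above ((\<lambda>x. \<bar>f x\<bar>) ` {0..1})" if "continuous_on {0..1} f" for f :: "real \<Rightarrow> real"
    using continuous_on_01_bounded[OF that] by (metis (mono_tags, lifting) bdd_aboveI2)
  have "feller_semigroup_01 (\<lambda>t f x. \<integral>y. f y \<partial>argmin_kernel t x)"
  proof
    fix t :: real and f :: "real \<Rightarrow> real" assume t: "0 \<le> t" and f: "continuous_on {0..1} f"
    show "continuous_on {0..1} (\<lambda>x. \<integral>y. f y \<partial>argmin_kernel t x)"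
      using t f by (rule continuous_on_argmin_kernel_integral)
  next
    fix t x :: real and f g :: "real \<Rightarrow> real" assume "\<forall>y\<in>{0..1}. f y = g y"
    then show "(\<integral>y. f y \<partial>argmin_kernel t x) = (\<integral>y. g y \<partial>argmin_kernel t x)"
      by (intro Bochner_Integration.integral_cong) auto
  next
    fix t x a b :: real and f g :: "real \<Rightarrow> real"
    assume t: "0 \<le> t" and f: "continuous_on {0..1} f" and g: "continuous_on {0..1} g" and x: "x \<in> {0..1}"
    obtain C where "\<And>y. y \<in> {0..1} \<Longrightarrow> \<bar>f y\<bar> \<le> C" using continuous_on_01_bounded[OF f] by blast
    then have "integrable (argmin_kernel t x) f" by (rule int[OF t f _ x])
    moreover obtain D where "\<And>y. y \<in> {0..1} \<Longrightarrow> \<bar>g y\<bar> \<le> D" using continuous_on_01_bounded[OF g] by blast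
    then have "integrable (argmin_kernel t x) g" by (rule int[OF t g _ x])
    ultimately show "(\<integral>y. a * f y + b * g y \<partial>argmin_kernel t x) = a * (\<integral>y. f y \<partial>argmin_kernel t x) + b * (\<integral>y. g y \<partial>argmin_kernel t x)"
      by simp
  next
    fix t x :: real and f :: "real \<Rightarrow> real" assume "\<forall>y\<in>{0..1}. 0 \<le> f y"
    then show "0 \<le> (\<integral>y. f y \<partial>argmin_kernel t x)" by (intro Bochner_Integration.integral_nonneg) auto
  next
    fix t :: real and f :: "real \<Rightarrow> real" assume t: "0 \<le> t" and f: "continuous_on {0..1} f"
    show "(SUP x\<in>{0..1}. \<bar>\<integral>y. f y \<partial>argmin_kernel t x\<bar>) \<le> (SUP x\<in>{0..1}. \<bar>f x\<bar>)"
      by (intro cSUP_least bound[OF t f]) (auto intro!: cSUP_upper bdd f)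
  next
    fix f :: "real \<Rightarrow> real" and x :: real assume "continuous_on {0..1} f" "x \<in> {0..1}"
    then show "(\<integral>y. f y \<partial>argmin_kernel 0 x) = f x" by (rule Q0)
  next
    fix s t x :: real and f :: "real \<Rightarrow> real"
    assume st: "0 \<le> s" "0 \<le> t" and f: "continuous_on {0..1} f" and x: "x \<in> {0..1}"
    obtain C where C: "\<And>y. y \<in> {0..1} \<Longrightarrow> \<bar>f y\<bar> \<le> C" using continuous_on_01_bounded[OF f] by blast
    have "argmin_kernel s x \<in> space (prob_algebra borel_01)"
      using prob_space_argmin_kernel[OF st(1) x] by (simp add: space_prob_algebra)
    then show "(\<integral>y. f y \<partial>argmin_kernel (s + t) x) = (\<integral>z. (\<integral>y. f y \<partial>argmin_kernel t z) \<partial>argmin_kernel s x)"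
      unfolding chapman_kolmogorov[OF st x]
      using C by (rule integral_bind_kernel[OF _ measurable_argmin_kernel[OF st(2)] continuous_on_01_measurable[OF f]])
  next
    fix f :: "real \<Rightarrow> real" assume f: "continuous_on {0..1} f"
    show "((\<lambda>t. SUP x\<in>{0..1}. \<bar>(\<integral>y. f y \<partial>argmin_kernel t x) - f x\<bar>) \<longlongrightarrow> 0) (at_right 0)"
    proof (rule tendstoI)
      fix e :: real assume "0 < e"
      then have "0 < e / 2" by simp
      from argmin_kernel_strongly_continuous[OF f this] eventually_at_right_less[of 0]
      show "\<forall>\<^sub>F t in at_right 0. dist (SUP x\<in>{0..1}. \<bar>(\<integral>y. f y \<partial>argmin_kernel t x) - f x\<bar>) 0 < e"
      proof eventually_elim
        case (elim t)
        let ?h = "\<lambda>x. \<bar>(\<integral>y. f y \<partial>argmin_kernel t x) - f x\<bar>"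
        have "(SUP x\<in>{0..1}. ?h x) \<le> e / 2" using elim(1) by (intro cSUP_least) auto
        moreover have "?h 0 \<le> (SUP x\<in>{0..1}. ?h x)"
          using elim(1) by (intro cSUP_upper) (auto intro!: bdd_aboveI2[of _ _ "e / 2"])
        then have "0 \<le> (SUP x\<in>{0..1}. ?h x)" by (rule order_trans[rotated]) simp
        ultimately show ?case using \<open>0 < e\<close> by (simp add: dist_real_def)
      qed
    qed
  qed
  moreover have "argmin_kernel 0 x = return borel_01 x" for x by (simp add: argmin_kernel_def)
  ultimately show ?thesis
    unfolding feller_transition_semigroup_01_def using measurable_argmin_kernel chapman_kolmogorov by auto
qed

end

theorem theorem1p2:
  fixes M :: "'w measure" and B :: "real \<Rightarrow> 'w \<Rightarrow> real"
  assumes "std_brownian_motion M B"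
  shows "feller_transition_semigroup_01 argmin_kernel \<and>
    markov_process M borel_01 (argmin_process B) argmin_kernel"
proof -
  interpret std_brownian_motion M B by fact
  show ?thesis
    using feller_transition_semigroup_argmin_kernel markov_process_argmin by blast
qed

end
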